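(* Let $n\ge 1$, let $\varrho>0$ and $0<\zeta<\varrho+1$ be constants, and let $u_0:\mathbb{R}^n\to\mathbb{R}$ be a $C^2$ function satisfying $$(-1+\zeta)I\le D^2u_0(x)\le \varrho I\qquad\text{for all }x\in\mathbb{R}^n .$$ Then there exists a unique solution $u$ of the Cauchy problem $$\frac{\partial u}{\partial t}=F_{\pi/4}(D^2u)\quad (t>0,\ x\in\mathbb{R}^n),\qquad u(x,0)=u_0(x)\quad (x\in\mathbb{R}^n),$$ such that $u\in C^\infty(\mathbb{R}^n\times(0,+\infty))\cap C(\mathbb{R}^n\times[0,+\infty))$ and such that $u(\cdot,t)$ satisfies $(-1+\zeta)I\le D^2u(x,t)\le\varrho I$ for all $x\in\mathbb{R}^n$ and all $t>0$. Moreover, for every $l\in\{3,4,5,\dots\}$ and every $\varepsilon_0>0$ there is a constant $C$ depending (for the given $l$) only on $n,\zeta,\varrho,\frac1{\varepsilon_0}$ such that $$\sup_{x\in\mathbb{R}^n}|D^lu(x,t)|\le C\qquad\text{for all }t\in(\varepsilon_0,+\infty).$$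
   Context: $I$ is the $n\times n$ identity matrix, $D^2u$ is the Hessian of $u$ in the space variable $x$, $D^lu$ denotes the collection of all $l$-th order spatial derivatives, and matrix inequalities are in the sense of symmetric matrices. For a symmetric matrix with eigenvalues $\lambda_1,\dots,\lambda_n$ (all $>-1$), $F_{\pi/4}=-\sqrt2\sum_{i=1}^n\frac{1}{1+\lambda_i}$; $F_{\pi/4}(D^2u)$ is this function of the eigenvalues of $D^2u$. *)

theory Defs
  imports "HOL-Analysis.Analysis" "HOL-Computational_Algebra.Polynomial"
begin

definition partial_deriv :: "'a::euclidean_space \<Rightarrow> ('a \<Rightarrow> real) \<Rightarrow> 'a \<Rightarrow> real" where
  "partial_deriv b f x = frechet_derivative f (at x) b"

text \<open>
  \<open>C\<^sup>k\<close> functions on an open set \<open>S\<close>. Total differentiability of the lower-order derivatives is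
  implied by the continuity of the partial derivatives; requiring it makes \<^const>\<open>partial_deriv\<close>
  (which is arbitrary where the function is not differentiable) meaningful.
\<close>

primrec Ck_on :: "nat \<Rightarrow> 'a::euclidean_space set \<Rightarrow> ('a \<Rightarrow> real) \<Rightarrow> bool" where
  "Ck_on 0 S f \<longleftrightarrow> continuous_on S f"
| "Ck_on (Suc k) S f \<longleftrightarrow>
     (\<forall>x\<in>S. f differentiable (at x)) \<and> (\<forall>b\<in>Basis. Ck_on k S (partial_deriv b f))"

definition smooth_on :: "'a::euclidean_space set \<Rightarrow> ('a \<Rightarrow> real) \<Rightarrow> bool" where
  "smooth_on S f \<longleftrightarrow> (\<forall>k. Ck_on k S f)"

definition iter_partial :: "'n list \<Rightarrow> (real^'n \<Rightarrow> real) \<Rightarrow> real^'n \<Rightarrow> real" where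
  "iter_partial is f = foldr (\<lambda>i. partial_deriv (axis i 1)) is f"

definition hessian :: "(real^'n \<Rightarrow> real) \<Rightarrow> real^'n \<Rightarrow> real^'n^'n" where
  "hessian f x = (\<chi> i j. iter_partial [i, j] f x)"

text \<open>
  \<open>|D\<^sup>l f(x)|\<close>: the Euclidean norm of the family of all partial derivatives of order \<open>l\<close>, indexed
  by ordered \<open>l\<close>-tuples of coordinates.
\<close>

definition deriv_norm :: "nat \<Rightarrow> (real^'n \<Rightarrow> real) \<Rightarrow> real^'n \<Rightarrow> real" where
  "deriv_norm l f x = L2_set (\<lambda>is. iter_partial is f x) {is. length is = l}"

definition loewner_le :: "real^'n^'n \<Rightarrow> real^'n^'n \<Rightarrow> bool" where
  "loewner_le A B \<longleftrightarrow>
     transpose A = A \<and> transpose B = B \<and> (\<forall>v. v \<bullet> (A *v v) \<le> v \<bullet> (B *v v))"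

definition char_polynomial :: "real^'n^'n \<Rightarrow> real poly" where
  "char_polynomial A = det (mat [:0, 1:] - (\<chi> i j. [:A $ i $ j:]))"

text \<open>Real eigenvalues with algebraic multiplicity; for symmetric \<open>A\<close> these are all \<open>n\<close> of them.\<close>

definition eigenvalues :: "real^'n^'n \<Rightarrow> real multiset" where
  "eigenvalues A = proots (char_polynomial A)"

text \<open>\<open>F\<^bsub>\<pi>/4\<^esub>\<close>; only meaningful for symmetric matrices with all eigenvalues greater than \<open>-1\<close>.\<close>

definition F_pi4 :: "real^'n^'n \<Rightarrow> real" where
  "F_pi4 A = - sqrt 2 * (\<Sum>\<mu>\<in>#eigenvalues A. 1 / (1 + \<mu>))"

definition hessian_bounds :: "real \<Rightarrow> real \<Rightarrow> (real^'n \<Rightarrow> real) \<Rightarrow> bool" where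
  "hessian_bounds \<rho> \<zeta> f \<longleftrightarrow>
     (\<forall>x. loewner_le (mat (- 1 + \<zeta>)) (hessian f x) \<and> loewner_le (hessian f x) (mat \<rho>))"

text \<open>
  The class in which existence and uniqueness are asserted. The values \<open>u x t\<close> for \<open>t < 0\<close>
  are irrelevant.
\<close>

definition solves_cauchy ::
    "real \<Rightarrow> real \<Rightarrow> (real^'n \<Rightarrow> real) \<Rightarrow> (real^'n \<Rightarrow> real \<Rightarrow> real) \<Rightarrow> bool" where
  "solves_cauchy \<rho> \<zeta> u0 u \<longleftrightarrow>
     smooth_on (UNIV \<times> {0<..}) (\<lambda>(x, t). u x t) \<and>
     continuous_on (UNIV \<times> {0..}) (\<lambda>(x, t). u x t) \<and>
     (\<forall>x. \<forall>t>0. ((\<lambda>s. u x s) has_real_derivative F_pi4 (hessian (\<lambda>y. u y t) x)) (at t)) \<and>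
     (\<forall>x. u x 0 = u0 x) \<and>
     (\<forall>t>0. hessian_bounds \<rho> \<zeta> (\<lambda>y. u y t))"

end

theory Submission
  imports Defs "HOL-Probability.Probability"
begin

text \<open>
  Put \<open>w = u + |x|\<^sup>2/2\<close>, so that \<open>\<zeta> \<le> D\<^sup>2w \<le> \<rho> + 1\<close> and \<open>w\<^sub>t = - \<surd>2 tr (D\<^sup>2w)\<^sup>-\<^sup>1\<close>. If \<open>v(\<cdot>, t)\<close> is the Legendre
  transform of \<open>w(\<cdot>, t)\<close>, then \<open>D\<^sup>2v = (D\<^sup>2w)\<^sup>-\<^sup>1\<close> and \<open>v\<^sub>t = - w\<^sub>t\<close> at corresponding points, so the equation becomes
  the linear heat equation \<open>v\<^sub>t = \<surd>2 \<Delta>v\<close>. The Gaussian average of the transformed initial value keeps the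
  bounds \<open>1/(\<rho> + 1) \<le> D\<^sup>2v \<le> 1/\<zeta>\<close>, because these are equivalent to bounds on second differences, and its
  derivatives of parabolic order at least two are bounded for \<open>t > \<epsilon>\<close>, because their kernels annihilate affine
  functions and \<open>v\<close> differs from an affine function by a quadratic error. Transforming back by the
  inverse function theorem expresses the derivatives of \<open>w\<close> of order at least two as smooth functions of
  those of \<open>v\<close>, evaluated at the point \<open>y\<close> with \<open>Dv(y, t) = x\<close>.

  Any solution satisfies \<open>|u(x, t) - u\<^sub>0(x)| \<le> C t\<close>, so the difference of two solutions is bounded and
  the maximum principle with the barrier \<open>\<epsilon> (|x|\<^sup>2/2 + L t)\<close> gives uniqueness.
\<close>

section \<open>Partial derivatives\<close>

text \<open>Two obstacles shape the proof. The transform of the initial value is only known to lie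
  between paraboloids, so bounds on second derivatives are stated without derivatives
  (\<open>quad_at\<close>): touching paraboloids with openings \<open>a\<close> and
  \<open>b\<close>. The Legendre transform turns these openings into \<open>1/b\<close> and
  \<open>1/a\<close>, which is the origin of the constants \<open>1/(\<rho> + 1)\<close> and
  \<open>1/\<zeta>\<close>. Secondly, the transformed flow and its gradient may be unbounded, so
  uniform bounds can only begin with its space Hessian, its time derivative and the time derivative
  of its gradient. On the way back, the map \<open>leg_point\<close>, which inverts the map from (y,
  t) to (Dv(y, t), t), has a derivative that is a function of its own image point. Each derivative
  of a function composed with \<open>leg_point\<close> is therefore again a bounded function
  composed with \<open>leg_point\<close>, and induction on the order needs no formula for higher
  derivatives of an inverse. The bound for an arbitrary solution rests on uniqueness, which
  identifies it with the constructed one.\<close>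

lemma partial_deriv_eq: "(f has_derivative f') (at x) \<Longrightarrow> partial_deriv b f x = f' b"
  unfolding partial_deriv_def using frechet_derivative_at by metis

lemma has_derivative_partial_deriv:
  assumes "f differentiable (at x)"
  shows "(f has_derivative (\<lambda>h. \<Sum>b\<in>Basis. (h \<bullet> b) * partial_deriv b f x)) (at x)"
proof -
  have d: "(f has_derivative frechet_derivative f (at x)) (at x)"
    using assms frechet_derivative_works by blast
  then interpret bounded_linear "frechet_derivative f (at x)" by (rule has_derivative_bounded_linear)
  have "frechet_derivative f (at x) h = (\<Sum>b\<in>Basis. (h \<bullet> b) * partial_deriv b f x)" for h
    by (subst euclidean_representation[of h, symmetric]) (simp add: sum scaleR partial_deriv_def)
  then have "frechet_derivative f (at x) = (\<lambda>h. \<Sum>b\<in>Basis. (h \<bullet> b) * partial_deriv b f x)" by blast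
  then show ?thesis using d by simp
qed

lemma has_derivative_cong_open:
  "open S \<Longrightarrow> x \<in> S \<Longrightarrow> (\<And>y. y \<in> S \<Longrightarrow> f y = g y) \<Longrightarrow> (f has_derivative f') (at x) \<longleftrightarrow> (g has_derivative f') (at x)"
  by (metis has_derivative_transform_within_open)

lemma differentiable_cong_open:
  "open S \<Longrightarrow> x \<in> S \<Longrightarrow> (\<And>y. y \<in> S \<Longrightarrow> f y = g y) \<Longrightarrow> f differentiable (at x) \<longleftrightarrow> g differentiable (at x)"
  unfolding differentiable_def using has_derivative_cong_open[of S x f g] by blast

lemma partial_deriv_cong_open:
  assumes "open S" "x \<in> S" "\<And>y. y \<in> S \<Longrightarrow> f y = g y"
  shows "partial_deriv b f x = partial_deriv b g x"
  unfolding partial_deriv_def frechet_derivative_def using has_derivative_cong_open[OF assms] by simp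

lemma Ck_on_cong:
  assumes "open S" "\<And>x. x \<in> S \<Longrightarrow> f x = g x"
  shows "Ck_on k S f \<longleftrightarrow> Ck_on k S g"
  using assms(2)
proof (induction k arbitrary: f g)
  case 0
  then show ?case by (simp cong: continuous_on_cong)
next
  case (Suc k)
  have "Ck_on k S (partial_deriv b f) \<longleftrightarrow> Ck_on k S (partial_deriv b g)" for b
    using Suc.prems by (intro Suc.IH partial_deriv_cong_open[OF assms(1)])
  then show ?case using differentiable_cong_open[OF assms(1) _ Suc.prems] by auto
qed

lemma Ck_on_continuous: "open S \<Longrightarrow> Ck_on k S f \<Longrightarrow> continuous_on S f"
  by (cases k) (auto intro!: differentiable_imp_continuous_on differentiable_at_imp_differentiable_on)

lemma Ck_on_Suc_imp: "open S \<Longrightarrow> Ck_on (Suc k) S f \<Longrightarrow> Ck_on k S f"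
proof (induction k arbitrary: f)
  case 0
  then show ?case by (simp add: Ck_on_continuous[of S "Suc 0"])
qed auto

lemma Ck_on_Union:
  assumes "\<And>T. T \<in> C \<Longrightarrow> open T" "\<And>T. T \<in> C \<Longrightarrow> Ck_on k T f"
  shows "Ck_on k (\<Union>C) f"
  using assms(2)
proof (induction k arbitrary: f)
  case 0
  then show ?case using continuous_on_open_Union[of C f] assms(1) by simp
qed auto

lemma has_derivative_gradient:
  fixes f :: "real^'n \<Rightarrow> real"
  assumes "f differentiable (at x)"
  shows "(f has_derivative (\<lambda>h. (\<chi> i. partial_deriv (axis i 1) f x) \<bullet> h)) (at x)"
proof -
  have "(\<Sum>b\<in>Basis. (h \<bullet> b) * partial_deriv b f x) = (\<chi> i. partial_deriv (axis i 1) f x) \<bullet> h" for h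
  proof -
    have B: "Basis = range (\<lambda>i::'n. axis i (1::real))" by (auto simp: Basis_vec_def)
    have "(\<chi> i. partial_deriv (axis i 1) f x) \<bullet> h = (\<Sum>i\<in>UNIV. h $ i * partial_deriv (axis i 1) f x)"
      by (simp add: inner_vec_def mult.commute)
    then show ?thesis
      unfolding B by (subst sum.reindex) (auto simp: inj_on_def axis_eq_axis inner_axis)
  qed
  then show ?thesis using has_derivative_partial_deriv[OF assms] by simp
qed

text \<open>Row \<open>i\<close> of \<open>hessian f x\<close> holds the derivatives of the gradient
  in direction \<open>i\<close>. The derivative of the gradient therefore acts by
  \<open>h v* hessian f x\<close>, a form in which no symmetry of mixed partial derivatives
  enters.\<close>

lemma C2_gradient_hessian:
  fixes f :: "real^'n \<Rightarrow> real"
  assumes "Ck_on 2 UNIV f"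
  shows "(f has_derivative (\<lambda>h. (\<chi> i. partial_deriv (axis i 1) f x) \<bullet> h)) (at x)"
    and "((\<lambda>x. \<chi> i. partial_deriv (axis i 1) f x) has_derivative (\<lambda>h. h v* hessian f x)) (at x)"
proof -
  have f: "f differentiable (at x)" and pf: "partial_deriv (axis i 1) f differentiable (at x)" for i
    using assms by (auto simp: numeral_2_eq_2)
  show "(f has_derivative (\<lambda>h. (\<chi> i. partial_deriv (axis i 1) f x) \<bullet> h)) (at x)"
    by (rule has_derivative_gradient[OF f])
  show "((\<lambda>x. \<chi> i. partial_deriv (axis i 1) f x) has_derivative (\<lambda>h. h v* hessian f x)) (at x)"
  proof (subst has_derivative_componentwise_within, rule ballI)
    fix b :: "real^'n" assume "b \<in> Basis"
    then obtain k where b: "b = axis k 1" by (auto simp: Basis_vec_def)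
    have "(\<lambda>h. (\<chi> i. partial_deriv (axis i 1) (partial_deriv (axis k 1) f) x) \<bullet> h) = (\<lambda>h. (h v* hessian f x) $ k)"
      by (simp add: vector_matrix_mult_def hessian_def iter_partial_def inner_vec_def mult.commute)
    then show "((\<lambda>x. (\<chi> i. partial_deriv (axis i 1) f x) \<bullet> b) has_derivative (\<lambda>h. (h v* hessian f x) \<bullet> b)) (at x)"
      using has_derivative_gradient[OF pf[of k]] by (simp add: b inner_axis)
  qed
qed

lemma has_derivative_slice:
  assumes "(g has_derivative g') (at (y, t))"
  shows "((\<lambda>y. g (y, t)) has_derivative (\<lambda>h. g' (h, 0))) (at y)"
proof -
  have "((\<lambda>y. (y, t)) has_derivative (\<lambda>h. (h, 0))) (at y)" by (auto intro!: derivative_eq_intros)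
  from has_derivative_compose[OF this assms] show ?thesis .
qed

lemma partial_deriv_slice:
  assumes "g differentiable (at (y, t))"
  shows "partial_deriv b (\<lambda>y. g (y, t)) y = partial_deriv (b, 0) g (y, t)"
proof -
  obtain g' where g': "(g has_derivative g') (at (y, t))" using assms by (auto simp: differentiable_def)
  show ?thesis using partial_deriv_eq[OF has_derivative_slice[OF g']] partial_deriv_eq[OF g'] by simp
qed

lemma Ck_on_slice:
  assumes "Ck_on k (UNIV \<times> I) g" "t \<in> I"
  shows "Ck_on k UNIV (\<lambda>y. g (y, t))"
  using assms(1)
proof (induction k arbitrary: g)
  case 0
  then show ?case using assms(2) by (auto intro!: continuous_intros elim: continuous_on_compose2)
next
  case (Suc k)
  have d: "g differentiable (at (y, t))" for y using Suc.prems assms(2) by auto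
  have "partial_deriv b (\<lambda>y. g (y, t)) = (\<lambda>y. partial_deriv (b, 0) g (y, t))" for b
    using partial_deriv_slice[OF d] by auto
  moreover have "(\<lambda>y. g (y, t)) differentiable (at y)" for y
    using d has_derivative_slice unfolding differentiable_def by blast
  moreover have "Ck_on k UNIV (\<lambda>y. partial_deriv (b, 0) g (y, t))" if "b \<in> Basis" for b
    using Suc.prems that by (intro Suc.IH) (auto simp: Basis_prod_def)
  ultimately show ?case by simp
qed

section \<open>Symmetric matrices\<close>

lemma symmetric_matrix_inner:
  fixes A :: "real^'n^'n"
  assumes "transpose A = A"
  shows "(A *v x) \<bullet> y = x \<bullet> (A *v y)"
  by (metis assms dot_lmul_matrix transpose_matrix_vector)

lemma loewner_quadratic_form:
  fixes A :: "real^'n^'n"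
  shows "(\<forall>v. v \<bullet> (mat c *v v) \<le> v \<bullet> (A *v v)) \<longleftrightarrow> (\<forall>v. c * (v \<bullet> v) \<le> v \<bullet> (A *v v))"
    and "(\<forall>v. v \<bullet> (A *v v) \<le> v \<bullet> (mat c *v v)) \<longleftrightarrow> (\<forall>v. v \<bullet> (A *v v) \<le> c * (v \<bullet> v))"
proof -
  have *: "mat c = c *\<^sub>R (mat 1 :: real^'n^'n)"
    by (simp add: mat_def vec_eq_iff)
  have "v \<bullet> ((mat c :: real^'n^'n) *v v) = c * (v \<bullet> v)" for v
    by (simp add: * scaleR_matrix_vector_assoc[symmetric])
  then show "(\<forall>v. v \<bullet> (mat c *v v) \<le> v \<bullet> (A *v v)) \<longleftrightarrow> (\<forall>v. c * (v \<bullet> v) \<le> v \<bullet> (A *v v))"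
    and "(\<forall>v. v \<bullet> (A *v v) \<le> v \<bullet> (mat c *v v)) \<longleftrightarrow> (\<forall>v. v \<bullet> (A *v v) \<le> c * (v \<bullet> v))"
    by simp_all
qed

text \<open>The maximum of the quadratic form on the unit sphere of an invariant subspace is attained at
  an eigenvector.\<close>

lemma symmetric_eigenvector_in_subspace:
  fixes A :: "real^'n^'n"
  assumes sym: "transpose A = A" and sub: "subspace S" and inv: "\<And>x. x \<in> S \<Longrightarrow> A *v x \<in> S"
    and ne: "x0 \<in> S" "x0 \<noteq> 0"
  obtains e l where "e \<in> S" "norm e = 1" "A *v e = l *\<^sub>R e"
proof -
  let ?K = "S \<inter> sphere 0 1"
  define q where "q v = v \<bullet> (A *v v)" for v
  have "compact ?K"
    using closed_subspace[OF sub] by (simp add: closed_Int_compact)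
  moreover have "(1 / norm x0) *\<^sub>R x0 \<in> ?K"
    using ne sub by (simp add: subspace_scale)
  hence "?K \<noteq> {}" by blast
  moreover have "continuous_on ?K q"
    unfolding q_def by (intro continuous_intros linear_continuous_on matrix_vector_mul_bounded_linear)
  ultimately obtain e where e: "e \<in> ?K" and max: "\<And>y. y \<in> ?K \<Longrightarrow> q y \<le> q e"
    using continuous_attains_sup[of ?K q] by metis
  have eS: "e \<in> S" and ne1: "e \<bullet> e = 1"
    using e by (auto simp: norm_eq_1)
  have max': "q y \<le> q e * (y \<bullet> y)" if "y \<in> S" for y
  proof (cases "y = 0")
    case False
    have "q ((1 / norm y) *\<^sub>R y) \<le> q e"
      using False that sub by (intro max) (simp add: subspace_scale)
    then have "q y / (norm y)^2 \<le> q e"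
      by (simp add: q_def matrix_vector_mult_scaleR power2_eq_square)
    then show ?thesis using False by (simp add: divide_le_eq power2_norm_eq_inner)
  qed (simp add: q_def)
  have orth: "h \<bullet> (A *v e) = 0" if h: "h \<in> S" "h \<bullet> e = 0" for h
  proof -
    have *: "2 * s * (h \<bullet> (A *v e)) \<le> s^2 * (q e * (h \<bullet> h) - q h)" for s
    proof -
      have "q (e + s *\<^sub>R h) \<le> q e * ((e + s *\<^sub>R h) \<bullet> (e + s *\<^sub>R h))"
        using h eS sub by (intro max') (simp add: subspace_add subspace_scale)
      moreover have "(e + s *\<^sub>R h) \<bullet> (e + s *\<^sub>R h) = 1 + s^2 * (h \<bullet> h)"
        using h ne1 by (simp add: algebra_simps inner_commute power2_eq_square)
      moreover have "q (e + s *\<^sub>R h) = q e + 2 * s * (h \<bullet> (A *v e)) + s^2 * q h"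
        using symmetric_matrix_inner[OF sym, of h e]
        by (simp add: q_def matrix_vector_mult_scaleR matrix_vector_right_distrib algebra_simps
            inner_commute power2_eq_square)
      ultimately have "q e + 2 * s * (h \<bullet> (A *v e)) + s^2 * q h \<le> q e * (1 + s^2 * (h \<bullet> h))"
        by simp
      then show ?thesis by (simp only: distrib_left right_diff_distrib) (simp add: mult_ac)
    qed
    show ?thesis
    proof (rule ccontr)
      define b where "b = h \<bullet> (A *v e)"
      define d where "d = q e * (h \<bullet> h) - q h"
      assume "h \<bullet> (A *v e) \<noteq> 0"
      then have b: "b \<noteq> 0" by (simp add: b_def)
      have *: "2 * s * b \<le> s^2 * d" for s using * by (simp add: b_def d_def)
      \<comment> \<open>The step \<open>s\<close> has the sign of \<open>b\<close> and is so short
        that the term of order \<open>s^2\<close> cannot compensate the linear gain.\<close>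
      have "2 * (b / (\<bar>d\<bar> + 1)) * b \<le> (b / (\<bar>d\<bar> + 1))^2 * d" by (rule *)
      also have "\<dots> \<le> (b / (\<bar>d\<bar> + 1))^2 * (\<bar>d\<bar> + 1)" by (intro mult_left_mono) auto
      also have "\<dots> = b^2 / (\<bar>d\<bar> + 1)" by (simp add: power2_eq_square)
      finally have "2 * (b^2 / (\<bar>d\<bar> + 1)) \<le> b^2 / (\<bar>d\<bar> + 1)" by (simp add: power2_eq_square)
      moreover have "b^2 / (\<bar>d\<bar> + 1) > 0" using b by (intro divide_pos_pos) auto
      ultimately show False by linarith
    qed
  qed
  define h where "h = A *v e - q e *\<^sub>R e"
  have hS: "h \<in> S" unfolding h_def using eS inv sub by (simp add: subspace_diff subspace_scale)
  have "h \<bullet> e = (A *v e) \<bullet> e - q e * (e \<bullet> e)" by (simp add: h_def inner_diff_left)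
  then have he: "h \<bullet> e = 0" using ne1 inner_commute[of "A *v e" e] by (simp add: q_def)
  have "h \<bullet> h = h \<bullet> (A *v e) - q e * (h \<bullet> e)" by (simp add: h_def inner_diff_right)
  then have "h = 0" using orth[OF hS he] he by simp
  then have "A *v e = q e *\<^sub>R e" by (simp add: h_def)
  then show ?thesis using that eS ne1 norm_eq_1 by blast
qed

text \<open>Take an orthonormal set of eigenvectors of largest cardinality. Its orthogonal
  complement is invariant under \<open>A\<close> by symmetry, so a nontrivial complement would
  contain one more unit eigenvector.\<close>

lemma symmetric_orthonormal_eigenbasis:
  fixes A :: "real^'n^'n"
  assumes sym: "transpose A = A"
  obtains e l where "\<And>i j. e (i::'n) \<bullet> e j = (if i = j then 1 else 0)" "\<And>i. A *v e i = l i *\<^sub>R e i"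
proof -
  define P where "P B \<longleftrightarrow> pairwise orthogonal B \<and> (\<forall>b\<in>B. norm b = 1 \<and> (\<exists>l. A *v b = l *\<^sub>R b))" for B
  have indep: "independent B" if "P B" for B
    using that by (intro pairwise_orthogonal_independent) (auto simp: P_def)
  have card: "card B \<le> CARD('n)" "finite B" if "P B" for B
    using independent_bound[OF indep[OF that]] by (auto simp: dim_UNIV)
  have "P {}" by (simp add: P_def)
  then obtain B where B: "P B" and maxB: "\<And>C. P C \<Longrightarrow> card C \<le> card B"
    using ex_has_greatest_nat[of P "{}" card "CARD('n) + 1"] card by fastforce
  have "card B = CARD('n)"
  proof (rule ccontr)
    assume "card B \<noteq> CARD('n)"
    then have "dim B < DIM(real^'n)" using card[OF B] dim_eq_card_independent[OF indep[OF B]] by simp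
    then obtain x where x: "x \<noteq> 0" "\<And>y. y \<in> span B \<Longrightarrow> orthogonal x y"
      using orthogonal_to_subspace_exists by blast
    define S where "S = {x. \<forall>b\<in>B. x \<bullet> b = 0}"
    have "subspace S" by (auto simp: S_def subspace_def inner_add_left)
    moreover have "x \<in> S" using x span_base by (auto simp: S_def orthogonal_def)
    moreover have "A *v y \<in> S" if "y \<in> S" for y
    proof -
      have "(A *v y) \<bullet> b = 0" if b: "b \<in> B" for b
      proof -
        obtain l where "A *v b = l *\<^sub>R b" using B b by (auto simp: P_def)
        then show ?thesis using symmetric_matrix_inner[OF sym, of y b] \<open>y \<in> S\<close> b by (simp add: S_def)
      qed
      then show ?thesis by (simp add: S_def)
    qed
    ultimately obtain e l where e: "e \<in> S" "norm e = 1" "A *v e = l *\<^sub>R e"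
      using symmetric_eigenvector_in_subspace[OF sym] x by metis
    have "e \<notin> B" using e by (auto simp: S_def norm_eq_1)
    moreover have "P (insert e B)"
      using B e by (auto simp: P_def S_def pairwise_insert orthogonal_def inner_commute)
    ultimately show False using maxB[of "insert e B"] card[OF B] by simp
  qed
  then obtain e where e: "bij_betw e (UNIV::'n set) B"
    using card[OF B] finite_same_card_bij[of "UNIV::'n set" B] by auto
  have "\<forall>i. \<exists>l. A *v e i = l *\<^sub>R e i"
    using B e by (auto simp: P_def bij_betw_def)
  then obtain l where l: "\<And>i. A *v e i = l i *\<^sub>R e i" by metis
  have "e i \<bullet> e j = (if i = j then 1 else 0)" for i j
  proof (cases "i = j")
    case True
    then show ?thesis using B e by (auto simp: P_def bij_betw_def norm_eq_1)
  next
    case False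
    then have "e i \<noteq> e j" using e by (auto simp: bij_betw_def inj_on_def)
    then show ?thesis using False B e unfolding P_def bij_betw_def pairwise_def orthogonal_def by auto
  qed
  then show ?thesis using that l by blast
qed

section \<open>Characteristic polynomial and the trace formula for \<open>F_pi4\<close>\<close>

lemma proots_prod_linear:
  "finite S \<Longrightarrow> proots (\<Prod>i\<in>S. [:- l i, 1::'a::idom:]) = image_mset l (mset_set S)"
  by (induction S rule: finite_induct)
    (simp_all add: proots_mult del: mult_pCons_left mult_pCons_right)

lemma map_matrix_poly_mult:
  fixes A B :: "real^'n^'n"
  shows "(\<chi> i j. [:(A ** B) $ i $ j:]) = (\<chi> i j. [:A $ i $ j:]) ** (\<chi> i j. [:B $ i $ j:])"
proof -
  have "(\<Sum>k\<in>S. [:f k::real:]) = [:\<Sum>k\<in>S. f k:]" for S :: "'n set" and f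
    by (induction S rule: infinite_finite_induct) auto
  then show ?thesis by (simp add: matrix_matrix_mult_def vec_eq_iff mult.commute)
qed

lemma orthonormal_columns:
  fixes e :: "'n \<Rightarrow> real^'n"
  assumes "\<And>i j. e i \<bullet> e j = (if i = j then 1 else 0)"
  shows "(\<chi> i j. e j $ i) ** transpose (\<chi> i j. e j $ i) = mat 1"
proof -
  have "transpose (\<chi> i j. e j $ i) ** (\<chi> i j. e j $ i) = mat 1"
    using assms by (simp add: transpose_def matrix_matrix_mult_def mat_def vec_eq_iff inner_vec_def)
  then show ?thesis by (rule matrix_left_right_inverse[THEN iffD1])
qed

text \<open>Over the polynomial ring, the characteristic matrix of \<open>A\<close> is conjugated by
  the orthogonal matrix of eigenvectors into a diagonal one, so the characteristic polynomial is a
  product of linear factors and \<open>proots\<close> can be read off with multiplicity.\<close>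

lemma eigenvalues_eq:
  fixes A :: "real^'n^'n"
  assumes e: "\<And>i j. e (i::'n) \<bullet> e j = (if i = j then 1 else 0)" and l: "\<And>i. A *v e i = l i *\<^sub>R e i"
  shows "eigenvalues A = image_mset l (mset_set UNIV)"
proof -
  define P where "P = (\<chi> i j. e j $ i)"
  define D where "D = (\<chi> i j. if i = j then l i else 0)"
  have PtP: "P ** transpose P = mat 1" unfolding P_def by (rule orthonormal_columns[OF e])
  have "A ** P = P ** D"
  proof -
    have "(A ** P) $ i $ j = (P ** D) $ i $ j" for i j
    proof -
      have "(A ** P) $ i $ j = (A *v e j) $ i" by (simp add: P_def matrix_matrix_mult_def matrix_vector_mult_def)
      also have "\<dots> = l j * e j $ i" by (simp add: l)
      also have "\<dots> = (P ** D) $ i $ j"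
        by (simp add: P_def D_def matrix_matrix_mult_def if_distrib cong: if_cong)
      finally show ?thesis .
    qed
    then show ?thesis by (simp add: vec_eq_iff)
  qed
  then have A: "A = P ** D ** transpose P"
    by (metis PtP matrix_mul_assoc matrix_mul_rid)
  define c where "c M = (\<chi> i j. [:M $ i $ j:])" for M :: "real^'n^'n"
  have c_mult: "c (M ** N) = c M ** c N" for M N by (simp add: c_def map_matrix_poly_mult)
  have c1: "c (mat 1) = mat 1" by (simp add: c_def mat_def vec_eq_iff one_pCons)
  \<comment> \<open>A scalar matrix commutes with \<open>c P\<close>, so conjugation leaves it
    unchanged.\<close>
  have X: "c P ** mat [:0, 1:] ** c (transpose P) = mat [:0, 1:]"
  proof -
    have "c P ** mat [:0,1:] = mat [:0,1:] ** c P"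
      by (simp add: vec_eq_iff matrix_matrix_mult_def mat_def if_distrib if_distribR mult.commute cong: if_cong)
    then show ?thesis
      by (metis c1 c_mult PtP matrix_mul_assoc matrix_mul_rid)
  qed
  have distr: "U ** (V - W) = U ** V - U ** W" "(V - W) ** U = V ** U - W ** U" for U V W :: "real poly^'n^'n"
    by (simp_all add: matrix_matrix_mult_def vec_eq_iff algebra_simps sum_subtractf)
  have "mat [:0, 1:] - c A = c P ** (mat [:0, 1:] - c D) ** c (transpose P)"
    by (simp add: distr X A c_mult)
  then have "char_polynomial A = det (c P) * det (mat [:0, 1:] - c D) * det (c (transpose P))"
    unfolding char_polynomial_def c_def[symmetric] by (simp add: det_mul)
  also have "\<dots> = det (c P ** c (transpose P)) * det (mat [:0, 1:] - c D)"
    by (simp add: det_mul)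
  also have "c P ** c (transpose P) = mat 1" using c_mult PtP c1 by metis
  also have "det (mat [:0, 1:] - c D) = (\<Prod>i\<in>UNIV. [:- l i, 1:])"
    by (subst det_diagonal) (auto simp: mat_def c_def D_def)
  finally show ?thesis by (simp add: eigenvalues_def proots_prod_linear)
qed

text \<open>The trace of \<open>B\<close> is computed in an eigenbasis of \<open>A\<close>, where
  \<open>B\<close> has the diagonal entries \<open>1 / (1 + l i)\<close>; the left inverse itself
  rules out \<open>1 + l i = 0\<close>. The trace form links \<open>F_pi4\<close> to the Laplacian
  of the transformed flow.\<close>

lemma F_pi4_eq_trace:
  fixes A :: "real^'n^'n"
  assumes sym: "transpose A = A" and inv: "B ** (mat 1 + A) = mat 1"
  shows "F_pi4 A = - sqrt 2 * trace B"
proof -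
  obtain e l where e: "\<And>i j. e (i::'n) \<bullet> e j = (if i = j then 1 else 0)"
    and l: "\<And>i. A *v e i = l i *\<^sub>R e i"
    using symmetric_orthonormal_eigenbasis[OF sym] by blast
  have 1: "(1 + l i) *\<^sub>R (B *v e i) = e i" for i
  proof -
    have "e i = (B ** (mat 1 + A)) *v e i" by (simp add: inv)
    also have "\<dots> = B *v (e i + l i *\<^sub>R e i)"
      by (simp add: matrix_vector_mul_assoc[symmetric] matrix_vector_mult_add_rdistrib l)
    also have "\<dots> = (1 + l i) *\<^sub>R (B *v e i)"
      by (simp add: matrix_vector_right_distrib matrix_vector_mult_scaleR algebra_simps)
    finally show ?thesis by simp
  qed
  have ne: "1 + l i \<noteq> 0" for i using 1[of i] e[of i i] by auto
  define P where "P = (\<chi> i j. e j $ i)"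
  have PtP: "P ** transpose P = mat 1" unfolding P_def by (rule orthonormal_columns[OF e])
  have "trace B = trace (B ** (P ** transpose P))" by (simp add: PtP)
  also have "\<dots> = trace (transpose P ** (B ** P))" by (metis matrix_mul_assoc trace_mul_sym)
  also have "\<dots> = (\<Sum>i\<in>UNIV. e i \<bullet> (B *v e i))"
    by (simp add: trace_def P_def transpose_def matrix_matrix_mult_def matrix_vector_mult_def inner_vec_def)
  also have "\<dots> = (\<Sum>i\<in>UNIV. 1 / (1 + l i))"
  proof (rule sum.cong)
    fix i
    have "(1 + l i) * (e i \<bullet> (B *v e i)) = 1"
      using arg_cong[OF 1[of i], of "\<lambda>x. e i \<bullet> x"] e[of i i] by simp
    then show "e i \<bullet> (B *v e i) = 1 / (1 + l i)" using ne[of i] by (simp add: field_simps)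
  qed simp
  finally show ?thesis
    by (simp add: F_pi4_def eigenvalues_eq[OF e l] image_mset.compositionality o_def
        sum_unfold_sum_mset[symmetric])
qed

text \<open>By Cauchy-Schwarz the lower bound on the form gives
  \<open>a * norm v \<le> norm (A *v v)\<close>, hence injectivity and the norm bound for the
  inverse.\<close>

lemma positive_definite_inverse:
  fixes A :: "real^'n^'n"
  assumes a: "a > 0" and A: "\<And>v. a * (v \<bullet> v) \<le> v \<bullet> (A *v v)"
  obtains B where "B ** A = mat 1" "A ** B = mat 1" "\<And>v. norm (B *v v) \<le> norm v / a"
proof -
  have bnd: "a * norm v \<le> norm (A *v v)" for v
  proof (cases "v = 0")
    case False
    have "a * (norm v)^2 \<le> norm v * norm (A *v v)"
      using A[of v] norm_cauchy_schwarz[of v "A *v v"] by (simp add: power2_norm_eq_inner)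
    then show ?thesis using False by (simp add: power2_eq_square)
  qed simp
  have "inj ((*v) A)"
  proof (rule injI)
    fix x y assume "A *v x = A *v y"
    then have "A *v (x - y) = 0" by (simp add: matrix_vector_mult_diff_distrib)
    then have "a * norm (x - y) \<le> 0" using bnd[of "x - y"] by simp
    then show "x = y" using a by (simp add: mult_le_0_iff)
  qed
  then obtain B where B: "B ** A = mat 1"
    using matrix_left_invertible_injective by blast
  then have B': "A ** B = mat 1" by (rule matrix_left_right_inverse[THEN iffD1])
  have "norm (B *v v) \<le> norm v / a" for v
    using bnd[of "B *v v"] a by (simp add: matrix_vector_mul_assoc B' field_simps)
  then show ?thesis using that B B' by blast
qed

lemma symmetric_inverse:
  fixes A :: "real^'n^'n"
  assumes "transpose A = A" "B ** A = mat 1"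
  shows "transpose B = B"
proof -
  have "A ** transpose B = mat 1" using assms by (metis matrix_transpose_mul transpose_mat)
  then show ?thesis using assms(2) by (metis matrix_mul_assoc matrix_mul_lid matrix_mul_rid)
qed

text \<open>With \<open>v = B *v h\<close>, positivity of the form of \<open>A\<close> at
  \<open>s h - v\<close> is a quadratic inequality in \<open>s\<close>; the choice
  \<open>s = 1 / b\<close> gives the lower bound. The upper bound combines
  \<open>a |v|^2 \<le> h \<bullet> v\<close> with the nonnegativity of
  \<open>|h - a v|^2\<close>.\<close>

lemma inverse_quadratic_form_bounds:
  fixes A :: "real^'n^'n"
  assumes sym: "transpose A = A" and inv: "A ** B = mat 1" and ab: "0 < a" "0 < b"
    and A: "\<And>v. a * (v \<bullet> v) \<le> v \<bullet> (A *v v)" "\<And>v. v \<bullet> (A *v v) \<le> b * (v \<bullet> v)"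
  shows "(1 / b) * (h \<bullet> h) \<le> h \<bullet> (B *v h)" "h \<bullet> (B *v h) \<le> (1 / a) * (h \<bullet> h)"
proof -
  define v where "v = B *v h"
  have Av: "A *v v = h" by (simp add: v_def matrix_vector_mul_assoc inv)
  have key: "0 \<le> (h \<bullet> h) * (s^2 * k) - 2 * s * (h \<bullet> h) + h \<bullet> v" if "h \<bullet> (A *v h) \<le> k * (h \<bullet> h)" for s k
  proof -
    have "0 \<le> a * ((s *\<^sub>R h - v) \<bullet> (s *\<^sub>R h - v))" using ab by simp
    also have "\<dots> \<le> (s *\<^sub>R h - v) \<bullet> (A *v (s *\<^sub>R h - v))" by (rule A)
    also have "\<dots> = s^2 * (h \<bullet> (A *v h)) - 2 * s * (h \<bullet> h) + h \<bullet> v"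
      using symmetric_matrix_inner[OF sym, of v h]
      by (simp add: matrix_vector_mult_diff_distrib matrix_vector_mult_scaleR Av algebra_simps
          inner_commute power2_eq_square)
    also have "\<dots> \<le> s^2 * (k * (h \<bullet> h)) - 2 * s * (h \<bullet> h) + h \<bullet> v"
      using mult_left_mono[OF that, of "s^2"] by simp
    finally show ?thesis by (simp add: algebra_simps)
  qed
  show "(1 / b) * (h \<bullet> h) \<le> h \<bullet> (B *v h)"
    using key[OF A(2), of "1 / b"] ab by (simp add: v_def power2_eq_square)
  have "a * (v \<bullet> v) \<le> h \<bullet> v" using A(1)[of v] by (simp add: Av inner_commute)
  moreover have "0 \<le> (h - a *\<^sub>R v) \<bullet> (h - a *\<^sub>R v)" by simp
  then have "0 \<le> h \<bullet> h - 2 * a * (h \<bullet> v) + a * (a * (v \<bullet> v))"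
    by (simp add: algebra_simps inner_commute)
  moreover have "a * (a * (v \<bullet> v)) \<le> a * (h \<bullet> v)" using calculation(1) ab by (intro mult_left_mono) auto
  ultimately have "a * (h \<bullet> v) \<le> h \<bullet> h" by linarith
  then show "h \<bullet> (B *v h) \<le> (1 / a) * (h \<bullet> h)" using ab by (simp add: v_def field_simps)
qed

lemma loewner_shift:
  fixes A :: "real^'n^'n"
  assumes "loewner_le (mat (- 1 + \<zeta>)) A"
  shows "\<zeta> * (v \<bullet> v) \<le> v \<bullet> ((mat 1 + A) *v v)"
proof -
  have "(- 1 + \<zeta>) * (v \<bullet> v) \<le> v \<bullet> (A *v v)"
    using assms loewner_quadratic_form(1) unfolding loewner_le_def by blast
  then show ?thesis by (simp add: matrix_vector_mult_add_rdistrib inner_add_right algebra_simps)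
qed

lemma matrix_entry_le:
  fixes A :: "real^'n^'n"
  assumes "\<And>v. norm (A *v v) \<le> norm v / a"
  shows "\<bar>A $ i $ j\<bar> \<le> 1 / a"
proof -
  have "A $ i $ j = (A *v axis j 1) $ i" by (simp add: matrix_vector_mult_basis column_def)
  also have "\<bar>\<dots>\<bar> \<le> norm (A *v axis j 1)" by (rule component_le_norm_cart)
  also have "\<dots> \<le> 1 / a" using assms[of "axis j 1"] by simp
  finally show ?thesis .
qed

section \<open>Boundedness and monotonicity of \<open>F_pi4\<close>\<close>

lemma F_pi4_bound:
  fixes A :: "real^'n^'n"
  assumes \<zeta>: "\<zeta> > 0" and A: "loewner_le (mat (- 1 + \<zeta>)) A"
  shows "\<bar>F_pi4 A\<bar> \<le> sqrt 2 * (CARD('n) / \<zeta>)"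
proof -
  have sym: "transpose A = A" using A by (simp add: loewner_le_def)
  obtain B where B: "B ** (mat 1 + A) = mat 1" "\<And>v. norm (B *v v) \<le> norm v / \<zeta>"
    using positive_definite_inverse[OF \<zeta> loewner_shift[OF A]] by metis
  have "\<bar>B $ i $ i\<bar> \<le> 1 / \<zeta>" for i by (rule matrix_entry_le[OF B(2)])
  then have "\<bar>trace B\<bar> \<le> (\<Sum>i\<in>(UNIV::'n set). 1 / \<zeta>)"
    unfolding trace_def by (intro order_trans[OF sum_abs] sum_mono)
  then have "sqrt 2 * \<bar>trace B\<bar> \<le> sqrt 2 * (CARD('n) / \<zeta>)" by (intro mult_left_mono) simp_all
  then show ?thesis by (simp add: F_pi4_eq_trace[OF sym B(1)] abs_mult)
qed

text \<open>Inversion reverses the order of positive definite matrices, and an excess of size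
  \<epsilon> costs at most \<epsilon> / \<zeta>^2 in each diagonal entry of the inverse. With
  \<open>x = Q *v h\<close> and \<open>v = P *v h\<close>, this follows by expanding the nonnegative
  form of \<open>mat 1 + A'\<close> at \<open>x - v\<close> and using that \<open>|v|\<close> is at
  most \<open>|h|\<close> / \<zeta>. It is the ellipticity that the maximum principle needs.\<close>

lemma F_pi4_perturbation:
  fixes A A' :: "real^'n^'n" and \<epsilon> :: real
  assumes \<zeta>: "\<zeta> > (0::real)" and A: "loewner_le (mat (- 1 + \<zeta>)) A" and A': "loewner_le (mat (- 1 + \<zeta>)) A'"
    and eps: "\<epsilon> \<ge> (0::real)" and le: "\<And>v. v \<bullet> (A' *v v) \<le> v \<bullet> (A *v v) + \<epsilon> * (v \<bullet> v)"
  shows "F_pi4 A' \<le> F_pi4 A + sqrt 2 * (CARD('n) * \<epsilon> / \<zeta>^2)"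
proof -
  have sym: "transpose A = A" "transpose A' = A'" using A A' by (auto simp: loewner_le_def)
  then have sym1: "transpose (mat 1 + A') = mat 1 + A'"
    by (simp add: transpose_def vec_eq_iff mat_def)
  obtain P where P: "P ** (mat 1 + A) = mat 1" "(mat 1 + A) ** P = mat 1" "\<And>v. norm (P *v v) \<le> norm v / \<zeta>"
    using positive_definite_inverse[OF \<zeta> loewner_shift[OF A]] by metis
  obtain Q where Q: "Q ** (mat 1 + A') = mat 1" "(mat 1 + A') ** Q = mat 1"
    using positive_definite_inverse[OF \<zeta> loewner_shift[OF A']] by metis
  have key: "h \<bullet> (P *v h) \<le> h \<bullet> (Q *v h) + \<epsilon> * (h \<bullet> h) / \<zeta>^2" for h
  proof -
    define v where "v = P *v h"
    define x where "x = Q *v h"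
    have Av: "(mat 1 + A) *v v = h" by (simp add: v_def matrix_vector_mul_assoc P)
    have Ax: "(mat 1 + A') *v x = h" by (simp add: x_def matrix_vector_mul_assoc Q)
    have "0 \<le> \<zeta> * ((x - v) \<bullet> (x - v))" using \<zeta> by simp
    also have "\<dots> \<le> (x - v) \<bullet> ((mat 1 + A') *v (x - v))" by (rule loewner_shift[OF A'])
    also have "\<dots> = x \<bullet> h - 2 * (v \<bullet> h) + v \<bullet> ((mat 1 + A') *v v)"
      using symmetric_matrix_inner[OF sym1, of v x]
      by (simp only: matrix_vector_mult_diff_distrib Ax) (simp add: algebra_simps inner_commute Ax)
    also have "v \<bullet> ((mat 1 + A') *v v) \<le> v \<bullet> ((mat 1 + A) *v v) + \<epsilon> * (v \<bullet> v)"
      using le[of v] by (simp add: matrix_vector_mult_add_rdistrib inner_add_right)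
    also have "v \<bullet> ((mat 1 + A) *v v) = v \<bullet> h" by (simp add: Av)
    also have "\<epsilon> * (v \<bullet> v) \<le> \<epsilon> * ((h \<bullet> h) / \<zeta>^2)"
    proof (intro mult_left_mono eps)
      have "(norm v)^2 \<le> (norm h / \<zeta>)^2" using P(3)[of h] by (intro power_mono) (auto simp: v_def)
      then show "v \<bullet> v \<le> (h \<bullet> h) / \<zeta>^2" by (simp add: power2_norm_eq_inner power_divide)
    qed
    finally show ?thesis by (simp add: v_def x_def inner_commute)
  qed
  have d: "M $ i $ i = axis i 1 \<bullet> (M *v axis i 1)" for M :: "real^'n^'n" and i
    by (simp add: inner_axis' matrix_vector_mult_basis column_def)
  have "trace P \<le> (\<Sum>i\<in>UNIV. Q $ i $ i + \<epsilon> / \<zeta>^2)"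
    unfolding trace_def
  proof (rule sum_mono)
    fix i show "P $ i $ i \<le> Q $ i $ i + \<epsilon> / \<zeta>^2"
      using key[of "axis i 1"] by (simp add: d[of P] d[of Q] inner_axis_axis)
  qed
  also have "\<dots> = trace Q + CARD('n) * \<epsilon> / \<zeta>^2" by (simp add: trace_def sum.distrib)
  finally have "sqrt 2 * trace P \<le> sqrt 2 * (trace Q + CARD('n) * \<epsilon> / \<zeta>^2)" by (intro mult_left_mono) auto
  then show ?thesis
    by (simp add: F_pi4_eq_trace[OF sym(1) P(1)] F_pi4_eq_trace[OF sym(2) Q(1)] algebra_simps)
qed

section \<open>Quadratic bounds and the Legendre transform\<close>

text \<open>If \<open>d\<close> were positive, \<phi>' would be positive just to the right of its
  zero at 0, and the mean value theorem would give a value of \<phi> above the maximum. The second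
  derivative is only required at 0.\<close>

lemma second_derivative_nonpos_at_max:
  fixes \<phi> :: "real \<Rightarrow> real"
  assumes max: "\<And>s. \<phi> s \<le> \<phi> 0" and d1: "\<And>s. (\<phi> has_real_derivative \<phi>' s) (at s)"
    and d2: "(\<phi>' has_real_derivative d) (at 0)"
  shows "d \<le> 0"
proof (rule ccontr)
  assume "\<not> d \<le> 0"
  then obtain e where e: "e > 0" "\<And>h. 0 < h \<Longrightarrow> h < e \<Longrightarrow> \<phi>' 0 < \<phi>' h"
    using DERIV_pos_inc_right[OF d2] by auto
  have "\<phi>' 0 = 0"
    by (rule DERIV_local_max[OF d1[of 0], of 1]) (use max in auto)
  moreover obtain z where z: "0 < z" "z < e / 2" "\<phi> (e/2) - \<phi> 0 = (e/2 - 0) * \<phi>' z"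
    using MVT2[of 0 "e/2" \<phi> \<phi>'] e(1) d1 by auto
  ultimately have "\<phi>' z > 0" using e(2)[of z] by auto
  then have "\<phi> (e/2) - \<phi> 0 > 0" using e(1) unfolding z(3) by simp
  then show False using max[of "e/2"] by simp
qed

text \<open>Two paraboloids with common slope \<open>p\<close> touch the graph at \<open>x\<close>,
  one from below and one from above. Required at every point, as in \<open>quad_between\<close>,
  this is a derivative-free form of a I \<le> D^2 f \<le> b I.\<close>

definition quad_at :: "real \<Rightarrow> real \<Rightarrow> ('a::euclidean_space \<Rightarrow> real) \<Rightarrow> 'a \<Rightarrow> 'a \<Rightarrow> bool" where
  "quad_at a b f x p \<longleftrightarrow>
     (\<forall>z. f x + p \<bullet> (z - x) + a / 2 * ((z - x) \<bullet> (z - x)) \<le> f z \<and>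
          f z \<le> f x + p \<bullet> (z - x) + b / 2 * ((z - x) \<bullet> (z - x)))"

definition quad_between :: "real \<Rightarrow> real \<Rightarrow> ('a::euclidean_space \<Rightarrow> real) \<Rightarrow> bool" where
  "quad_between a b f \<longleftrightarrow> (\<forall>x. \<exists>p. quad_at a b f x p)"

lemma line_derivatives:
  fixes f :: "'a::euclidean_space \<Rightarrow> real"
  assumes f: "\<And>x. (f has_derivative (\<lambda>h. G x \<bullet> h)) (at x)" and G: "\<And>x. (G has_derivative H x) (at x)"
  shows "((\<lambda>s. f (x + s *\<^sub>R h)) has_real_derivative G (x + s *\<^sub>R h) \<bullet> h) (at s)"
    and "((\<lambda>s. G (x + s *\<^sub>R h) \<bullet> h) has_real_derivative h \<bullet> H (x + s *\<^sub>R h) h) (at s)"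
proof -
  have l: "((\<lambda>s. x + s *\<^sub>R h) has_derivative (\<lambda>\<tau>. \<tau> *\<^sub>R h)) (at s)"
    by (auto intro!: derivative_eq_intros)
  show "((\<lambda>s. f (x + s *\<^sub>R h)) has_real_derivative G (x + s *\<^sub>R h) \<bullet> h) (at s)"
    unfolding has_field_derivative_def
    by (rule has_derivative_eq_rhs[OF has_derivative_compose[OF l f]]) (simp add: fun_eq_iff mult.commute)
  interpret H: bounded_linear "H (x + s *\<^sub>R h)" using G has_derivative_bounded_linear by blast
  have "((\<lambda>s. G (x + s *\<^sub>R h) \<bullet> h) has_derivative (\<lambda>\<tau>. H (x + s *\<^sub>R h) (\<tau> *\<^sub>R h) \<bullet> h)) (at s)"
    using has_derivative_compose[OF l G] by (rule has_derivative_inner_left)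
  then show "((\<lambda>s. G (x + s *\<^sub>R h) \<bullet> h) has_real_derivative h \<bullet> H (x + s *\<^sub>R h) h) (at s)"
    unfolding has_field_derivative_def
    by (rule has_derivative_eq_rhs) (simp add: fun_eq_iff H.scaleR inner_commute mult.commute)
qed

text \<open>Taylor's formula of order two with Lagrange remainder on the segment from
  \<open>x\<close> to \<open>z\<close>, the remainder being a value of the Hessian form.\<close>

lemma quad_at_gradient:
  fixes f :: "'a::euclidean_space \<Rightarrow> real"
  assumes f: "\<And>x. (f has_derivative (\<lambda>h. G x \<bullet> h)) (at x)" and G: "\<And>x. (G has_derivative H x) (at x)"
    and H: "\<And>x h. a * (h \<bullet> h) \<le> h \<bullet> H x h" "\<And>x h. h \<bullet> H x h \<le> b * (h \<bullet> h)"
  shows "quad_at a b f x (G x)"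
  unfolding quad_at_def
proof
  fix z
  define h where "h = z - x"
  define diff where "diff = (\<lambda>(m::nat) s. if m = 0 then f (x + s *\<^sub>R h) else
     if m = 1 then G (x + s *\<^sub>R h) \<bullet> h else h \<bullet> H (x + s *\<^sub>R h) h)"
  have "\<exists>t. 0 < t \<and> t \<le> 1 \<and> f (x + 1 *\<^sub>R h) =
     (\<Sum>m<2. diff m 0 / fact m * 1 ^ m) + diff 2 t / fact 2 * 1 ^ 2"
    by (rule Maclaurin2[where diff = diff])
      (use line_derivatives[OF f G, of x h] in \<open>simp_all add: diff_def less_2_cases_iff all_conj_distrib[symmetric] split: if_splits\<close>)
  then obtain t where "f (x + h) = f x + G x \<bullet> h + (h \<bullet> H (x + t *\<^sub>R h) h) / 2"
    by (auto simp: diff_def numeral_2_eq_2)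
  then show "f x + G x \<bullet> (z - x) + a / 2 * ((z - x) \<bullet> (z - x)) \<le> f z \<and>
          f z \<le> f x + G x \<bullet> (z - x) + b / 2 * ((z - x) \<bullet> (z - x))"
    using H[of h "x + t *\<^sub>R h"] by (simp add: h_def)
qed

text \<open>The slope cancels when the paraboloids are evaluated at \<open>x + h\<close> and
  \<open>x - h\<close>. What remains is linear in \<open>f\<close> and free of \<open>p\<close>, so
  it survives averaging.\<close>

lemma quad_at_second_difference:
  assumes "quad_at a b f x p"
  shows "a * (h \<bullet> h) \<le> f (x + h) + f (x - h) - 2 * f x"
    "f (x + h) + f (x - h) - 2 * f x \<le> b * (h \<bullet> h)"
  using assms[unfolded quad_at_def, rule_format, of "x + h"]
    assms[unfolded quad_at_def, rule_format, of "x - h"] by simp_all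

text \<open>The way back from second differences to derivatives: with
  \<open>c = b * (h \<bullet> h)\<close> the function of \<open>s\<close> in \<open>*\<close> has
  its maximum at 0, and its second derivative there is twice the Hessian form minus
  \<open>2 * c\<close>. The lower bound is the same argument with the sign reversed.\<close>

lemma hessian_bounds_from_second_differences:
  fixes f :: "'a::euclidean_space \<Rightarrow> real"
  assumes f: "\<And>x. (f has_derivative (\<lambda>h. G x \<bullet> h)) (at x)" and G: "\<And>x. (G has_derivative H x) (at x)"
    and mid: "\<And>h. a * (h \<bullet> h) \<le> f (x + h) + f (x - h) - 2 * f x"
      "\<And>h. f (x + h) + f (x - h) - 2 * f x \<le> b * (h \<bullet> h)"
  shows "a * (h \<bullet> h) \<le> h \<bullet> H x h" "h \<bullet> H x h \<le> b * (h \<bullet> h)"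
proof -
  note d1 = line_derivatives(1)[OF f G] and d2 = line_derivatives(2)[OF f G]
  have m: "h \<bullet> H x (-h) = - (h \<bullet> H x h)"
    using G[of x] by (metis has_derivative_bounded_linear bounded_linear.linear linear_neg inner_minus_right)
  have *: "((\<lambda>s. f (x + s *\<^sub>R h) + f (x - s *\<^sub>R h) - s\<^sup>2 * c)
      has_real_derivative (G (x + s *\<^sub>R h) \<bullet> h - G (x - s *\<^sub>R h) \<bullet> h - 2 * s * c)) (at s)" for s c
  proof -
    have "((\<lambda>s. s\<^sup>2 * c) has_real_derivative 2 * s * c) (at s)"
      by (auto intro!: derivative_eq_intros)
    from DERIV_diff[OF DERIV_add[OF d1[of x h s] d1[of x "-h" s]] this] show ?thesis by simp
  qed
  have **: "((\<lambda>s. G (x + s *\<^sub>R h) \<bullet> h - G (x - s *\<^sub>R h) \<bullet> h - 2 * s * c)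
      has_real_derivative 2 * (h \<bullet> H x h - c)) (at 0)" for c
  proof -
    have "((\<lambda>s. 2 * s * c) has_real_derivative 2 * c) (at 0)"
      by (auto intro!: derivative_eq_intros)
    from DERIV_diff[OF DERIV_add[OF d2[of x h 0] d2[of x "-h" 0]] this] show ?thesis
      by (simp add: m right_diff_distrib)
  qed
  have "2 * (h \<bullet> H x h - b * (h \<bullet> h)) \<le> 0"
  proof (rule second_derivative_nonpos_at_max[OF _ * **])
    fix s show "f (x + s *\<^sub>R h) + f (x - s *\<^sub>R h) - s\<^sup>2 * (b * (h \<bullet> h))
        \<le> f (x + 0 *\<^sub>R h) + f (x - 0 *\<^sub>R h) - 0\<^sup>2 * (b * (h \<bullet> h))"
      using mid(2)[of "s *\<^sub>R h"] by (simp add: power2_eq_square mult_ac)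
  qed
  then show "h \<bullet> H x h \<le> b * (h \<bullet> h)" by simp
  have "- (2 * (h \<bullet> H x h - a * (h \<bullet> h))) \<le> 0"
  proof (rule second_derivative_nonpos_at_max[OF _ DERIV_minus[OF *] DERIV_minus[OF **]])
    fix s show "- (f (x + s *\<^sub>R h) + f (x - s *\<^sub>R h) - s\<^sup>2 * (a * (h \<bullet> h)))
        \<le> - (f (x + 0 *\<^sub>R h) + f (x - 0 *\<^sub>R h) - 0\<^sup>2 * (a * (h \<bullet> h)))"
      using mid(1)[of "s *\<^sub>R h"] by (simp add: power2_eq_square mult_ac)
  qed
  then show "a * (h \<bullet> h) \<le> h \<bullet> H x h" by simp
qed

text \<open>Sum of the two lower paraboloid inequalities, each evaluated at the other contact
  point.\<close>

lemma quad_at_strongly_monotone: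
  assumes "quad_at a b f x p" "quad_at a b f y q"
  shows "a * ((x - y) \<bullet> (x - y)) \<le> (p - q) \<bullet> (x - y)"
  using assms(1)[unfolded quad_at_def, rule_format, of y]
    assms(2)[unfolded quad_at_def, rule_format, of x]
  by (simp add: inner_diff_left inner_diff_right inner_commute algebra_simps)

lemma quad_between_growth:
  assumes "quad_between a b f"
  obtains C where "C \<ge> 0" "\<And>z. \<bar>f z\<bar> \<le> C * (1 + (norm (z - x))^2)"
proof -
  obtain p where p: "quad_at a b f x p" using assms by (auto simp: quad_between_def)
  define C where "C = \<bar>f x\<bar> + norm p + \<bar>a\<bar> + \<bar>b\<bar>"
  have "\<bar>f z\<bar> \<le> C * (1 + (norm (z - x))^2)" for z
  proof -
    define r where "r = norm (z - x)"
    have r0: "0 \<le> r" by (simp add: r_def)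
    have "r * 2 \<le> 1 + r^2" using sum_squares_bound[of r 1] by simp
    then have r: "0 \<le> r" "r \<le> 1 + r^2" using r0 by simp_all
    have pz: "\<bar>p \<bullet> (z - x)\<bar> \<le> norm p * r" unfolding r_def by (rule Cauchy_Schwarz_ineq2)
    have *: "f x + p \<bullet> (z - x) + a / 2 * r^2 \<le> f z" "f z \<le> f x + p \<bullet> (z - x) + b / 2 * r^2"
      using p[unfolded quad_at_def, rule_format, of z] by (auto simp: r_def power2_norm_eq_inner)
    have "norm p * r \<le> norm p * (1 + r^2)" using r by (intro mult_left_mono) auto
    moreover have "\<bar>a / 2 * r^2\<bar> \<le> \<bar>a\<bar> * (1 + r^2)" "\<bar>b / 2 * r^2\<bar> \<le> \<bar>b\<bar> * (1 + r^2)"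
      using mult_mono[of "\<bar>a\<bar> / 2" "\<bar>a\<bar>" "r^2" "1 + r^2"] mult_mono[of "\<bar>b\<bar> / 2" "\<bar>b\<bar>" "r^2" "1 + r^2"]
      by (simp_all add: abs_mult)
    moreover have "\<bar>f x\<bar> \<le> \<bar>f x\<bar> * (1 + r^2)" using r by (simp add: mult_le_cancel_left1)
    ultimately show ?thesis using * pz unfolding C_def r_def[symmetric]
      by (simp only: distrib_right) linarith
  qed
  then show ?thesis using that[of C] by (simp add: C_def)
qed

lemma quad_between_continuous:
  assumes "quad_between a b f"
  shows "continuous_on UNIV f"
proof -
  have "isCont f x" for x
  proof -
    obtain p where p: "quad_at a b f x p" using assms by (auto simp: quad_between_def)
    show ?thesis
      unfolding isCont_def
    proof (rule tendsto_sandwich)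
      show "((\<lambda>z. f x + p \<bullet> (z - x) + a / 2 * ((z - x) \<bullet> (z - x))) \<longlongrightarrow> f x) (at x)"
        by (auto intro!: tendsto_eq_intros)
      show "((\<lambda>z. f x + p \<bullet> (z - x) + b / 2 * ((z - x) \<bullet> (z - x))) \<longlongrightarrow> f x) (at x)"
        by (auto intro!: tendsto_eq_intros)
    qed (use p in \<open>auto simp: quad_at_def\<close>)
  qed
  then show ?thesis by (simp add: continuous_on_eq_continuous_at)
qed

section \<open>Legendre transform of functions between paraboloids\<close>

definition is_legmax :: "('a::euclidean_space \<Rightarrow> real) \<Rightarrow> 'a \<Rightarrow> 'a \<Rightarrow> bool" where
  "is_legmax g x y \<longleftrightarrow> (\<forall>z. x \<bullet> z - g z \<le> x \<bullet> y - g y)"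

definition legmax :: "('a::euclidean_space \<Rightarrow> real) \<Rightarrow> 'a \<Rightarrow> 'a" where
  "legmax g x = (SOME y. is_legmax g x y)"

text \<open>The supremum of \<open>x \<bullet> z - g z\<close>, written as the value at a chosen
  maximiser. The maximiser is what later becomes the gradient of the transform, and it exists by
  \<open>is_legmax_legmax\<close>.\<close>

definition legendre :: "('a::euclidean_space \<Rightarrow> real) \<Rightarrow> 'a \<Rightarrow> real" where
  "legendre g x = x \<bullet> legmax g x - g (legmax g x)"

lemma is_legmax_legmax:
  assumes q: "quad_between a b g" and a: "a > 0"
  shows "is_legmax g x (legmax g x)"
proof -
  obtain p where p: "quad_at a b g 0 p" using q by (auto simp: quad_between_def)
  \<comment> \<open>Outside this radius the lower paraboloid at 0 outweighs the linear term
    \<open>(x - p) \<bullet> z\<close>, so the competitor 0 is at least as good and the maximum over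
    the ball is global.\<close>
  define R where "R = 2 * norm (x - p) / a"
  have R: "R \<ge> 0" using a by (simp add: R_def)
  then have "compact (cball (0::'a) R)" "cball (0::'a) R \<noteq> {}" by auto
  moreover have "continuous_on (cball 0 R) (\<lambda>z. x \<bullet> z - g z)"
    by (intro continuous_intros continuous_on_subset[OF quad_between_continuous[OF q]]) auto
  ultimately obtain y where y: "y \<in> cball 0 R" "\<And>z. z \<in> cball 0 R \<Longrightarrow> x \<bullet> z - g z \<le> x \<bullet> y - g y"
    using continuous_attains_sup[of "cball 0 R" "\<lambda>z. x \<bullet> z - g z"] by metis
  have "x \<bullet> z - g z \<le> x \<bullet> y - g y" for z
  proof (cases "norm z \<le> R")
    case False
    have "(x - p) \<bullet> z \<le> norm (x - p) * norm z" by (rule norm_cauchy_schwarz)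
    also have "\<dots> = a / 2 * (R * norm z)" using a by (simp add: R_def)
    also have "\<dots> \<le> a / 2 * (norm z * norm z)" using a False by (intro mult_left_mono mult_right_mono) auto
    also have "norm z * norm z = z \<bullet> z" by (simp add: power2_eq_square flip: power2_norm_eq_inner)
    finally have "x \<bullet> z - g z \<le> x \<bullet> 0 - g 0"
      using p[unfolded quad_at_def, rule_format, of z] by (simp add: inner_diff_left)
    also have "\<dots> \<le> x \<bullet> y - g y" using y(2)[of 0] R by simp
    finally show ?thesis .
  qed (use y in simp)
  then have "is_legmax g x y" by (simp add: is_legmax_def)
  then show ?thesis unfolding legmax_def by (rule someI)
qed

lemma legendre_eq:
  assumes "quad_between a b g" "a > 0" "is_legmax g x y"
  shows "legendre g x = x \<bullet> y - g y"
  using is_legmax_legmax[OF assms(1,2), of x] assms(3)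
  by (auto simp: is_legmax_def legendre_def intro: antisym)

lemma legendre_ge:
  assumes "quad_between a b g" "a > 0"
  shows "x \<bullet> y - g y \<le> legendre g x"
  using is_legmax_legmax[OF assms, of x] by (simp add: is_legmax_def legendre_def)

text \<open>Moving from \<open>y\<close> by \<open>(x - p) / b\<close> gains
  \<open>|x - p|^2 / b\<close> to first order and loses at most half of that to the upper
  paraboloid; at a maximiser there is no gain, so \<open>p = x\<close>.\<close>

lemma gradient_at_legmax:
  assumes q: "quad_at a b g y p" and b: "b > 0" and max: "is_legmax g x y"
  shows "p = x"
proof -
  define h where "h = (1 / b) *\<^sub>R (x - p)"
  have "x \<bullet> (y + h) - g (y + h) \<le> x \<bullet> y - g y" using max by (simp add: is_legmax_def)
  moreover have "g (y + h) \<le> g y + p \<bullet> h + b / 2 * (h \<bullet> h)"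
    using q[unfolded quad_at_def, rule_format, of "y + h"] by simp
  ultimately have "(x - p) \<bullet> h \<le> b / 2 * (h \<bullet> h)"
    by (simp add: inner_add_right inner_diff_left)
  moreover have "(x - p) \<bullet> h = ((x - p) \<bullet> (x - p)) / b" "h \<bullet> h = ((x - p) \<bullet> (x - p)) / b / b"
    by (simp_all add: h_def)
  ultimately have "((x - p) \<bullet> (x - p)) / b \<le> ((x - p) \<bullet> (x - p)) / b / 2"
    using b by simp
  then have "((x - p) \<bullet> (x - p)) / b \<le> 0" by simp
  moreover have "((x - p) \<bullet> (x - p)) / b \<ge> 0" using b by simp
  ultimately have "((x - p) \<bullet> (x - p)) / b = 0" by linarith
  then show ?thesis using b by simp
qed

text \<open>The contact slope of the transform at \<open>x\<close> is the maximiser for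
  \<open>x\<close>. Both bounds compare maximisers for \<open>z\<close> and \<open>x\<close> through
  the paraboloids that touch \<open>g\<close> there, whose slope is \<open>x\<close> by
  \<open>gradient_at_legmax\<close>.\<close>

lemma quad_at_legendre:
  assumes q: "quad_between a b g" and ab: "0 < a" "0 < b"
  shows "quad_at (1 / b) (1 / a) (legendre g) x (legmax g x)"
  unfolding quad_at_def
proof (intro allI conjI)
  fix z
  define X where "X = legmax g x"
  have max: "is_legmax g x X" unfolding X_def by (rule is_legmax_legmax[OF q ab(1)])
  obtain p where "quad_at a b g X p" using q by (auto simp: quad_between_def)
  moreover from this have "p = x" using gradient_at_legmax max ab by blast
  ultimately have Q: "quad_at a b g X x" by simp
  have lx: "legendre g x = x \<bullet> X - g X" by (simp add: legendre_def X_def)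
  \<comment> \<open>This displacement maximises
    \<open>(z - x) \<bullet> k - b / 2 * (k \<bullet> k)\<close>, so it is the best test point for
    the lower bound.\<close>
  define k where "k = (1 / b) *\<^sub>R (z - x)"
  have "z \<bullet> (X + k) - g (X + k) \<le> legendre g z" by (rule legendre_ge[OF q ab(1)])
  moreover have "g (X + k) \<le> g X + x \<bullet> k + b / 2 * (k \<bullet> k)"
    using Q[unfolded quad_at_def, rule_format, of "X + k"] by simp
  moreover have "(z - x) \<bullet> k - b / 2 * (k \<bullet> k) = 1 / b / 2 * ((z - x) \<bullet> (z - x))"
  proof -
    have "(z - x) \<bullet> k = ((z - x) \<bullet> (z - x)) / b" "k \<bullet> k = ((z - x) \<bullet> (z - x)) / b / b"
      by (simp_all add: k_def)
    then show ?thesis using ab by simp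
  qed
  ultimately show "legendre g x + legmax g x \<bullet> (z - x) + 1 / b / 2 * ((z - x) \<bullet> (z - x)) \<le> legendre g z"
    unfolding lx X_def[symmetric] by (simp add: inner_add_right inner_diff_left inner_diff_right inner_commute)
  \<comment> \<open>For the upper bound the true maximiser for \<open>z\<close> is used, and
    completing the square bounds its contribution whatever \<open>m\<close> is.\<close>
  define m where "m = legmax g z - X"
  have "legendre g z = z \<bullet> (X + m) - g (X + m)" by (simp add: legendre_def m_def)
  moreover have "g X + x \<bullet> m + a / 2 * (m \<bullet> m) \<le> g (X + m)"
    using Q[unfolded quad_at_def, rule_format, of "X + m"] by simp
  moreover have "(z - x) \<bullet> m - a / 2 * (m \<bullet> m) \<le> 1 / a / 2 * ((z - x) \<bullet> (z - x))"
  proof -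
    have "0 \<le> a / 2 * ((m - (1/a) *\<^sub>R (z - x)) \<bullet> (m - (1/a) *\<^sub>R (z - x)))" using ab by simp
    moreover have "(m - (1/a) *\<^sub>R w) \<bullet> (m - (1/a) *\<^sub>R w) = m \<bullet> m - 2 / a * (w \<bullet> m) + (w \<bullet> w) / a / a" for w
      by (simp add: inner_diff_left inner_diff_right inner_commute)
    ultimately have "0 \<le> a / 2 * (m \<bullet> m - 2 / a * ((z - x) \<bullet> m) + ((z - x) \<bullet> (z - x)) / a / a)"
      by simp
    then show ?thesis
      using ab by (simp add: distrib_left right_diff_distrib)
  qed
  ultimately show "legendre g z \<le> legendre g x + legmax g x \<bullet> (z - x) + 1 / a / 2 * ((z - x) \<bullet> (z - x))"
    unfolding lx X_def[symmetric] by (simp add: inner_add_right inner_diff_left inner_diff_right inner_commute)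
qed

lemma quad_between_legendre:
  "quad_between a b g \<Longrightarrow> 0 < a \<Longrightarrow> 0 < b \<Longrightarrow> quad_between (1 / b) (1 / a) (legendre g)"
  using quad_at_legendre unfolding quad_between_def by blast

text \<open>If \<open>p\<close> is a contact slope of \<open>g\<close> at \<open>x\<close>, then
  \<open>x\<close> is a maximiser for \<open>p\<close> because \<open>a > 0\<close>, and dually
  \<open>p\<close> is a maximiser for \<open>x\<close> in the second transform. Evaluating there
  gives back \<open>g x\<close>.\<close>

lemma legendre_legendre:
  assumes q: "quad_between a b g" and ab: "0 < a" "0 < b"
  shows "legendre (legendre g) x = g x"
proof -
  obtain p where p: "quad_at a b g x p" using q by (auto simp: quad_between_def)
  have "p \<bullet> z - g z \<le> p \<bullet> x - g x" for z
  proof -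
    have "0 \<le> a / 2 * ((z - x) \<bullet> (z - x))" using ab by simp
    then show ?thesis using p[unfolded quad_at_def, rule_format, of z] by (simp add: inner_diff_right)
  qed
  then have max: "is_legmax g p x" by (simp add: is_legmax_def)
  have "is_legmax (legendre g) x p"
    unfolding is_legmax_def
  proof
    fix z show "x \<bullet> z - legendre g z \<le> x \<bullet> p - legendre g p"
      using legendre_ge[OF q ab(1), of z x] legendre_eq[OF q ab(1) max] by (simp add: inner_commute)
  qed
  then show ?thesis
    using legendre_eq[OF quad_between_legendre[OF q ab]] legendre_eq[OF q ab(1) max] ab
    by (simp add: inner_commute)
qed

text \<open>Each transform is tested at the maximiser of the other one. This transfers closeness to
  the initial value through the transform.\<close>

lemma legendre_diff_le:
  assumes "quad_between a b f" "quad_between a b g" "a > 0" and d: "\<And>y. \<bar>f y - g y\<bar> \<le> c"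
  shows "\<bar>legendre f x - legendre g x\<bar> \<le> c"
  using legendre_ge[OF assms(1,3), of x "legmax g x"] legendre_ge[OF assms(2,3), of x "legmax f x"]
    d[of "legmax g x", unfolded abs_le_iff] d[of "legmax f x", unfolded abs_le_iff]
  unfolding abs_le_iff by (simp only: legendre_def) linarith

section \<open>Uniqueness\<close>

text \<open>Mean value theorem in time, with \<open>F_pi4\<close> bounded by the lower Hessian
  bound. It replaces a growth condition at infinity: two solutions of quadratic growth still have a
  bounded difference on bounded time intervals.\<close>

lemma solution_near_initial_value:
  fixes u :: "real^'n \<Rightarrow> real \<Rightarrow> real"
  assumes \<zeta>: "\<zeta> > 0" and u: "solves_cauchy \<rho> \<zeta> u0 u" and t: "t \<ge> 0"
  shows "\<bar>u x t - u0 x\<bar> \<le> sqrt 2 * (CARD('n) / \<zeta>) * t"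
proof (cases "t = 0")
  case False
  then have t: "0 < t" using t by simp
  have d: "((\<lambda>s. u x s) has_real_derivative F_pi4 (hessian (\<lambda>y. u y s) x)) (at s)" if "s > 0" for s
    using u that by (simp add: solves_cauchy_def)
  have "continuous_on (UNIV \<times> {0..}) (\<lambda>(x, t). u x t)" using u by (simp add: solves_cauchy_def)
  then have "continuous_on {0..t} (\<lambda>s. (\<lambda>(x, t). u x t) (x, s))"
    by (rule continuous_on_compose2) (auto intro!: continuous_intros)
  then have c: "continuous_on {0..t} (\<lambda>s. u x s)" by simp
  obtain l z where z: "0 < z" "z < t" "((\<lambda>s. u x s) has_real_derivative l) (at z)" "u x t - u x 0 = (t - 0) * l"
    using MVT[OF t c] d real_differentiable_def by metis
  have "l = F_pi4 (hessian (\<lambda>y. u y z) x)" using DERIV_unique[OF z(3) d] z by simp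
  moreover have "loewner_le (mat (- 1 + \<zeta>)) (hessian (\<lambda>y. u y z) x)"
    using u z(1) by (simp add: solves_cauchy_def hessian_bounds_def)
  ultimately have "\<bar>l\<bar> \<le> sqrt 2 * (CARD('n) / \<zeta>)" using F_pi4_bound[OF \<zeta>] by blast
  then have "\<bar>l\<bar> * t \<le> sqrt 2 * (CARD('n) / \<zeta>) * t" using t by (intro mult_right_mono) auto
  moreover have "u x 0 = u0 x" using u by (simp add: solves_cauchy_def)
  ultimately show ?thesis using z(4) t by (simp add: abs_mult mult.commute)
qed (use u in \<open>simp add: solves_cauchy_def\<close>)

lemma solves_cauchy_comparison:
  fixes u v :: "real^'n \<Rightarrow> real \<Rightarrow> real"
  assumes \<zeta>: "\<zeta> > 0" and u: "solves_cauchy \<rho> \<zeta> u0 u" and v: "solves_cauchy \<rho> \<zeta> u0 v" and t0: "t0 > 0"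
  shows "v x0 t0 \<le> u x0 t0"
proof (rule ccontr)
  assume "\<not> v x0 t0 \<le> u x0 t0"
  define \<delta> where "\<delta> = v x0 t0 - u x0 t0"
  have \<delta>: "\<delta> > 0" using \<open>\<not> v x0 t0 \<le> u x0 t0\<close> by (simp add: \<delta>_def)
  define N where "N = real CARD('n)"
  have N: "N > 0" by (simp add: N_def)
  \<comment> \<open>The first summand absorbs the loss in \<open>F_pi4_perturbation\<close> caused
    by the Hessian of the barrier; the additional 1 makes the time derivative at the maximum
    strictly negative.\<close>
  define L where "L = sqrt 2 * (N / \<zeta>^2) + 1"
  have L: "L > 0" using \<zeta> N by (simp add: L_def add_nonneg_pos)
  define M where "M = 1 / 2 * (x0 \<bullet> x0) + L * t0"
  have M: "M > 0" using L t0 by (simp add: M_def add_nonneg_pos)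
  \<comment> \<open>With this weight the barrier takes away exactly half of the supposed gap
    \<delta> at \<open>(x0, t0)\<close>.\<close>
  define \<epsilon> where "\<epsilon> = \<delta> / (2 * M)"
  have \<epsilon>: "\<epsilon> > 0" using \<delta> M by (simp add: \<epsilon>_def)
  define \<psi> where "\<psi> x t = v x t - u x t - \<epsilon> * (1 / 2 * (x \<bullet> x) + L * t)" for x t
  have "\<psi> x0 t0 = \<delta> - \<epsilon> * M" by (simp add: \<psi>_def \<delta>_def M_def)
  also have "\<dots> = \<delta> / 2" using M by (simp add: \<epsilon>_def)
  finally have "\<psi> x0 t0 = \<delta> / 2" .
  then have \<psi>0: "\<psi> x0 t0 > 0" using \<delta> by simp
  define k where "k = sqrt 2 * (N / \<zeta>)"
  have k: "k \<ge> 0" using \<zeta> N by (simp add: k_def)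
  define Q where "Q = 2 * (k * t0)"
  have Q: "Q \<ge> 0" using k t0 by (simp add: Q_def)
  have diff: "v x t - u x t \<le> Q" if "0 \<le> t" "t \<le> t0" for x t
  proof -
    have "k * t \<le> k * t0" using k that by (intro mult_left_mono) auto
    then show ?thesis
      using abs_le_D2[OF solution_near_initial_value[OF \<zeta> u that(1), of x]]
        abs_le_D1[OF solution_near_initial_value[OF \<zeta> v that(1), of x]]
      unfolding Q_def N_def[symmetric] k_def[symmetric] by linarith
  qed
  \<comment> \<open>Outside this radius the quadratic part of the barrier exceeds \<open>Q\<close>,
    the bound for the difference; adding \<open>norm x0\<close> keeps \<open>x0\<close>
    inside.\<close>
  define R where "R = sqrt (2 * Q / \<epsilon>) + norm x0"
  have R: "R \<ge> 0" "norm x0 \<le> R" using Q \<epsilon> by (simp_all add: R_def)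
  have out: "\<psi> x t \<le> 0" if "0 \<le> t" "t \<le> t0" "norm x > R" for x t
  proof -
    have "sqrt (2 * Q / \<epsilon>) \<le> norm x" using that by (simp add: R_def) (meson add_increasing2 norm_ge_zero order.strict_implies_order order_trans le_add_same_cancel1)
    then have "(sqrt (2 * Q / \<epsilon>))^2 \<le> (norm x)^2" using Q \<epsilon> by (intro power_mono) auto
    then have "2 * Q / \<epsilon> \<le> x \<bullet> x" using Q \<epsilon> by (simp add: power2_norm_eq_inner)
    then have "Q \<le> \<epsilon> * (1 / 2 * (x \<bullet> x))" using \<epsilon> by (simp add: field_simps)
    moreover have "0 \<le> \<epsilon> * (L * t)" using \<epsilon> L that by simp
    ultimately show ?thesis using diff[OF that(1,2), of x] by (simp add: \<psi>_def distrib_left)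
  qed
  have cont: "continuous_on (UNIV \<times> {0..}) (\<lambda>(x, t). u x t)" "continuous_on (UNIV \<times> {0..}) (\<lambda>(x, t). v x t)"
    using u v by (simp_all add: solves_cauchy_def)
  let ?K = "cball (0::real^'n) R \<times> {0..t0}"
  have "continuous_on ?K (\<lambda>p. \<psi> (fst p) (snd p))"
    unfolding \<psi>_def
    by (intro continuous_intros continuous_on_compose2[OF cont(1), of _ "\<lambda>p. p", unfolded case_prod_beta]
       continuous_on_compose2[OF cont(2), of _ "\<lambda>p. p", unfolded case_prod_beta]) auto
  moreover have "compact ?K" "?K \<noteq> {}" using R t0 by (auto intro!: compact_Times)
  ultimately obtain p where p: "p \<in> ?K" "\<And>q. q \<in> ?K \<Longrightarrow> \<psi> (fst q) (snd q) \<le> \<psi> (fst p) (snd p)"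
    using continuous_attains_sup[of ?K "\<lambda>p. \<psi> (fst p) (snd p)"] by metis
  define x1 where "x1 = fst p"
  define t1 where "t1 = snd p"
  have t1: "0 \<le> t1" "t1 \<le> t0" using p(1) by (auto simp: t1_def mem_Times_iff)
  have pos: "\<psi> x1 t1 > 0" using p(2)[of "(x0, t0)"] R t0 \<psi>0 by (simp add: x1_def t1_def)
  \<comment> \<open>The maximum over the compact cylinder is global in space, since the function is
    nonpositive outside the ball. Hence the second order test applies at \<open>x1\<close> even if
    it lies on the sphere.\<close>
  have max: "\<psi> x t \<le> \<psi> x1 t1" if "0 \<le> t" "t \<le> t0" for x t
    using p(2)[of "(x, t)"] out[OF that, of x] pos that by (cases "norm x \<le> R") (auto simp: x1_def t1_def)
  have "\<psi> x 0 \<le> 0" for x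
    using u v \<epsilon> by (simp add: \<psi>_def solves_cauchy_def)
  then have t1': "t1 > 0" using pos t1 by (metis less_eq_real_def not_le)
  have C2: "Ck_on 2 UNIV (\<lambda>y. w y t1)" if "solves_cauchy \<rho> \<zeta> u0 w" for w
    using Ck_on_slice[of 2 "{0<..}" "\<lambda>(x, t). w x t" t1] that t1' by (simp add: solves_cauchy_def smooth_on_def)
  define Hu where "Hu = hessian (\<lambda>y. u y t1) x1"
  define Hv where "Hv = hessian (\<lambda>y. v y t1) x1"
  have "h \<bullet> (Hv *v h) \<le> h \<bullet> (Hu *v h) + \<epsilon> * (h \<bullet> h)" for h
  proof -
    note du = line_derivatives[OF C2_gradient_hessian[OF C2[OF u]], of x1 h]
    note dv = line_derivatives[OF C2_gradient_hessian[OF C2[OF v]], of x1 h]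
    have q: "((\<lambda>s. \<epsilon> * (1 / 2 * ((x1 + s *\<^sub>R h) \<bullet> (x1 + s *\<^sub>R h)) + L * t1)) has_real_derivative
         \<epsilon> * ((x1 + s *\<^sub>R h) \<bullet> h)) (at s)" for s
      unfolding inner_add_left inner_add_right inner_scaleR_left inner_scaleR_right
      by (auto intro!: derivative_eq_intros simp: inner_commute algebra_simps)
    have q2: "((\<lambda>s. \<epsilon> * ((x1 + s *\<^sub>R h) \<bullet> h)) has_real_derivative \<epsilon> * (h \<bullet> h)) (at s)" for s
      unfolding inner_add_left inner_scaleR_left by (auto intro!: derivative_eq_intros)
    have "h \<bullet> (h v* Hv) - h \<bullet> (h v* Hu) - \<epsilon> * (h \<bullet> h) \<le> 0"
    proof (rule second_derivative_nonpos_at_max)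
      fix s
      show "v (x1 + s *\<^sub>R h) t1 - u (x1 + s *\<^sub>R h) t1 - \<epsilon> * (1 / 2 * ((x1 + s *\<^sub>R h) \<bullet> (x1 + s *\<^sub>R h)) + L * t1)
        \<le> v (x1 + 0 *\<^sub>R h) t1 - u (x1 + 0 *\<^sub>R h) t1 - \<epsilon> * (1 / 2 * ((x1 + 0 *\<^sub>R h) \<bullet> (x1 + 0 *\<^sub>R h)) + L * t1)"
        using max[OF t1, of "x1 + s *\<^sub>R h"] by (simp add: \<psi>_def)
      show "((\<lambda>s. v (x1 + s *\<^sub>R h) t1 - u (x1 + s *\<^sub>R h) t1 - \<epsilon> * (1 / 2 * ((x1 + s *\<^sub>R h) \<bullet> (x1 + s *\<^sub>R h)) + L * t1))
        has_real_derivative ((\<chi> i. partial_deriv (axis i 1) (\<lambda>y. v y t1) (x1 + s *\<^sub>R h)) \<bullet> h -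
          (\<chi> i. partial_deriv (axis i 1) (\<lambda>y. u y t1) (x1 + s *\<^sub>R h)) \<bullet> h - \<epsilon> * ((x1 + s *\<^sub>R h) \<bullet> h))) (at s)"
        by (rule DERIV_diff[OF DERIV_diff[OF dv(1) du(1)] q])
      show "((\<lambda>s. (\<chi> i. partial_deriv (axis i 1) (\<lambda>y. v y t1) (x1 + s *\<^sub>R h)) \<bullet> h -
          (\<chi> i. partial_deriv (axis i 1) (\<lambda>y. u y t1) (x1 + s *\<^sub>R h)) \<bullet> h - \<epsilon> * ((x1 + s *\<^sub>R h) \<bullet> h))
         has_real_derivative (h \<bullet> (h v* Hv) - h \<bullet> (h v* Hu) - \<epsilon> * (h \<bullet> h))) (at 0)"
        using DERIV_diff[OF DERIV_diff[OF dv(2)[of 0] du(2)[of 0]] q2[of 0]] by (simp add: Hu_def Hv_def)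
    qed
    moreover have "h \<bullet> (h v* A) = h \<bullet> (A *v h)" for A :: "real^'n^'n"
      using dot_lmul_matrix[of h A h] by (simp add: inner_commute)
    ultimately show ?thesis by simp
  qed
  moreover have "loewner_le (mat (- 1 + \<zeta>)) Hu" "loewner_le (mat (- 1 + \<zeta>)) Hv"
    using u v t1' by (auto simp: solves_cauchy_def hessian_bounds_def Hu_def Hv_def)
  ultimately have F: "F_pi4 Hv \<le> F_pi4 Hu + sqrt 2 * (N * \<epsilon> / \<zeta>^2)"
    using F_pi4_perturbation[OF \<zeta>, of Hu Hv \<epsilon>] \<epsilon> by (simp add: N_def)
  have "((\<lambda>t. \<psi> x1 t) has_real_derivative F_pi4 Hv - F_pi4 Hu - \<epsilon> * L) (at t1)"
  proof -
    have "((\<lambda>t. \<epsilon> * (1 / 2 * (x1 \<bullet> x1) + L * t)) has_real_derivative \<epsilon> * L) (at t1)"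
      by (auto intro!: derivative_eq_intros)
    moreover have "((\<lambda>s. u x1 s) has_real_derivative F_pi4 Hu) (at t1)" "((\<lambda>s. v x1 s) has_real_derivative F_pi4 Hv) (at t1)"
      using u v t1' by (auto simp: solves_cauchy_def Hu_def Hv_def)
    ultimately show ?thesis unfolding \<psi>_def by (intro DERIV_diff)
  qed
  moreover have "F_pi4 Hv - F_pi4 Hu - \<epsilon> * L < 0"
    using F \<epsilon> by (simp add: L_def algebra_simps)
  \<comment> \<open>Only times before \<open>t1\<close> are compared, so the case
    \<open>t1 = t0\<close> needs no separate treatment.\<close>
  ultimately obtain d where d: "d > 0" "\<And>h. 0 < h \<Longrightarrow> h < d \<Longrightarrow> \<psi> x1 t1 < \<psi> x1 (t1 - h)"
    using DERIV_neg_dec_left by blast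
  define h where "h = min (d / 2) t1"
  have "0 < h" "h < d" "h \<le> t1" using d t1' by (auto simp: h_def)
  then show False using d(2)[of h] max[of "t1 - h" x1] t1 by simp
qed

section \<open>Uniformly bounded families of derivatives\<close>

text \<open>The index set \<open>\<Theta>\<close> will consist of the Legendre transforms of all admissible initial values; it makes
  the constants of the derivative bounds independent of the initial value.\<close>

primrec unif_Cb ::
    "nat \<Rightarrow> 'a::euclidean_space set \<Rightarrow> 'b set \<Rightarrow> ('b \<Rightarrow> 'a \<Rightarrow> real) \<Rightarrow> bool" where
  "unif_Cb 0 S \<Theta> g \<longleftrightarrow> (\<exists>C. \<forall>\<theta>\<in>\<Theta>. \<forall>x\<in>S. \<bar>g \<theta> x\<bar> \<le> C)"
| "unif_Cb (Suc k) S \<Theta> g \<longleftrightarrow> (\<exists>C. \<forall>\<theta>\<in>\<Theta>. \<forall>x\<in>S. \<bar>g \<theta> x\<bar> \<le> C) \<and>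
     (\<forall>\<theta>\<in>\<Theta>. \<forall>x\<in>S. g \<theta> differentiable (at x)) \<and>
     (\<forall>b\<in>Basis. unif_Cb k S \<Theta> (\<lambda>\<theta>. partial_deriv b (g \<theta>)))"

lemma unif_Cb_bounded: "unif_Cb k S \<Theta> g \<Longrightarrow> \<exists>C. \<forall>\<theta>\<in>\<Theta>. \<forall>x\<in>S. \<bar>g \<theta> x\<bar> \<le> C"
  by (cases k) auto

lemma unif_Cb_cong:
  assumes "open S" "\<And>\<theta> x. \<theta> \<in> \<Theta> \<Longrightarrow> x \<in> S \<Longrightarrow> f \<theta> x = g \<theta> x"
  shows "unif_Cb k S \<Theta> f \<longleftrightarrow> unif_Cb k S \<Theta> g"
  using assms(2)
proof (induction k arbitrary: f g)
  case (Suc k)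
  have "unif_Cb k S \<Theta> (\<lambda>\<theta>. partial_deriv b (f \<theta>)) \<longleftrightarrow> unif_Cb k S \<Theta> (\<lambda>\<theta>. partial_deriv b (g \<theta>))" for b
    using Suc.prems by (intro Suc.IH partial_deriv_cong_open[OF assms(1)])
  moreover have "f \<theta> differentiable (at x) \<longleftrightarrow> g \<theta> differentiable (at x)" if "\<theta> \<in> \<Theta>" "x \<in> S" for \<theta> x
    using differentiable_cong_open[OF assms(1) that(2)] Suc.prems that by blast
  ultimately show ?case using Suc.prems by simp
qed simp

lemma unif_Cb_SucI:
  assumes S: "open S" and bd: "\<And>\<theta> x. \<theta> \<in> \<Theta> \<Longrightarrow> x \<in> S \<Longrightarrow> \<bar>g \<theta> x\<bar> \<le> C"
    and d: "\<And>\<theta> x. \<theta> \<in> \<Theta> \<Longrightarrow> x \<in> S \<Longrightarrow> (g \<theta> has_derivative g' \<theta> x) (at x)"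
    and D: "\<And>b. b \<in> Basis \<Longrightarrow> unif_Cb k S \<Theta> (\<lambda>\<theta> x. g' \<theta> x b)"
  shows "unif_Cb (Suc k) S \<Theta> g"
proof -
  have "unif_Cb k S \<Theta> (\<lambda>\<theta>. partial_deriv b (g \<theta>))" if "b \<in> Basis" for b
    using D[OF that] unif_Cb_cong[OF S, of \<Theta> "\<lambda>\<theta>. partial_deriv b (g \<theta>)" "\<lambda>\<theta> x. g' \<theta> x b"]
      partial_deriv_eq[OF d] by blast
  moreover have "\<exists>C. \<forall>\<theta>\<in>\<Theta>. \<forall>x\<in>S. \<bar>g \<theta> x\<bar> \<le> C" using bd by blast
  ultimately show ?thesis using d by (auto simp: differentiable_def)
qed

lemma unif_Cb_deriv:
  assumes "unif_Cb (Suc k) S \<Theta> g" "\<theta> \<in> \<Theta>" "x \<in> S"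
  shows "(g \<theta> has_derivative (\<lambda>h. \<Sum>b\<in>Basis. (h \<bullet> b) * partial_deriv b (g \<theta>) x)) (at x)"
  using assms by (intro has_derivative_partial_deriv) simp

lemma unif_Cb_Suc_imp: "unif_Cb (Suc k) S \<Theta> g \<Longrightarrow> unif_Cb k S \<Theta> g"
  by (induction k arbitrary: g) auto

text \<open>One order is lost: \<open>unif_Cb\<close> asks for bounds but not for continuity at the
  top order, so the continuity of the derivatives of order \<open>k\<close> is read off from their
  differentiability.\<close>

lemma unif_Cb_imp_Ck_on: "unif_Cb (Suc k) S \<Theta> g \<Longrightarrow> \<theta> \<in> \<Theta> \<Longrightarrow> Ck_on k S (g \<theta>)"
proof (induction k arbitrary: g)
  case 0
  then show ?case
    by (auto intro!: differentiable_imp_continuous_on differentiable_at_imp_differentiable_on)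
next
  case (Suc k)
  have "Ck_on k S (partial_deriv b (g \<theta>))" if "b \<in> Basis" for b
    using Suc.prems that by (intro Suc.IH[of "\<lambda>\<theta>. partial_deriv b (g \<theta>)"]) auto
  then show ?case using Suc.prems by simp
qed

lemma unif_Cb_const:
  assumes "open S"
  shows "unif_Cb k S \<Theta> (\<lambda>\<theta> x. c)"
proof (induction k arbitrary: c)
  case (Suc k)
  show ?case by (rule unif_Cb_SucI[OF assms, where g' = "\<lambda>\<theta> x h. 0"]) (auto intro: Suc)
qed auto

lemma abs_mult_mono: "\<bar>a::real\<bar> \<le> C \<Longrightarrow> \<bar>b\<bar> \<le> D \<Longrightarrow> \<bar>a * b\<bar> \<le> C * D"
  unfolding abs_mult by (intro mult_mono) auto

lemma abs_add_mono: "\<bar>a::real\<bar> \<le> C \<Longrightarrow> \<bar>b\<bar> \<le> D \<Longrightarrow> \<bar>a + b\<bar> \<le> C + D"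
  by linarith

lemma unif_Cb_add:
  assumes "open S" "unif_Cb k S \<Theta> f" "unif_Cb k S \<Theta> g"
  shows "unif_Cb k S \<Theta> (\<lambda>\<theta> x. f \<theta> x + g \<theta> x)"
  using assms(2,3)
proof (induction k arbitrary: f g)
  case 0
  then obtain C D where "\<forall>\<theta>\<in>\<Theta>. \<forall>x\<in>S. \<bar>f \<theta> x\<bar> \<le> C" "\<forall>\<theta>\<in>\<Theta>. \<forall>x\<in>S. \<bar>g \<theta> x\<bar> \<le> D" by auto
  then have "\<forall>\<theta>\<in>\<Theta>. \<forall>x\<in>S. \<bar>f \<theta> x + g \<theta> x\<bar> \<le> C + D" using abs_add_mono by blast
  then show ?case by auto
next
  case (Suc k)
  obtain C D where "\<forall>\<theta>\<in>\<Theta>. \<forall>x\<in>S. \<bar>f \<theta> x\<bar> \<le> C" "\<forall>\<theta>\<in>\<Theta>. \<forall>x\<in>S. \<bar>g \<theta> x\<bar> \<le> D" using Suc.prems by auto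
  then have "\<forall>\<theta>\<in>\<Theta>. \<forall>x\<in>S. \<bar>f \<theta> x + g \<theta> x\<bar> \<le> C + D" using abs_add_mono by blast
  then show ?case
    using Suc.prems Suc.IH
    by (intro unif_Cb_SucI[OF assms(1) _ has_derivative_add[OF unif_Cb_deriv unif_Cb_deriv]])
      (auto simp: inner_Basis if_distrib if_distribR cong: if_cong)
qed

lemma unif_Cb_mult:
  assumes S: "open S" and fg: "unif_Cb k S \<Theta> f" "unif_Cb k S \<Theta> g"
  shows "unif_Cb k S \<Theta> (\<lambda>\<theta> x. f \<theta> x * g \<theta> x)"
  using fg
proof (induction k arbitrary: f g)
  case 0
  then obtain C D where CD: "\<forall>\<theta>\<in>\<Theta>. \<forall>x\<in>S. \<bar>f \<theta> x\<bar> \<le> C" "\<forall>\<theta>\<in>\<Theta>. \<forall>x\<in>S. \<bar>g \<theta> x\<bar> \<le> D" by auto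
  have "\<forall>\<theta>\<in>\<Theta>. \<forall>x\<in>S. \<bar>f \<theta> x * g \<theta> x\<bar> \<le> C * D"
    by (intro ballI abs_mult_mono CD[rule_format])
  then show ?case by auto
next
  case (Suc k)
  obtain C D where CD: "\<forall>\<theta>\<in>\<Theta>. \<forall>x\<in>S. \<bar>f \<theta> x\<bar> \<le> C" "\<forall>\<theta>\<in>\<Theta>. \<forall>x\<in>S. \<bar>g \<theta> x\<bar> \<le> D" using Suc.prems by auto
  have "\<bar>f \<theta> x * g \<theta> x\<bar> \<le> C * D" if "\<theta> \<in> \<Theta>" "x \<in> S" for \<theta> x
    by (intro abs_mult_mono CD[rule_format] that)
  moreover have "((\<lambda>x. f \<theta> x * g \<theta> x) has_derivative
      (\<lambda>h. f \<theta> x * (\<Sum>c\<in>Basis. (h \<bullet> c) * partial_deriv c (g \<theta>) x) +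
      (\<Sum>c\<in>Basis. (h \<bullet> c) * partial_deriv c (f \<theta>) x) * g \<theta> x)) (at x)" if "\<theta> \<in> \<Theta>" "x \<in> S" for \<theta> x
    by (intro has_derivative_mult unif_Cb_deriv[OF Suc.prems(1)] unif_Cb_deriv[OF Suc.prems(2)] that)
  moreover have "unif_Cb k S \<Theta> (\<lambda>\<theta> x. f \<theta> x * (\<Sum>c\<in>Basis. (b \<bullet> c) * partial_deriv c (g \<theta>) x) +
      (\<Sum>c\<in>Basis. (b \<bullet> c) * partial_deriv c (f \<theta>) x) * g \<theta> x)" if "b \<in> Basis" for b
  proof -
    have "unif_Cb k S \<Theta> (\<lambda>\<theta> x. f \<theta> x * partial_deriv b (g \<theta>) x + partial_deriv b (f \<theta>) x * g \<theta> x)"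
      using Suc.prems that unif_Cb_Suc_imp[OF Suc.prems(1)] unif_Cb_Suc_imp[OF Suc.prems(2)]
      by (intro unif_Cb_add[OF S] Suc.IH) simp_all
    then show ?thesis using that by (simp add: inner_Basis if_distrib if_distribR cong: if_cong)
  qed
  ultimately show ?case by (rule unif_Cb_SucI[OF S])
qed

lemma unif_Cb_sum:
  assumes "open S" "\<And>i. i \<in> I \<Longrightarrow> unif_Cb k S \<Theta> (f i)"
  shows "unif_Cb k S \<Theta> (\<lambda>\<theta> x. \<Sum>i\<in>I. f i \<theta> x)"
  using assms(2)
  by (induction I rule: infinite_finite_induct) (auto intro: unif_Cb_const unif_Cb_add assms(1))

lemma unif_Cb_prod:
  assumes "open S" "\<And>i. i \<in> I \<Longrightarrow> unif_Cb k S \<Theta> (f i)"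
  shows "unif_Cb k S \<Theta> (\<lambda>\<theta> x. \<Prod>i\<in>I. f i \<theta> x)"
  using assms(2)
  by (induction I rule: infinite_finite_induct) (auto intro: unif_Cb_const unif_Cb_mult assms(1))

lemma unif_Cb_cmult:
  assumes "open S" "unif_Cb k S \<Theta> f"
  shows "unif_Cb k S \<Theta> (\<lambda>\<theta> x. c * f \<theta> x)"
  using assms by (intro unif_Cb_mult unif_Cb_const)

lemma unif_Cb_inverse:
  assumes S: "open S" and g: "unif_Cb k S \<Theta> g" and c: "c > 0" "\<And>\<theta> x. \<theta> \<in> \<Theta> \<Longrightarrow> x \<in> S \<Longrightarrow> c \<le> \<bar>g \<theta> x\<bar>"
  shows "unif_Cb k S \<Theta> (\<lambda>\<theta> x. inverse (g \<theta> x))"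
  using g
proof (induction k)
  case 0
  have "\<bar>inverse (g \<theta> x)\<bar> \<le> inverse c" if "\<theta> \<in> \<Theta>" "x \<in> S" for \<theta> x
    using c that by (auto intro!: le_imp_inverse_le)
  then show ?case by auto
next
  case (Suc k)
  have "\<bar>inverse (g \<theta> x)\<bar> \<le> inverse c" if "\<theta> \<in> \<Theta>" "x \<in> S" for \<theta> x
    using c that by (auto intro!: le_imp_inverse_le)
  moreover have "((\<lambda>x. inverse (g \<theta> x)) has_derivative
      (\<lambda>h. - (inverse (g \<theta> x) * (\<Sum>b\<in>Basis. (h \<bullet> b) * partial_deriv b (g \<theta>) x) * inverse (g \<theta> x)))) (at x)"
    if "\<theta> \<in> \<Theta>" "x \<in> S" for \<theta> x
    using c(1) c(2)[OF that] by (intro Deriv.has_derivative_inverse unif_Cb_deriv[OF Suc.prems that]) auto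
  moreover have "unif_Cb k S \<Theta> (\<lambda>\<theta> x. - (inverse (g \<theta> x) * (\<Sum>c\<in>Basis. (b \<bullet> c) * partial_deriv c (g \<theta>) x) * inverse (g \<theta> x)))"
    if "b \<in> Basis" for b
  proof -
    have "unif_Cb k S \<Theta> (\<lambda>\<theta> x. (- 1) * (inverse (g \<theta> x) * partial_deriv b (g \<theta>) x * inverse (g \<theta> x)))"
      using Suc.prems that Suc.IH[OF unif_Cb_Suc_imp[OF Suc.prems]]
      by (intro unif_Cb_cmult[OF S] unif_Cb_mult[OF S]) simp_all
    then show ?thesis using that by (simp add: inner_Basis if_distrib if_distribR cong: if_cong)
  qed
  ultimately show ?case by (rule unif_Cb_SucI[OF S])
qed

lemma unif_Cb_det:
  fixes A :: "'b \<Rightarrow> 'a::euclidean_space \<Rightarrow> real^'n^'n"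
  assumes "open S" "\<And>i j. unif_Cb k S \<Theta> (\<lambda>\<theta> x. A \<theta> x $ i $ j)"
  shows "unif_Cb k S \<Theta> (\<lambda>\<theta> x. det (A \<theta> x))"
  unfolding det_def using assms by (intro unif_Cb_sum unif_Cb_mult unif_Cb_prod unif_Cb_const)

lemma det_bounded:
  assumes "\<And>i j. \<bar>A $ i $ j\<bar> \<le> c"
  shows "\<bar>det (A :: real^'n^'n)\<bar> \<le> (\<Sum>p | p permutes (UNIV::'n set). c ^ CARD('n))"
proof -
  have "\<bar>det A\<bar> \<le> (\<Sum>p | p permutes (UNIV::'n set). \<bar>of_int (sign p) * (\<Prod>i\<in>UNIV. A $ i $ p i)\<bar>)"
    unfolding det_def by (rule sum_abs)
  also have "\<dots> \<le> (\<Sum>p | p permutes (UNIV::'n set). c ^ CARD('n))"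
  proof (rule sum_mono)
    fix p :: "'n \<Rightarrow> 'n"
    have "(\<Prod>i\<in>UNIV. \<bar>A $ i $ p i\<bar>) \<le> (\<Prod>i\<in>(UNIV::'n set). c)" using assms by (intro prod_mono) auto
    then show "\<bar>of_int (sign p) * (\<Prod>i\<in>UNIV. A $ i $ p i)\<bar> \<le> c ^ CARD('n)"
      by (simp add: abs_mult abs_prod sign_def)
  qed
  finally show ?thesis .
qed

text \<open>Cramer's rule writes each entry of the inverse as a quotient of determinants in entries
  of \<open>A\<close>. A bound on the entries of \<open>B\<close> alone keeps the denominator away
  from zero and thus controls all derivatives up to order \<open>k\<close>.\<close>

lemma unif_Cb_matrix_inverse:
  fixes A B :: "'b \<Rightarrow> 'a::euclidean_space \<Rightarrow> real^'n^'n"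
  assumes S: "open S" and A: "\<And>i j. unif_Cb k S \<Theta> (\<lambda>\<theta> x. A \<theta> x $ i $ j)"
    and inv: "\<And>\<theta> x. \<theta> \<in> \<Theta> \<Longrightarrow> x \<in> S \<Longrightarrow> A \<theta> x ** B \<theta> x = mat 1"
    and bd: "\<And>\<theta> x i j. \<theta> \<in> \<Theta> \<Longrightarrow> x \<in> S \<Longrightarrow> \<bar>B \<theta> x $ i $ j\<bar> \<le> c"
  shows "unif_Cb k S \<Theta> (\<lambda>\<theta> x. B \<theta> x $ i $ j)"
proof -
  \<comment> \<open>A bound for \<open>|det (B \<theta> x)|\<close> from the Leibniz formula. As the
    determinants are reciprocal, \<open>|det (A \<theta> x)|\<close> is at least the inverse of
    \<open>|K| + 1\<close>, where the 1 ensures positivity.\<close>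
  define K where "K = (\<Sum>p | p permutes (UNIV::'n set). c ^ CARD('n))"
  have dd: "det (A \<theta> x) * det (B \<theta> x) = 1" if "\<theta> \<in> \<Theta>" "x \<in> S" for \<theta> x
    using inv[OF that] by (metis det_I det_mul)
  have lower: "inverse (\<bar>K\<bar> + 1) \<le> \<bar>det (A \<theta> x)\<bar>" if "\<theta> \<in> \<Theta>" "x \<in> S" for \<theta> x
  proof -
    have "\<bar>det (B \<theta> x)\<bar> \<le> \<bar>K\<bar> + 1" using det_bounded[OF bd[OF that]] unfolding K_def[symmetric] by linarith
    moreover have d0: "\<bar>det (B \<theta> x)\<bar> > 0" using dd[OF that] by auto
    ultimately have "inverse (\<bar>K\<bar> + 1) \<le> inverse \<bar>det (B \<theta> x)\<bar>" by (rule le_imp_inverse_le)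
    moreover have "\<bar>det (A \<theta> x)\<bar> * \<bar>det (B \<theta> x)\<bar> = 1" using dd[OF that] by (simp flip: abs_mult)
    then have "\<bar>det (A \<theta> x)\<bar> = inverse \<bar>det (B \<theta> x)\<bar>" using d0 by (simp add: field_simps)
    ultimately show ?thesis by simp
  qed
  define N where "N \<theta> x = (\<chi> p q. if q = i then axis j 1 $ p else A \<theta> x $ p $ q)" for \<theta> x
  have "unif_Cb k S \<Theta> (\<lambda>\<theta> x. N \<theta> x $ p $ q)" for p q
    using A S by (cases "q = i") (simp_all add: N_def unif_Cb_const)
  then have "unif_Cb k S \<Theta> (\<lambda>\<theta> x. det (N \<theta> x) * inverse (det (A \<theta> x)))"
    using A lower by (intro unif_Cb_mult[OF S] unif_Cb_inverse[OF S, where c = "inverse (\<bar>K\<bar> + 1)"] unif_Cb_det[OF S]) auto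
  moreover have "B \<theta> x $ i $ j = det (N \<theta> x) * inverse (det (A \<theta> x))" if "\<theta> \<in> \<Theta>" "x \<in> S" for \<theta> x
  proof -
    have "A \<theta> x *v (B \<theta> x *v axis j 1) = axis j 1"
      by (simp add: matrix_vector_mul_assoc inv[OF that])
    moreover have "det (A \<theta> x) \<noteq> 0" using dd[OF that] by auto
    ultimately have "B \<theta> x *v axis j 1 = (\<chi> k. det (\<chi> p q. if q = k then axis j 1 $ p else A \<theta> x $ p $ q) / det (A \<theta> x))"
      using cramer by blast
    then have "(B \<theta> x *v axis j 1) $ i = det (N \<theta> x) / det (A \<theta> x)" by (simp add: N_def)
    then show ?thesis by (simp add: matrix_vector_mult_basis column_def divide_inverse)
  qed
  ultimately show ?thesis
    by (subst unif_Cb_cong[OF S]) auto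
qed

text \<open>The derivative of \<Psi> at \<open>x\<close> is assumed to be a function
  \<open>E\<close> of the image point. The partial derivatives of the composition are then again a
  function composed with the same \<Psi>, built from \<open>E\<close> and partial derivatives of
  \<open>g\<close>, and the induction closes without bounds on \<Psi> itself, which may be
  unbounded.\<close>

lemma unif_Cb_compose:
  fixes \<Psi> :: "'b \<Rightarrow> 'a::euclidean_space \<Rightarrow> 'a"
  assumes S: "open S" and maps: "\<And>\<theta> x. \<theta> \<in> \<Theta> \<Longrightarrow> x \<in> S \<Longrightarrow> \<Psi> \<theta> x \<in> S"
    and d: "\<And>\<theta> x. \<theta> \<in> \<Theta> \<Longrightarrow> x \<in> S \<Longrightarrow> (\<Psi> \<theta> has_derivative E \<theta> (\<Psi> \<theta> x)) (at x)"
    and E: "\<And>b c k. b \<in> Basis \<Longrightarrow> c \<in> Basis \<Longrightarrow> unif_Cb k S \<Theta> (\<lambda>\<theta> y. E \<theta> y b \<bullet> c)"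
    and g: "unif_Cb k S \<Theta> g"
  shows "unif_Cb k S \<Theta> (\<lambda>\<theta> x. g \<theta> (\<Psi> \<theta> x))"
  using g
proof (induction k arbitrary: g)
  case 0
  then show ?case using maps by auto blast
next
  case (Suc k)
  obtain C where C: "\<forall>\<theta>\<in>\<Theta>. \<forall>x\<in>S. \<bar>g \<theta> x\<bar> \<le> C" using Suc.prems by auto
  have dg: "((\<lambda>x. g \<theta> (\<Psi> \<theta> x)) has_derivative
      (\<lambda>h. \<Sum>c\<in>Basis. (E \<theta> (\<Psi> \<theta> x) h \<bullet> c) * partial_deriv c (g \<theta>) (\<Psi> \<theta> x))) (at x)" if "\<theta> \<in> \<Theta>" "x \<in> S" for \<theta> x
    using has_derivative_compose[OF d[OF that] unif_Cb_deriv[OF Suc.prems that(1) maps[OF that]]] .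
  show ?case
  proof (rule unif_Cb_SucI[OF S _ dg])
    fix b :: 'a assume b: "b \<in> Basis"
    show "unif_Cb k S \<Theta> (\<lambda>\<theta> x. \<Sum>c\<in>Basis. (E \<theta> (\<Psi> \<theta> x) b \<bullet> c) * partial_deriv c (g \<theta>) (\<Psi> \<theta> x))"
      using Suc.prems
      by (intro Suc.IH[of "\<lambda>\<theta> y. \<Sum>c\<in>Basis. (E \<theta> y b \<bullet> c) * partial_deriv c (g \<theta>) y"]
          unif_Cb_sum[OF S] unif_Cb_mult[OF S] E[OF b]) auto
  qed (use C maps in auto)
qed

section \<open>Gaussian integrals\<close>

text \<open>Differentiation under the integral sign in the Frechet sense. The normalised remainders
  tend to 0 pointwise and are dominated by \<open>2 * w\<close>, so dominated convergence along
  sequences applies.\<close>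

lemma has_derivative_integral_dominated:
  fixes F :: "'a::euclidean_space \<Rightarrow> 'z \<Rightarrow> real"
  assumes r: "r > 0" and int: "\<And>p. p \<in> ball p0 r \<Longrightarrow> integrable M (F p)"
    and der: "\<And>p z. p \<in> ball p0 r \<Longrightarrow> ((\<lambda>p. F p z) has_derivative D p z) (at p)"
    and bound: "\<And>p z h. p \<in> ball p0 r \<Longrightarrow> \<bar>D p z h\<bar> \<le> w z * norm h"
    and w: "integrable M w" and intD: "\<And>h. integrable M (\<lambda>z. D p0 z h)"
  shows "((\<lambda>p. integral\<^sup>L M (F p)) has_derivative (\<lambda>h. \<integral>z. D p0 z h \<partial>M)) (at p0)"
proof -
  have p0: "p0 \<in> ball p0 r" using r by simp
  have lin: "bounded_linear (D p z)" if "p \<in> ball p0 r" for p z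
    using der[OF that] by (rule has_derivative_bounded_linear)
  have w0: "0 \<le> w z" for z
  proof -
    obtain b :: 'a where "b \<in> Basis" using nonempty_Basis by blast
    then show ?thesis using bound[OF p0, of z b] by simp
  qed
  have mvt: "\<bar>F p z - F p0 z\<bar> \<le> w z * norm (p - p0)" if "p \<in> ball p0 r" for p z
  proof -
    have "norm (F p z - F p0 z) \<le> w z * norm (p - p0)"
    proof (rule differentiable_bound[of "ball p0 r" "\<lambda>p. F p z" "\<lambda>p. D p z"])
      fix x assume x: "x \<in> ball p0 r"
      show "((\<lambda>p. F p z) has_derivative D x z) (at x within ball p0 r)"
        using der[OF x] by (rule has_derivative_at_withinI)
      show "onorm (D x z) \<le> w z" using bound[OF x] by (intro onorm_bound w0) auto
    qed (use that p0 in auto)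
    then show ?thesis by simp
  qed
  have linI: "linear (\<lambda>h. \<integral>z. D p0 z h \<partial>M)"
    using intD by (intro linearI)
      (simp_all add: linear_add[OF bounded_linear.linear[OF lin[OF p0]]] linear_cmul[OF bounded_linear.linear[OF lin[OF p0]]])
  let ?I = "\<lambda>p. integral\<^sup>L M (F p)"
  let ?L = "\<lambda>h. \<integral>z. D p0 z h \<partial>M"
  have "((\<lambda>y. norm ((?I y - ?I p0) - ?L (y - p0)) / norm (y - p0)) \<longlongrightarrow> 0) (at p0)"
    unfolding tendsto_at_iff_sequentially comp_def
  proof (intro allI impI)
    fix X :: "nat \<Rightarrow> 'a" assume X: "\<forall>i. X i \<in> UNIV - {p0}" "X \<longlonglongrightarrow> p0"
    obtain N where N: "\<And>i. i \<ge> N \<Longrightarrow> X i \<in> ball p0 r"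
      using X(2) r unfolding lim_sequentially by (metis dist_commute mem_ball)
    \<comment> \<open>Dropping finitely many terms keeps the sequence in the ball where the
      hypotheses hold.\<close>
    define Y where "Y i = X (i + N)" for i
    have Y: "Y i \<in> ball p0 r" "Y i \<noteq> p0" for i using N X by (auto simp: Y_def)
    have Ylim: "Y \<longlonglongrightarrow> p0" unfolding Y_def by (rule LIMSEQ_ignore_initial_segment[OF X(2)])
    define s where "s i z = norm ((F (Y i) z - F p0 z) - D p0 z (Y i - p0)) / norm (Y i - p0)" for i z
    have sint: "integrable M (s i)" for i
      unfolding s_def using int[OF Y(1)] int[OF p0] intD by auto
    have "(\<lambda>i. integral\<^sup>L M (s i)) \<longlonglongrightarrow> integral\<^sup>L M (\<lambda>z. 0::real)"
    proof (rule integral_dominated_convergence[where w = "\<lambda>z. 2 * w z"])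
      show "AE z in M. (\<lambda>i. s i z) \<longlonglongrightarrow> 0"
      proof (rule AE_I2)
        fix z
        have "((\<lambda>y. norm ((F y z - F p0 z) - D p0 z (y - p0)) / norm (y - p0)) \<longlongrightarrow> 0) (at p0)"
          using der[OF p0, of z] by (simp add: has_derivative_iff_norm)
        then show "(\<lambda>i. s i z) \<longlonglongrightarrow> 0"
          unfolding s_def tendsto_at_iff_sequentially comp_def using Y(2) Ylim by auto
      qed
      show "AE z in M. norm (s i z) \<le> 2 * w z" for i
      proof (rule AE_I2)
        fix z
        \<comment> \<open>One \<open>w z\<close> bounds the increment by the mean value inequality,
          the other bounds the linear part.\<close>
        have "norm ((F (Y i) z - F p0 z) - D p0 z (Y i - p0)) \<le> 2 * w z * norm (Y i - p0)"
          using mvt[OF Y(1), of i z] bound[OF p0, of z "Y i - p0"] by simp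
        then show "norm (s i z) \<le> 2 * w z" using Y(2)[of i] by (simp add: s_def divide_le_eq)
      qed
    qed (use sint w in auto)
    then have lim: "(\<lambda>i. integral\<^sup>L M (s i)) \<longlonglongrightarrow> 0" by simp
    have "(\<lambda>i. norm ((?I (Y i) - ?I p0) - ?L (Y i - p0)) / norm (Y i - p0)) \<longlonglongrightarrow> 0"
    proof (rule tendsto_sandwich[OF _ _ tendsto_const lim])
      show "\<forall>\<^sub>F i in sequentially. norm ((?I (Y i) - ?I p0) - ?L (Y i - p0)) / norm (Y i - p0) \<le> integral\<^sup>L M (s i)"
      proof (rule always_eventually, rule allI)
        fix i
        have "(?I (Y i) - ?I p0) - ?L (Y i - p0) = (\<integral>z. (F (Y i) z - F p0 z) - D p0 z (Y i - p0) \<partial>M)"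
          using int[OF Y(1)] int[OF p0] intD by simp
        also have "norm \<dots> \<le> (\<integral>z. norm ((F (Y i) z - F p0 z) - D p0 z (Y i - p0)) \<partial>M)"
          by (rule integral_norm_bound)
        finally show "norm ((?I (Y i) - ?I p0) - ?L (Y i - p0)) / norm (Y i - p0) \<le> integral\<^sup>L M (s i)"
          unfolding s_def by (simp add: divide_right_mono)
      qed
    qed auto
    then show "(\<lambda>i. norm ((?I (X i) - ?I p0) - ?L (X i - p0)) / norm (X i - p0)) \<longlonglongrightarrow> 0"
      unfolding Y_def by (rule LIMSEQ_offset)
  qed
  then show ?thesis
    unfolding has_derivative_iff_norm using linI linear_conv_bounded_linear by blast
qed

lemma lborel_integral_affine:
  fixes g :: "'a::euclidean_space \<Rightarrow> real"
  assumes [measurable]: "g \<in> borel_measurable borel" and c: "c \<noteq> 0"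
  shows "integral\<^sup>L lborel g = \<bar>c\<bar> ^ DIM('a) * (\<integral>x. g (t + c *\<^sub>R x) \<partial>lborel)"
  by (subst lborel_affine[OF c, of t]) (simp add: integral_density integral_distr)

lemma lborel_integrable_affine:
  fixes g :: "'a::euclidean_space \<Rightarrow> real"
  assumes [measurable]: "g \<in> borel_measurable borel" and c: "c \<noteq> 0"
  shows "integrable lborel (\<lambda>x. g (t + c *\<^sub>R x)) \<longleftrightarrow> integrable lborel g"
  by (subst (2) lborel_affine[OF c, of t]) (simp add: integrable_density integrable_distr_eq c)

lemma integrable_exp_neg_square:
  fixes B :: real
  assumes B: "B > 0"
  shows "integrable lborel (\<lambda>x::real. exp (- x\<^sup>2 / B))"
proof -
  define \<sigma> where "\<sigma> = sqrt (B / 2)"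
  have s: "\<sigma> > 0" "2 * \<sigma>\<^sup>2 = B" using B by (auto simp: \<sigma>_def)
  have "integrable lborel (\<lambda>x. sqrt (2 * pi * \<sigma>\<^sup>2) * normal_density 0 \<sigma> x)"
    by (intro integrable_mult_right integrable_normal_density[OF s(1)])
  then show ?thesis using s B by (simp add: normal_density_def)
qed

lemma integrable_gaussian:
  fixes B :: real
  assumes B: "B > 0"
  shows "integrable lborel (\<lambda>x::'a::euclidean_space. exp (- (x \<bullet> x) / B))"
proof (rule integrableI_nonneg)
  have "(\<integral>\<^sup>+x. ennreal (exp (- (x \<bullet> x) / B)) \<partial>(lborel :: 'a measure)) =
      (\<integral>\<^sup>+x. (\<Prod>b\<in>Basis. ennreal (exp (- (x \<bullet> b)\<^sup>2 / B))) \<partial>(lborel :: 'a measure))"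
  proof (rule nn_integral_cong)
    fix x :: 'a
    have "- (x \<bullet> x) / B = (\<Sum>b\<in>Basis. - (x \<bullet> b)\<^sup>2 / B)"
      by (subst euclidean_inner[of x x]) (simp add: power2_eq_square sum_negf sum_divide_distrib)
    then show "ennreal (exp (- (x \<bullet> x) / B)) = (\<Prod>b\<in>Basis. ennreal (exp (- (x \<bullet> b)\<^sup>2 / B)))"
      by (simp add: exp_sum prod_ennreal)
  qed
  also have "\<dots> = (\<Prod>b\<in>(Basis::'a set). (\<integral>\<^sup>+x. ennreal (exp (- x\<^sup>2 / B)) \<partial>lborel))"
    by (rule nn_integral_lborel_prod) auto
  also have "\<dots> < \<infinity>"
  proof -
    have "(\<integral>\<^sup>+x. ennreal (exp (- x\<^sup>2 / B)) \<partial>lborel) < \<infinity>"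
      using integrable_exp_neg_square[OF B] by (simp add: integrable_iff_bounded)
    then show ?thesis by (simp add: power_less_top_ennreal)
  qed
  finally show "(\<integral>\<^sup>+x. ennreal (exp (- (x \<bullet> x) / B)) \<partial>(lborel :: 'a measure)) < \<infinity>" .
qed auto

text \<open>For any rate \<gamma>, however small, a polynomial factor is absorbed by an exponential
  with that rate at the price of a constant. This is how factors of \<open>x\<close> are traded for
  a slightly weaker Gaussian decay.\<close>

lemma self_le_exp_square: "\<gamma> > 0 \<Longrightarrow> s \<le> (1 + 1 / \<gamma>) * exp (\<gamma> * s\<^sup>2)" for s :: real
proof -
  assume g: "\<gamma> > 0"
  have "s * 2 \<le> 1 + s\<^sup>2" using sum_squares_bound[of s 1] by simp
  moreover have "0 \<le> s\<^sup>2" by simp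
  ultimately have "s \<le> 1 + s\<^sup>2" by linarith
  also have "\<dots> \<le> (1 + 1 / \<gamma>) * (1 + \<gamma> * s\<^sup>2)" using g by (simp add: field_simps)
  also have "\<dots> \<le> (1 + 1 / \<gamma>) * exp (\<gamma> * s\<^sup>2)" using g by (intro mult_left_mono exp_ge_add_one_self) auto
  finally show ?thesis .
qed

lemma one_plus_square_le_exp: "\<gamma> > 0 \<Longrightarrow> 1 + s\<^sup>2 \<le> (1 + 1 / \<gamma>) * exp (\<gamma> * s\<^sup>2)" for s :: real
proof -
  assume g: "\<gamma> > 0"
  have "1 + s\<^sup>2 \<le> (1 + 1 / \<gamma>) * (1 + \<gamma> * s\<^sup>2)" using g by (simp add: field_simps)
  also have "\<dots> \<le> (1 + 1 / \<gamma>) * exp (\<gamma> * s\<^sup>2)" using g by (intro mult_left_mono exp_ge_add_one_self) auto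
  finally show ?thesis .
qed

text \<open>Half of the decay rate absorbs the quadratic factor and the other half is integrated,
  whence the passage from \<open>B\<close> to \<open>2 * B\<close>.\<close>

lemma integrable_square_gaussian:
  fixes B :: real and y :: "'a::euclidean_space"
  assumes B: "B > 0"
  shows "integrable lborel (\<lambda>x. (1 + (x - y) \<bullet> (x - y)) * exp (- ((x - y) \<bullet> (x - y)) / B))"
proof -
  have *: "integrable lborel (\<lambda>x::'a. (1 + x \<bullet> x) * exp (- (x \<bullet> x) / B))"
  proof (rule Bochner_Integration.integrable_bound)
    show "integrable lborel (\<lambda>x::'a. (1 + 2 * B) * exp (- (x \<bullet> x) / (2 * B)))"
      using integrable_gaussian[of "2 * B"] B by auto
    show "AE x::'a in lborel. norm ((1 + x \<bullet> x) * exp (- (x \<bullet> x) / B)) \<le> norm ((1 + 2 * B) * exp (- (x \<bullet> x) / (2 * B)))"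
    proof (rule AE_I2)
      fix x :: 'a
      have "1 + x \<bullet> x \<le> (1 + 2 * B) * exp ((x \<bullet> x) / (2 * B))"
        using one_plus_square_le_exp[of "1 / (2 * B)" "norm x"] B by (simp add: power2_norm_eq_inner)
      then have "(1 + x \<bullet> x) * exp (- (x \<bullet> x) / B) \<le> (1 + 2 * B) * exp ((x \<bullet> x) / (2 * B)) * exp (- (x \<bullet> x) / B)"
        by (intro mult_right_mono) auto
      also have "\<dots> = (1 + 2 * B) * exp (- (x \<bullet> x) / (2 * B))"
        using B by (simp add: mult_exp_exp field_simps)
      finally show "norm ((1 + x \<bullet> x) * exp (- (x \<bullet> x) / B)) \<le> norm ((1 + 2 * B) * exp (- (x \<bullet> x) / (2 * B)))"
        using B by (simp add: abs_mult add_nonneg_nonneg)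
    qed
  qed auto
  then have "integrable lborel (\<lambda>x::'a. (\<lambda>x. (1 + x \<bullet> x) * exp (- (x \<bullet> x) / B)) (- y + 1 *\<^sub>R x))"
    by (subst lborel_integrable_affine) auto
  then show ?thesis by simp
qed

section \<open>Derivatives of the heat kernel\<close>

abbreviation ddx :: "'n \<Rightarrow> ((real^'n) \<times> real \<Rightarrow> real) \<Rightarrow> (real^'n) \<times> real \<Rightarrow> real" where
  "ddx i \<equiv> partial_deriv (axis i 1, 0)"

abbreviation ddt :: "((real^'n) \<times> real \<Rightarrow> real) \<Rightarrow> (real^'n) \<times> real \<Rightarrow> real" where
  "ddt \<equiv> partial_deriv (0, 1)"

text \<open>The kernel of \<open>v\<^sub>t = \<surd>2 \<Delta>v\<close> is a multiple of \<open>t\<^bsup>-n/2\<^esup> exp (-|x|\<^sup>2/(4 \<surd>2 t))\<close>.\<close>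

definition hc :: real where "hc = 4 * sqrt 2"

lemma hc_pos [simp]: "hc > 0" "hc \<noteq> 0" "0 \<le> hc" by (simp_all add: hc_def)

definition gauss :: "real \<Rightarrow> (real^'n) \<times> real \<Rightarrow> real" where
  "gauss r p = snd p powr r * exp (- (fst p \<bullet> fst p) / (hc * snd p))"

text \<open>The degree \<open>d\<close> is the parabolic homogeneity: \<open>q (s x, s\<^sup>2 t) = s\<^sup>d q (x, t)\<close> for \<open>s, t > 0\<close>.\<close>

inductive heat_type :: "real \<Rightarrow> ((real^'n) \<times> real \<Rightarrow> real) \<Rightarrow> bool" where
  gauss: "heat_type (2 * r) (gauss r)"
| coord: "heat_type d q \<Longrightarrow> heat_type (d + 1) (\<lambda>p. fst p $ i * q p)"
| add: "heat_type d q \<Longrightarrow> heat_type d q' \<Longrightarrow> heat_type d (\<lambda>p. q p + q' p)"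
| cmult: "heat_type d q \<Longrightarrow> heat_type d (\<lambda>p. a * q p)"
| cong: "heat_type d q \<Longrightarrow> (\<And>p. snd p > 0 \<Longrightarrow> q' p = q p) \<Longrightarrow> heat_type d q'"

text \<open>The function \<open>q0\<close> only certifies that the zero function, the empty sum, has
  degree \<open>d\<close>.\<close>

lemma heat_type_sum:
  fixes q :: "'i \<Rightarrow> (real^'n) \<times> real \<Rightarrow> real" and q0 :: "(real^'n) \<times> real \<Rightarrow> real"
  assumes "\<And>i. i \<in> I \<Longrightarrow> heat_type d (q i)" "finite I" "heat_type d q0"
  shows "heat_type d (\<lambda>p. \<Sum>i\<in>I. q i p)"
  using assms(2,1)
proof (induction I rule: finite_induct)
  case empty
  show ?case using heat_type.cmult[OF assms(3), of 0] by simp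
next
  case (insert i I)
  then show ?case using heat_type.add[of d "q i"] by simp
qed

lemma open_upper: "open {p :: (real^'n) \<times> real. snd p > 0}"
  by (intro open_Collect_less continuous_intros)

lemma gauss_has_derivative:
  assumes t: "snd p > 0"
  shows "(gauss r has_derivative (\<lambda>h. - (2 / hc) * (fst p \<bullet> fst h) * gauss (r - 1) p +
     snd h * (r * gauss (r - 1) p + 1 / hc * ((fst p \<bullet> fst p) * gauss (r - 2) p)))) (at p)"
proof -
  have "((\<lambda>s. s powr r) has_derivative (\<lambda>\<tau>. \<tau> * (r * snd p powr (r - 1)))) (at (snd p))"
    using has_real_derivative_powr[OF t, of r] unfolding has_field_derivative_def
    by (rule has_derivative_eq_rhs) (simp add: fun_eq_iff)
  from has_derivative_compose[OF has_derivative_snd[OF has_derivative_ident] this]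
  have 1: "((\<lambda>p. snd p powr r) has_derivative (\<lambda>h. snd h * (r * snd p powr (r - 1)))) (at p)" .
  have 2: "((\<lambda>p. - (fst p \<bullet> fst p) / (hc * snd p)) has_derivative
     (\<lambda>h. - (2 / hc) * (fst p \<bullet> fst h) / snd p + snd h * ((fst p \<bullet> fst p) / (hc * (snd p)\<^sup>2)))) (at p)"
    using t by (auto intro!: derivative_eq_intros simp: fun_eq_iff inner_commute field_simps power2_eq_square)
  have 3: "((\<lambda>p. exp (- (fst p \<bullet> fst p) / (hc * snd p))) has_derivative
     (\<lambda>h. exp (- (fst p \<bullet> fst p) / (hc * snd p)) *
       (- (2 / hc) * (fst p \<bullet> fst h) / snd p + snd h * ((fst p \<bullet> fst p) / (hc * (snd p)\<^sup>2))))) (at p)"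
    by (rule has_derivative_eq_rhs[OF has_derivative_exp[OF 2]]) (simp add: fun_eq_iff mult.commute)
  have pw: "snd p powr (r - 1) = snd p powr r / snd p" "snd p powr (r - 2) = snd p powr r / (snd p)\<^sup>2"
    using t by (simp_all add: powr_diff powr_numeral)
  show ?thesis
    unfolding gauss_def[abs_def]
    by (rule has_derivative_eq_rhs[OF has_derivative_mult[OF 1 3]])
      (use t in \<open>simp add: fun_eq_iff pw field_simps power2_eq_square\<close>)
qed

text \<open>The class is closed under differentiation, where a space derivative lowers the parabolic
  degree by one and a time derivative by two. The rule \<open>heat_type.cong\<close> lets derivative
  formulas enter that hold only for positive time.\<close>

lemma heat_type_partial_deriv:
  fixes q :: "(real^'n) \<times> real \<Rightarrow> real"
  assumes "heat_type d q"
  shows "(\<forall>p. snd p > 0 \<longrightarrow> q differentiable (at p)) \<and>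
    (\<forall>i. heat_type (d - 1) (ddx i q)) \<and>
    heat_type (d - 2) (ddt q)"
  using assms
proof (induction rule: heat_type.induct)
  case (gauss r)
  have g: "heat_type (2 * r - 2) (gauss (r - 1))" "heat_type (2 * r - 4) (gauss (r - 2))"
    using heat_type.gauss[of "r - 1"] heat_type.gauss[of "r - 2"] by simp_all
  have s: "heat_type (2 * r - 1) (\<lambda>p. - (2 / hc) * (fst p $ i * gauss (r - 1) p))" for i :: 'n
    using heat_type.coord[OF g(1), of i] by (intro heat_type.cmult) simp
  have 1: "heat_type (2 * r - 1) (ddx i (gauss r))" for i :: 'n
    by (rule heat_type.cong[OF s[of i]]) (simp add: partial_deriv_eq[OF gauss_has_derivative] inner_axis)
  have "heat_type (2 * r - 2) (\<lambda>p. fst p $ i * (fst p $ i * gauss (r - 2) p))" for i :: 'n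
    using heat_type.coord[OF heat_type.coord[OF g(2), of i], of i] by simp
  then have "heat_type (2 * r - 2) (\<lambda>p::(real^'n) \<times> real. \<Sum>i\<in>UNIV. fst p $ i * (fst p $ i * gauss (r - 2) p))"
    using g(1) by (intro heat_type_sum[of UNIV]) auto
  then have "heat_type (2 * r - 2) (\<lambda>p::(real^'n) \<times> real. r * gauss (r - 1) p +
     1 / hc * (\<Sum>i\<in>UNIV. fst p $ i * (fst p $ i * gauss (r - 2) p)))"
    using g(1) by (intro heat_type.add heat_type.cmult)
  then have 2: "heat_type (2 * r - 2) (ddt (gauss r :: (real^'n) \<times> real \<Rightarrow> real))"
    by (rule heat_type.cong)
      (simp add: partial_deriv_eq[OF gauss_has_derivative] inner_vec_def sum_distrib_right mult.assoc)
  show ?case using 1 2 gauss_has_derivative unfolding differentiable_def by blast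
next
  case (coord d q i)
  have d: "((\<lambda>p. fst p $ i * q p) has_derivative (\<lambda>h. fst p $ i * frechet_derivative q (at p) h + fst h $ i * q p)) (at p)"
    if "snd p > 0" for p
  proof -
    have "(q has_derivative frechet_derivative q (at p)) (at p)" using coord.IH that frechet_derivative_works by blast
    then show ?thesis
      by (intro has_derivative_mult bounded_linear.has_derivative[OF bounded_linear_vec_nth] has_derivative_fst has_derivative_ident)
  qed
  have pd: "partial_deriv b (\<lambda>p. fst p $ i * q p) p = fst p $ i * partial_deriv b q p + fst b $ i * q p"
    if "snd p > 0" for p b
    using partial_deriv_eq[OF d[OF that], of b] by (simp add: partial_deriv_def)
  have "heat_type d (\<lambda>p. fst p $ i * ddx j q p + axis j 1 $ i * q p)" for j
    using heat_type.add[OF _ heat_type.cmult[OF coord.hyps]] heat_type.coord[of "d - 1" "ddx j q" i] coord.IH by simp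
  then have 1: "heat_type d (ddx j (\<lambda>p. fst p $ i * q p))" for j
    by (rule heat_type.cong) (simp add: pd)
  have "heat_type (d - 1) (\<lambda>p. fst p $ i * ddt q p)"
    using heat_type.coord[of "d - 2" "ddt q" i] coord.IH by simp
  then have "heat_type (d - 1) (ddt (\<lambda>p. fst p $ i * q p))"
    by (rule heat_type.cong) (simp add: pd)
  moreover have "\<forall>p. snd p > 0 \<longrightarrow> (\<lambda>p. fst p $ i * q p) differentiable (at p)"
    using d unfolding differentiable_def by blast
  ultimately show ?case using 1 by simp
next
  case (add d q q')
  have d: "((\<lambda>p. q p + q' p) has_derivative (\<lambda>h. frechet_derivative q (at p) h + frechet_derivative q' (at p) h)) (at p)"
    if "snd p > 0" for p
    using add.IH that frechet_derivative_works by (intro has_derivative_add) blast+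
  have pd: "partial_deriv b (\<lambda>p. q p + q' p) p = partial_deriv b q p + partial_deriv b q' p"
    if "snd p > 0" for p b
    using partial_deriv_eq[OF d[OF that], of b] by (simp add: partial_deriv_def)
  have "heat_type (d - 1) (ddx i (\<lambda>p. q p + q' p))" for i
    using heat_type.add[of "d - 1" "ddx i q" "ddx i q'"] add.IH
    by (intro heat_type.cong[OF _ pd]) auto
  moreover have "heat_type (d - 2) (ddt (\<lambda>p. q p + q' p))"
    using heat_type.add[of "d - 2" "ddt q" "ddt q'"] add.IH
    by (intro heat_type.cong[OF _ pd]) auto
  moreover have "\<forall>p. snd p > 0 \<longrightarrow> (\<lambda>p. q p + q' p) differentiable (at p)"
    using d unfolding differentiable_def by blast
  ultimately show ?case by blast
next
  case (cmult d q a)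
  have d: "((\<lambda>p. a * q p) has_derivative (\<lambda>h. a * frechet_derivative q (at p) h)) (at p)"
    if "snd p > 0" for p
    using cmult.IH that frechet_derivative_works by (intro has_derivative_mult_right) blast
  have pd: "partial_deriv b (\<lambda>p. a * q p) p = a * partial_deriv b q p"
    if "snd p > 0" for p b
    using partial_deriv_eq[OF d[OF that], of b] by (simp add: partial_deriv_def)
  have "heat_type (d - 1) (ddx i (\<lambda>p. a * q p))" for i
    using heat_type.cmult[of "d - 1" "ddx i q"] cmult.IH
    by (intro heat_type.cong[OF _ pd]) auto
  moreover have "heat_type (d - 2) (ddt (\<lambda>p. a * q p))"
    using heat_type.cmult[of "d - 2" "ddt q"] cmult.IH
    by (intro heat_type.cong[OF _ pd]) auto
  moreover have "\<forall>p. snd p > 0 \<longrightarrow> (\<lambda>p. a * q p) differentiable (at p)"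
    using d unfolding differentiable_def by blast
  ultimately show ?case by blast
next
  case (cong d q q')
  have pd: "partial_deriv b q' p = partial_deriv b q p" if "snd p > 0" for p b
    using that cong.hyps by (intro partial_deriv_cong_open[OF open_upper]) auto
  have "q' differentiable (at p)" if "snd p > 0" for p
  proof -
    have "q differentiable (at p)" using cong.IH that by blast
    then show ?thesis
      by (subst differentiable_cong_open[OF open_upper, of p q' q]) (use that cong.hyps in simp_all)
  qed
  moreover have "heat_type (d - 1) (ddx i q')" for i
    using cong.IH by (intro heat_type.cong[OF _ pd]) auto
  moreover have "heat_type (d - 2) (ddt q')"
    using cong.IH by (intro heat_type.cong[OF _ pd]) auto
  ultimately show ?case by blast
qed

lemma heat_type_differentiable: "heat_type d q \<Longrightarrow> snd p > 0 \<Longrightarrow> q differentiable (at p)"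
  and heat_type_space_deriv: "heat_type d q \<Longrightarrow> heat_type (d - 1) (ddx i q)"
  and heat_type_time_deriv: "heat_type d q \<Longrightarrow> heat_type (d - 2) (ddt q)"
  using heat_type_partial_deriv by blast+

text \<open>The power \<open>d / 2\<close> of \<open>t\<close> is forced by homogeneity. Every
  factor \<open>x\<close> costs some Gaussian decay, so the induction carries the claim for all
  \<open>B > hc\<close> at once.\<close>

lemma heat_type_bound:
  fixes q :: "(real^'n) \<times> real \<Rightarrow> real"
  assumes "heat_type d q" "B > hc"
  obtains C where "C \<ge> 0" "\<And>x t. t > 0 \<Longrightarrow> \<bar>q (x, t)\<bar> \<le> C * t powr (d / 2) * exp (- (x \<bullet> x) / (B * t))"
proof -
  define bd where "bd d B C q \<longleftrightarrow> C \<ge> 0 \<and> (\<forall>x t. t > 0 \<longrightarrow> \<bar>q (x, t)\<bar> \<le> C * t powr (d / 2) * exp (- (x \<bullet> x) / (B * t)))"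
    for d B C and q :: "(real^'n) \<times> real \<Rightarrow> real"
  note bdD = bd_def[THEN iffD1, THEN conjunct2, rule_format]
  have "\<forall>B>hc. \<exists>C. bd d B C q"
    using assms(1)
  proof (induction rule: heat_type.induct)
    case (gauss r)
    have "\<bar>gauss r (x::real^'n, t)\<bar> \<le> 1 * t powr (2 * r / 2) * exp (- (x \<bullet> x) / (B * t))" if "B > hc" "t > 0" for B x t
    proof -
      have "(x \<bullet> x) / (B * t) \<le> (x \<bullet> x) / (hc * t)"
        using that hc_pos by (intro divide_left_mono mult_right_mono mult_pos_pos) (auto intro: order_less_trans[OF hc_pos(1)])
      then show ?thesis using that by (auto simp: gauss_def intro!: mult_left_mono)
    qed
    then show ?case unfolding bd_def by (intro allI impI exI[of _ 1]) auto
  next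
    case (coord d q i)
    show ?case
    proof (intro allI impI)
      fix B assume B: "B > hc"
      \<comment> \<open>The induction hypothesis is used at an intermediate rate; the difference
        \<gamma> between the rates pays for the coordinate factor.\<close>
      define B1 where "B1 = (B + hc) / 2"
      have B1: "B1 > hc" "B1 < B" "B > 0" "B1 > 0" using B hc_pos(1) by (auto simp: B1_def simp del: hc_pos)
      obtain C where C: "bd d B1 C q" using coord.IH B1 by blast
      define \<gamma> where "\<gamma> = 1 / B1 - 1 / B"
      have g: "\<gamma> > 0" using B1 by (simp add: \<gamma>_def field_simps)
      show "\<exists>C. bd (d + 1) B C (\<lambda>p. fst p $ i * q p)"
        unfolding bd_def
      proof (intro exI[of _ "(1 + 1 / \<gamma>) * C"] conjI allI impI)
        fix x :: "real^'n" and t :: real assume t: "t > 0"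
        have e: "norm x / sqrt t \<le> (1 + 1 / \<gamma>) * exp (\<gamma> * ((x \<bullet> x) / t))"
          using self_le_exp_square[OF g, of "norm x / sqrt t"] t by (simp add: power_divide power2_norm_eq_inner)
        have "\<bar>x $ i\<bar> \<le> norm x" by (rule component_le_norm_cart)
        also have "\<dots> = sqrt t * (norm x / sqrt t)" using t by simp
        also have "\<dots> \<le> sqrt t * ((1 + 1 / \<gamma>) * exp (\<gamma> * ((x \<bullet> x) / t)))" using e t by (intro mult_left_mono) auto
        finally have "\<bar>x $ i * q (x, t)\<bar> \<le> (sqrt t * ((1 + 1 / \<gamma>) * exp (\<gamma> * ((x \<bullet> x) / t)))) *
           (C * t powr (d / 2) * exp (- (x \<bullet> x) / (B1 * t)))"
          unfolding abs_mult using bdD[OF C t, of x] by (intro mult_mono) auto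
        also have "\<dots> = (1 + 1 / \<gamma>) * C * (sqrt t * t powr (d / 2)) *
           (exp (\<gamma> * ((x \<bullet> x) / t)) * exp (- (x \<bullet> x) / (B1 * t)))" by (simp only: mult_ac)
        also have "exp (\<gamma> * ((x \<bullet> x) / t)) * exp (- (x \<bullet> x) / (B1 * t)) = exp (- (x \<bullet> x) / (B * t))"
          using t B1 by (simp add: mult_exp_exp \<gamma>_def left_diff_distrib diff_divide_distrib)
        also have "sqrt t * t powr (d / 2) = t powr ((d + 1) / 2)"
          using t by (simp add: powr_half_sqrt[symmetric] powr_add[symmetric] add_divide_distrib add.commute)
        finally show "\<bar>fst (x, t) $ i * q (x, t)\<bar> \<le> (1 + 1 / \<gamma>) * C * t powr ((d + 1) / 2) * exp (- (x \<bullet> x) / (B * t))"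
          by simp
      qed (use C g in \<open>auto simp: bd_def\<close>)
    qed
  next
    case (add d q q')
    show ?case
    proof (intro allI impI)
      fix B assume B: "B > hc"
      obtain C where C: "bd d B C q"
        using add.IH(1) B by blast
      obtain C' where C': "bd d B C' q'"
        using add.IH(2) B by blast
      show "\<exists>C. bd d B C (\<lambda>p. q p + q' p)"
        unfolding bd_def
      proof (intro exI[of _ "C + C'"] conjI allI impI)
        fix x :: "real^'n" and t :: real assume t: "t > 0"
        show "\<bar>q (x, t) + q' (x, t)\<bar> \<le> (C + C') * t powr (d / 2) * exp (- (x \<bullet> x) / (B * t))"
          using bdD[OF C t, of x] bdD[OF C' t, of x] unfolding distrib_right by linarith
      qed (use C C' in \<open>auto simp: bd_def\<close>)
    qed
  next
    case (cmult d q a)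
    show ?case
    proof (intro allI impI)
      fix B assume B: "B > hc"
      obtain C where C: "bd d B C q"
        using cmult.IH(1) B by blast
      show "\<exists>C. bd d B C (\<lambda>p. a * q p)"
        unfolding bd_def
      proof (intro exI[of _ "\<bar>a\<bar> * C"] conjI allI impI)
        fix x :: "real^'n" and t :: real assume t: "t > 0"
        show "\<bar>a * q (x, t)\<bar> \<le> \<bar>a\<bar> * C * t powr (d / 2) * exp (- (x \<bullet> x) / (B * t))"
          using mult_left_mono[OF bdD[OF C t, of x], of "\<bar>a\<bar>"] by (simp add: abs_mult mult.assoc)
      qed (use C in \<open>auto simp: bd_def\<close>)
    qed
  next
    case (cong d q q')
    then show ?case by (simp add: bd_def)
  qed
  then show ?thesis using assms(2) that unfolding bd_def by blast
qed

section \<open>Convolution of functions of quadratic growth with kernels of heat type\<close>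

definition conv :: "(real^'n \<Rightarrow> real) \<Rightarrow> ((real^'n) \<times> real \<Rightarrow> real) \<Rightarrow> (real^'n) \<times> real \<Rightarrow> real" where
  "conv f q p = (\<integral>z. f z * q (fst p - z, snd p) \<partial>lborel)"

definition quad_growth :: "(real^'n \<Rightarrow> real) \<Rightarrow> bool" where
  "quad_growth f \<longleftrightarrow> continuous_on UNIV f \<and> (\<forall>x. \<exists>C\<ge>0. \<forall>z. \<bar>f z\<bar> \<le> C * (1 + (z - x) \<bullet> (z - x)))"

lemma quad_between_quad_growth: "quad_between a b f \<Longrightarrow> quad_growth f"
  unfolding quad_growth_def power2_norm_eq_inner[symmetric]
  using quad_between_continuous quad_between_growth by metis

lemma quad_between_affine: "quad_between 0 0 (\<lambda>z. \<alpha> + \<beta> \<bullet> z)"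
  unfolding quad_between_def quad_at_def by (intro allI exI[of _ \<beta>]) (simp add: inner_diff_right)

lemmas quad_growth_affine = quad_between_quad_growth[OF quad_between_affine]

lemma heat_type_continuous:
  fixes q :: "(real^'n) \<times> real \<Rightarrow> real"
  assumes "heat_type d q" "t > 0"
  shows "continuous_on UNIV (\<lambda>x. q (x, t))"
proof -
  have "(\<lambda>x. q (x, t)) differentiable (at x)" for x
    using heat_type_differentiable[OF assms(1), of "(x, t)"] assms(2) has_derivative_slice
    unfolding differentiable_def by (metis snd_conv)
  then show ?thesis
    by (intro differentiable_imp_continuous_on differentiable_at_imp_differentiable_on) auto
qed

lemma measurable_conv_integrand:
  fixes q :: "(real^'n) \<times> real \<Rightarrow> real"
  assumes "heat_type d q" "t > 0" "quad_growth f"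
  shows "(\<lambda>z. f z * q (y - z, t)) \<in> borel_measurable borel"
  using assms(3) heat_type_continuous[OF assms(1,2)]
  by (intro borel_measurable_continuous_onI continuous_intros)
    (auto simp: quad_growth_def intro!: continuous_intros continuous_on_compose2[of UNIV "\<lambda>x. q (x, t)" UNIV "\<lambda>z. y - z"])

text \<open>One Gaussian centred at \<open>fst p0\<close> dominates the kernel for all parameters
  near \<open>p0\<close>, which supplies the majorant for differentiating under the
  integral.\<close>

lemma heat_type_local_bound:
  fixes q :: "(real^'n) \<times> real \<Rightarrow> real"
  assumes q: "heat_type d q" and t0: "snd p0 > 0"
  obtains A where "A \<ge> 0"
    "\<And>p z. p \<in> ball p0 (min 1 (snd p0 / 2)) \<Longrightarrow>
       \<bar>q (fst p - z, snd p)\<bar> \<le> A * exp (- ((z - fst p0) \<bullet> (z - fst p0)) / (6 * hc * snd p0))"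
proof -
  obtain C where C: "C \<ge> 0" "\<And>x t. t > 0 \<Longrightarrow> \<bar>q (x, t)\<bar> \<le> C * t powr (d / 2) * exp (- (x \<bullet> x) / (2 * hc * t))"
    using heat_type_bound[OF q, of "2 * hc"] hc_pos(1) by auto
  define T where "T = snd p0"
  have T: "T > 0" using t0 by (simp add: T_def)
  \<comment> \<open>A power of \<open>t\<close> is monotone in one direction or the other according
    to the sign of \<open>d\<close>; the sum of the values at both ends of the time interval covers
    both cases.\<close>
  define m where "m = (T / 2) powr (d / 2) + (3 * T / 2) powr (d / 2)"
  define e where "e = exp (1 / (3 * hc * T))"
  have "\<bar>q (fst p - z, snd p)\<bar> \<le> (C * m * e) * exp (- ((z - fst p0) \<bullet> (z - fst p0)) / (6 * hc * T))"
    if p: "p \<in> ball p0 (min 1 (snd p0 / 2))" for p z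
  proof -
    define t where "t = snd p"
    have "dist (fst p) (fst p0) \<le> dist p p0" "dist (snd p) (snd p0) \<le> dist p p0"
      by (rule dist_fst_le dist_snd_le)+
    moreover have "dist p p0 < 1" "dist p p0 < T / 2" using p by (simp_all add: dist_commute T_def)
    ultimately have y: "norm (fst p - fst p0) \<le> 1" and "\<bar>t - T\<bar> < T / 2"
      unfolding T_def t_def by (simp_all only: dist_norm real_norm_def)
    then have t: "T / 2 \<le> t" "t \<le> 3 * T / 2" "t > 0" using T by (auto simp: abs_if split: if_splits)
    have tm: "t powr (d / 2) \<le> m"
    proof (cases "d \<ge> 0")
      case True
      then have "t powr (d / 2) \<le> (3 * T / 2) powr (d / 2)" using t by (intro powr_mono2) auto
      then show ?thesis by (simp add: m_def add_increasing)
    next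
      case False
      then have "t powr (d / 2) \<le> (T / 2) powr (d / 2)" using t T by (intro powr_mono2') auto
      then show ?thesis by (simp add: m_def add_increasing2)
    qed
    define w where "w = fst p - z"
    define v where "v = z - fst p0"
    define k where "k = fst p - fst p0"
    have w: "w = k - v" by (simp add: w_def v_def k_def)
    have "k \<bullet> k \<le> 1" using y by (simp add: k_def power2_norm_eq_inner[symmetric] power_le_one)
    \<comment> \<open>This square yields \<open>|v|^2 / 2 - |k|^2 \<le> |k - v|^2\<close>: moving
      the centre by at most 1 halves the decay and costs a constant factor.\<close>
    moreover have "0 \<le> (2 *\<^sub>R k - v) \<bullet> (2 *\<^sub>R k - v)" by simp
    then have "0 \<le> 4 * (k \<bullet> k) - 4 * (k \<bullet> v) + v \<bullet> v" by (simp add: inner_diff_left inner_diff_right inner_commute)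
    ultimately have ww: "v \<bullet> v / 2 - 1 \<le> w \<bullet> w"
      by (simp add: w inner_diff_left inner_diff_right inner_commute)
    have "(v \<bullet> v) / (6 * hc * T) - 1 / (3 * hc * T) = (v \<bullet> v / 2 - 1) / (3 * hc * T)"
      using T by (simp add: field_simps)
    also have "\<dots> \<le> (w \<bullet> w) / (3 * hc * T)" using ww T by (intro divide_right_mono) auto
    also have "\<dots> \<le> (w \<bullet> w) / (2 * hc * t)"
      using t T hc_pos by (intro divide_left_mono mult_pos_pos) auto
    finally have "exp (- (w \<bullet> w) / (2 * hc * t)) \<le> exp (1 / (3 * hc * T) + - (v \<bullet> v) / (6 * hc * T))" by simp
    also have "\<dots> = e * exp (- (v \<bullet> v) / (6 * hc * T))" unfolding e_def by (rule exp_add)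
    finally have ee: "exp (- (w \<bullet> w) / (2 * hc * t)) \<le> e * exp (- (v \<bullet> v) / (6 * hc * T))" .
    have "\<bar>q (w, t)\<bar> \<le> C * t powr (d / 2) * exp (- (w \<bullet> w) / (2 * hc * t))" by (rule C(2)[OF t(3)])
    also have "\<dots> \<le> C * m * (e * exp (- (v \<bullet> v) / (6 * hc * T)))"
      using C tm ee by (intro mult_mono) (auto simp: m_def)
    finally show ?thesis by (simp add: w_def v_def t_def mult.assoc)
  qed
  moreover have "C * m * e \<ge> 0" using C by (simp add: m_def e_def)
  ultimately show ?thesis using that unfolding T_def by blast
qed

lemma vec_nth_le_norm_prod: "\<bar>fst h $ i\<bar> \<le> norm (h :: (real^'n) \<times> real)"
  using component_le_norm_cart[of "fst h" i] norm_fst_le[where x = "fst h" and y = "snd h"] by simp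

lemma heat_type_has_derivative:
  fixes q :: "(real^'n) \<times> real \<Rightarrow> real"
  assumes "heat_type d q" "snd p > 0"
  shows "(q has_derivative (\<lambda>h. (\<Sum>i\<in>UNIV. fst h $ i * ddx i q p) +
    snd h * ddt q p)) (at p)"
proof -
  have d: "(q has_derivative frechet_derivative q (at p)) (at p)"
    using heat_type_differentiable[OF assms] frechet_derivative_works by blast
  then interpret bounded_linear "frechet_derivative q (at p)" by (rule has_derivative_bounded_linear)
  have "frechet_derivative q (at p) h = (\<Sum>i\<in>UNIV. fst h $ i * ddx i q p) +
    snd h * ddt q p" for h
  proof -
    have "h = (\<Sum>i\<in>UNIV. fst h $ i *\<^sub>R (axis i 1, 0)) + snd h *\<^sub>R (0, 1)"
      by (rule prod_eqI) (simp_all add: fst_sum snd_sum vec_eq_iff axis_def if_distrib cong: if_cong)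
    then have "frechet_derivative q (at p) h =
        frechet_derivative q (at p) ((\<Sum>i\<in>UNIV. fst h $ i *\<^sub>R (axis i 1, 0)) + snd h *\<^sub>R (0, 1))" by simp
    then show ?thesis by (simp only: add sum scaleR partial_deriv_def) simp
  qed
  then have "frechet_derivative q (at p) = (\<lambda>h. (\<Sum>i\<in>UNIV. fst h $ i * ddx i q p) +
    snd h * ddt q p)" by blast
  then show ?thesis using d by simp
qed

lemma conv_dominated:
  fixes q :: "(real^'n) \<times> real \<Rightarrow> real"
  assumes f: "quad_growth f" and q: "heat_type d q" and t0: "snd p0 > 0"
  obtains w where "integrable lborel w" "\<And>z. w z \<ge> 0"
    "\<And>p z. p \<in> ball p0 (min 1 (snd p0 / 2)) \<Longrightarrow> \<bar>f z * q (fst p - z, snd p)\<bar> \<le> w z"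
proof -
  obtain C where C: "C \<ge> 0" "\<And>z. \<bar>f z\<bar> \<le> C * (1 + (z - fst p0) \<bullet> (z - fst p0))"
    using f unfolding quad_growth_def by metis
  obtain A where A: "A \<ge> 0" "\<And>p z. p \<in> ball p0 (min 1 (snd p0 / 2)) \<Longrightarrow>
       \<bar>q (fst p - z, snd p)\<bar> \<le> A * exp (- ((z - fst p0) \<bullet> (z - fst p0)) / (6 * hc * snd p0))"
    by (rule heat_type_local_bound[OF q t0]) blast
  define w where "w z = (C * A) * ((1 + (z - fst p0) \<bullet> (z - fst p0)) * exp (- ((z - fst p0) \<bullet> (z - fst p0)) / (6 * hc * snd p0)))" for z
  show ?thesis
  proof (rule that[of w])
    show "integrable lborel w"
      unfolding w_def using t0 by (intro integrable_mult_right integrable_square_gaussian) simp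
    show "w z \<ge> 0" for z using C A by (simp add: w_def)
    fix p z assume p: "p \<in> ball p0 (min 1 (snd p0 / 2))"
    have "\<bar>f z * q (fst p - z, snd p)\<bar> \<le> (C * (1 + (z - fst p0) \<bullet> (z - fst p0))) * (A * exp (- ((z - fst p0) \<bullet> (z - fst p0)) / (6 * hc * snd p0)))"
      unfolding abs_mult by (intro mult_mono C(2) A(2)[OF p]) (use C(1) in auto)
    then show "\<bar>f z * q (fst p - z, snd p)\<bar> \<le> w z" by (simp add: w_def mult_ac)
  qed
qed

lemma conv_integrable:
  fixes q :: "(real^'n) \<times> real \<Rightarrow> real"
  assumes f: "quad_growth f" and q: "heat_type d q" and t: "t > 0"
  shows "integrable lborel (\<lambda>z. f z * q (y - z, t))"
proof -
  obtain w where w: "integrable lborel w" "\<And>p z. p \<in> ball (y, t) (min 1 (snd (y, t) / 2)) \<Longrightarrow> \<bar>f z * q (fst p - z, snd p)\<bar> \<le> w z"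
    by (rule conv_dominated[OF f q, of "(y, t)"]) (use t in simp, blast)
  have "\<bar>f z * q (y - z, t)\<bar> \<le> w z" for z using w(2)[of "(y, t)" z] t by simp
  then show ?thesis
    by (intro Bochner_Integration.integrable_bound[OF w(1)]) (use measurable_conv_integrand[OF q t f] in \<open>auto intro: order_trans[OF _ abs_ge_self]\<close>)
qed

lemma conv_has_derivative:
  fixes q :: "(real^'n) \<times> real \<Rightarrow> real"
  assumes f: "quad_growth f" and q: "heat_type d q" and t0: "snd p0 > 0"
  shows "(conv f q has_derivative (\<lambda>h. (\<Sum>i\<in>UNIV. fst h $ i * conv f (ddx i q) p0) +
    snd h * conv f (ddt q) p0)) (at p0)"
proof -
  define r where "r = min 1 (snd p0 / 2)"
  have r: "r > 0" using t0 by (simp add: r_def)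
  have pos: "snd p > 0" if "p \<in> ball p0 r" for p
  proof -
    have "dist (snd p0) (snd p) \<le> dist p0 p" by (rule dist_snd_le)
    then show ?thesis using that t0 by (auto simp: r_def dist_real_def)
  qed
  note qi = heat_type_space_deriv[OF q] and qt = heat_type_time_deriv[OF q]
  have dom: "\<exists>w. integrable lborel w \<and> (\<forall>z. w z \<ge> 0) \<and>
     (\<forall>p z. p \<in> ball p0 r \<longrightarrow> \<bar>f z * q' (fst p - z, snd p)\<bar> \<le> w z)" if q': "heat_type d' q'" for d' q'
    unfolding r_def by (rule conv_dominated[OF f q' t0]) blast
  have "\<forall>i. \<exists>w. integrable lborel w \<and> (\<forall>z. w z \<ge> 0) \<and>
     (\<forall>p z. p \<in> ball p0 r \<longrightarrow> \<bar>f z * ddx i q (fst p - z, snd p)\<bar> \<le> w z)"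
    using dom[OF qi] by blast
  then obtain W where W: "\<And>i. integrable lborel (W i)" "\<And>i z. W i z \<ge> 0"
    "\<And>i p z. p \<in> ball p0 r \<Longrightarrow> \<bar>f z * ddx i q (fst p - z, snd p)\<bar> \<le> W i z" by metis
  obtain V where V: "integrable lborel V" "\<And>z. V z \<ge> 0"
    "\<And>p z. p \<in> ball p0 r \<Longrightarrow> \<bar>f z * ddt q (fst p - z, snd p)\<bar> \<le> V z"
    using dom[OF qt] by blast
  define D where "D p z h = f z * ((\<Sum>i\<in>UNIV. fst h $ i * ddx i q (fst p - z, snd p)) +
    snd h * ddt q (fst p - z, snd p))" for p z h
  have D: "D p z h = (\<Sum>i\<in>UNIV. fst h $ i * (f z * ddx i q (fst p - z, snd p))) +
     snd h * (f z * ddt q (fst p - z, snd p))" for p z h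
    by (simp add: D_def distrib_left sum_distrib_left mult_ac)
  have "((\<lambda>p. \<integral>z. f z * q (fst p - z, snd p) \<partial>lborel) has_derivative (\<lambda>h. \<integral>z. D p0 z h \<partial>lborel)) (at p0)"
  proof (rule has_derivative_integral_dominated[OF r, where w = "\<lambda>z. (\<Sum>i\<in>UNIV. W i z) + V z"])
    show "integrable lborel (\<lambda>z. f z * q (fst p - z, snd p))" if "p \<in> ball p0 r" for p
      by (rule conv_integrable[OF f q pos[OF that]])
    show "((\<lambda>p. f z * q (fst p - z, snd p)) has_derivative D p z) (at p)" if "p \<in> ball p0 r" for p z
    proof -
      have 1: "((\<lambda>p. (fst p - z, snd p)) has_derivative (\<lambda>h. (fst h, snd h))) (at p)"
        by (auto intro!: derivative_eq_intros)
      have "(q has_derivative (\<lambda>h. (\<Sum>i\<in>UNIV. fst h $ i * ddx i q (fst p - z, snd p)) +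
        snd h * ddt q (fst p - z, snd p))) (at (fst p - z, snd p))"
        using pos[OF that] by (intro heat_type_has_derivative[OF q]) simp
      from has_derivative_mult_right[OF has_derivative_compose[OF 1 this], of "f z"] show ?thesis
        by (simp add: D_def[abs_def])
    qed
    show "\<bar>D p z h\<bar> \<le> ((\<Sum>i\<in>UNIV. W i z) + V z) * norm h" if p: "p \<in> ball p0 r" for p z h
    proof -
      have "\<bar>\<Sum>i\<in>UNIV. fst h $ i * (f z * ddx i q (fst p - z, snd p))\<bar> \<le> (\<Sum>i\<in>UNIV. norm h * W i z)"
        by (intro order_trans[OF sum_abs] sum_mono, subst abs_mult, intro mult_mono W(3)[OF p] vec_nth_le_norm_prod) auto
      moreover have "\<bar>snd h * (f z * ddt q (fst p - z, snd p))\<bar> \<le> norm h * V z"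
        using norm_snd_le[where x = "fst h" and y = "snd h"]
        by (subst abs_mult, intro mult_mono V(3)[OF p]) simp_all
      moreover have "(\<Sum>i\<in>UNIV. norm h * W i z) + norm h * V z = ((\<Sum>i\<in>UNIV. W i z) + V z) * norm h"
        by (simp add: sum_distrib_left[symmetric] algebra_simps)
      ultimately show ?thesis unfolding D by linarith
    qed
    show "integrable lborel (\<lambda>z. D p0 z h)" for h
      unfolding D using conv_integrable[OF f qi t0] conv_integrable[OF f qt t0] by auto
  qed (use W V in auto)
  moreover have "(\<integral>z. D p0 z h \<partial>lborel) = (\<Sum>i\<in>UNIV. fst h $ i * conv f (ddx i q) p0) +
    snd h * conv f (ddt q) p0" for h
    unfolding D conv_def using conv_integrable[OF f qi t0] conv_integrable[OF f qt t0] by simp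
  ultimately show ?thesis by (simp add: conv_def[abs_def])
qed

section \<open>The heat flow\<close>

lemma conv_reflect:
  fixes q :: "(real^'n) \<times> real \<Rightarrow> real"
  assumes f: "quad_growth f" and q: "heat_type d q" and t: "t > 0"
  shows "conv f q (y, t) = (\<integral>x. f (y - x) * q (x, t) \<partial>lborel)"
    and "integrable lborel (\<lambda>x. f (y - x) * q (x, t))"
proof -
  note m = measurable_conv_integrand[OF q t f, of y]
  show "conv f q (y, t) = (\<integral>x. f (y - x) * q (x, t) \<partial>lborel)"
    unfolding conv_def using lborel_integral_affine[OF m, of "-1" y] by simp
  show "integrable lborel (\<lambda>x. f (y - x) * q (x, t))"
    using lborel_integrable_affine[OF m, of "-1" y] conv_integrable[OF f q t, of y] by simp
qed

lemma conv_diff: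
  fixes q :: "(real^'n) \<times> real \<Rightarrow> real"
  assumes "quad_growth f" "quad_growth g" "heat_type d q" "snd p > 0"
  shows "conv (\<lambda>z. f z - g z) q p = conv f q p - conv g q p"
  using conv_integrable[OF assms(1,3,4)] conv_integrable[OF assms(2,3,4)]
  by (simp add: conv_def left_diff_distrib)

lemma conv_cong:
  "(\<And>x. q (x, snd p) = q' (x, snd p)) \<Longrightarrow> conv f q p = conv f q' p"
  by (simp add: conv_def)

lemma conv_sum:
  fixes q :: "'i \<Rightarrow> (real^'n) \<times> real \<Rightarrow> real"
  assumes "quad_growth f" "\<And>i. i \<in> I \<Longrightarrow> heat_type d (q i)" "snd p > 0"
  shows "conv f (\<lambda>p. c * (\<Sum>i\<in>I. q i p)) p = c * (\<Sum>i\<in>I. conv f (q i) p)"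
proof -
  have *: "f z * (c * (\<Sum>i\<in>I. g i)) = c * (\<Sum>i\<in>I. f z * g i)" for z g
    by (simp only: mult.left_commute[of "f z" c] sum_distrib_left[of "f z"])
  show ?thesis
    unfolding conv_def * using conv_integrable[OF assms(1) assms(2) assms(3), of _ "fst p"] by simp
qed

lemma quad_growth_diff:
  assumes "quad_growth f" "quad_growth g"
  shows "quad_growth (\<lambda>z. f z - g z)"
  unfolding quad_growth_def
proof (intro conjI allI)
  show "continuous_on UNIV (\<lambda>z. f z - g z)"
    using assms by (auto simp: quad_growth_def intro!: continuous_intros)
  fix x
  obtain C D where C: "C \<ge> 0" "\<And>z. \<bar>f z\<bar> \<le> C * (1 + (z - x) \<bullet> (z - x))"
    and D: "D \<ge> 0" "\<And>z. \<bar>g z\<bar> \<le> D * (1 + (z - x) \<bullet> (z - x))"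
    using assms unfolding quad_growth_def by metis
  have "\<bar>f z - g z\<bar> \<le> (C + D) * (1 + (z - x) \<bullet> (z - x))" for z
    using C(2)[of z] D(2)[of z] unfolding distrib_right[of C D] by linarith
  then show "\<exists>C\<ge>0. \<forall>z. \<bar>f z - g z\<bar> \<le> C * (1 + (z - x) \<bullet> (z - x))"
    using C D by (intro exI[of _ "C + D"]) auto
qed

lemma gaussian_integral_scale:
  assumes "t > 0"
  shows "(\<integral>x. exp (- (x \<bullet> x) / (B * t)) \<partial>(lborel :: (real^'n) measure)) =
    t powr (real CARD('n) / 2) * (\<integral>x. exp (- (x \<bullet> x) / B) \<partial>(lborel :: (real^'n) measure))"
proof -
  have "(\<integral>x. exp (- (x \<bullet> x) / (B * t)) \<partial>(lborel :: (real^'n) measure)) =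
     \<bar>sqrt t\<bar> ^ DIM(real^'n) * (\<integral>x. exp (- ((0 + sqrt t *\<^sub>R x) \<bullet> (0 + sqrt t *\<^sub>R x)) / (B * t)) \<partial>(lborel :: (real^'n) measure))"
    using assms by (intro lborel_integral_affine) auto
  also have "(\<lambda>x::real^'n. exp (- ((0 + sqrt t *\<^sub>R x) \<bullet> (0 + sqrt t *\<^sub>R x)) / (B * t))) = (\<lambda>x. exp (- (x \<bullet> x) / B))"
    using assms by (auto simp: fun_eq_iff mult.assoc[symmetric])
  also have "\<bar>sqrt t\<bar> ^ DIM(real^'n) = t powr (real CARD('n) / 2)"
    using assms by (simp add: powr_half_sqrt[symmetric] powr_power)
  finally show ?thesis .
qed

text \<open>The integral of the unnormalised kernel at time 1, that is (pi hc)^(n/2).\<close>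

definition gauss_mass :: "'n::finite itself \<Rightarrow> real" where
  "gauss_mass _ = (\<integral>x. exp (- (x \<bullet> x) / hc) \<partial>(lborel :: (real^'n) measure))"

lemma gauss_mass_pos: "gauss_mass TYPE('n::finite) > 0"
proof -
  let ?f = "\<lambda>x::real^'n. exp (- (x \<bullet> x) / hc)"
  have i: "integrable lborel ?f" by (rule integrable_gaussian) simp
  have "integral\<^sup>L lborel ?f \<noteq> 0"
  proof
    assume "integral\<^sup>L lborel ?f = 0"
    then have "AE x in lborel. ?f x = 0" using integral_nonneg_eq_0_iff_AE[OF i] by simp
    then have "AE x in (lborel :: (real^'n) measure). False" by simp
    then have "emeasure (lborel :: (real^'n) measure) UNIV = 0"
      using AE_iff_measurable[of UNIV "lborel :: (real^'n) measure" "\<lambda>_. False"] by simp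
    then show False by simp
  qed
  moreover have "integral\<^sup>L lborel ?f \<ge> 0" by simp
  ultimately show ?thesis unfolding gauss_mass_def by linarith
qed

definition heat_kernel :: "(real^'n) \<times> real \<Rightarrow> real" where
  "heat_kernel p = (1 / gauss_mass TYPE('n)) * gauss (- real CARD('n) / 2) p"

lemma heat_type_heat_kernel: "heat_type (- real CARD('n)) (heat_kernel :: (real^'n) \<times> real \<Rightarrow> real)"
  unfolding heat_kernel_def[abs_def] using heat_type.gauss[of "- real CARD('n) / 2"]
  by (intro heat_type.cmult) simp

lemma heat_kernel_pos: "t > 0 \<Longrightarrow> heat_kernel (x :: real^'n, t) > 0"
  using gauss_mass_pos[where 'n = 'n] by (simp add: heat_kernel_def gauss_def)

lemma heat_kernel_even: "heat_kernel (- x, t) = heat_kernel (x, t)"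
  by (simp add: heat_kernel_def gauss_def)

lemma heat_kernel_mass:
  assumes "t > 0"
  shows "(\<integral>x. heat_kernel (x::real^'n, t) \<partial>lborel) = 1"
proof -
  have "(\<integral>x. heat_kernel (x::real^'n, t) \<partial>lborel) =
     1 / gauss_mass TYPE('n) * (t powr (- real CARD('n) / 2) * (\<integral>x. exp (- (x \<bullet> x) / (hc * t)) \<partial>(lborel :: (real^'n) measure)))"
    by (simp add: heat_kernel_def gauss_def)
  also have "\<dots> = 1 / gauss_mass TYPE('n) * (t powr (- real CARD('n) / 2) * t powr (real CARD('n) / 2) * gauss_mass TYPE('n))"
    by (simp only: gaussian_integral_scale[OF assms] gauss_mass_def mult.assoc)
  also have "t powr (- real CARD('n) / 2) * t powr (real CARD('n) / 2) = 1"
    using assms by (simp add: powr_add[symmetric])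
  finally show ?thesis using gauss_mass_pos[where 'n = 'n] by simp
qed

text \<open>The kernel has mass one and is even in space, so constants are reproduced and the linear
  moment vanishes.\<close>

lemma conv_affine_heat_kernel:
  assumes t: "snd p > 0"
  shows "conv (\<lambda>z. \<alpha> + \<beta> \<bullet> z) heat_kernel p = \<alpha> + \<beta> \<bullet> (fst p :: real^'n)"
proof -
  obtain y t where p: "p = (y, t)" by (cases p)
  have t: "t > 0" using assms p by simp
  let ?K = "\<lambda>x::real^'n. heat_kernel (x, t)"
  have i1: "integrable lborel ?K"
    using conv_reflect(2)[OF quad_growth_affine[of 1 0] heat_type_heat_kernel t, of y] by simp
  have i2: "integrable lborel (\<lambda>x. (0 + \<beta> \<bullet> (0 - x)) * ?K x)"
    by (rule conv_reflect(2)[OF quad_growth_affine[of 0 \<beta>] heat_type_heat_kernel t, of 0])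
  then have i2: "integrable lborel (\<lambda>x. (\<beta> \<bullet> x) * ?K x)" by simp
  \<comment> \<open>Reflection at the origin.\<close>
  have "(\<integral>x. (\<beta> \<bullet> x) * ?K x \<partial>lborel) = - (\<integral>x. (\<beta> \<bullet> x) * ?K x \<partial>lborel)"
    using lborel_integral_affine[of "\<lambda>x. (\<beta> \<bullet> x) * ?K x" "-1" 0] i2
    by (simp add: heat_kernel_even)
  then have z: "(\<integral>x. (\<beta> \<bullet> x) * ?K x \<partial>lborel) = 0" by simp
  have "conv (\<lambda>z. \<alpha> + \<beta> \<bullet> z) heat_kernel (y, t) = (\<integral>x. (\<alpha> + \<beta> \<bullet> y) * ?K x - (\<beta> \<bullet> x) * ?K x \<partial>lborel)"
    by (simp add: conv_reflect(1)[OF quad_growth_affine heat_type_heat_kernel t] inner_diff_right algebra_simps)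
  also have "\<dots> = \<alpha> + \<beta> \<bullet> y"
    using i1 i2 z heat_kernel_mass[OF t, where 'n = 'n] by simp
  finally show ?thesis by (simp add: p)
qed

text \<open>The exponent is a count of scales: \<open>d / 2\<close> from the kernel, 1 from the
  quadratic factor, which is of size \<open>t\<close> where the Gaussian lives, and half the
  dimension from the integration.\<close>

lemma conv_quad_bound:
  fixes q :: "(real^'n) \<times> real \<Rightarrow> real"
  assumes q: "heat_type d q"
  obtains C where "C \<ge> 0" "\<And>h m y t. quad_growth h \<Longrightarrow> t > 0 \<Longrightarrow> m \<ge> 0 \<Longrightarrow> (\<And>z. \<bar>h z\<bar> \<le> m * ((z - y) \<bullet> (z - y))) \<Longrightarrow>
    \<bar>conv h q (y, t)\<bar> \<le> m * C * t powr (d / 2 + 1 + real CARD('n) / 2)"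
proof -
  obtain C where C: "C \<ge> 0" "\<And>x t. t > 0 \<Longrightarrow> \<bar>q (x, t)\<bar> \<le> C * t powr (d / 2) * exp (- (x \<bullet> x) / (2 * hc * t))"
    using heat_type_bound[OF q, of "2 * hc"] hc_pos(1) by auto
  define Z where "Z = (\<integral>x. exp (- (x \<bullet> x) / (4 * hc)) \<partial>(lborel :: (real^'n) measure))"
  have Z: "Z \<ge> 0" by (simp add: Z_def)
  define c where "c = 1 + 4 * hc"
  have c: "c \<ge> 0" by (simp add: c_def)
  have "\<bar>conv h q (y, t)\<bar> \<le> m * (C * c * Z) * t powr (d / 2 + 1 + real CARD('n) / 2)"
    if h: "quad_growth h" "t > 0" "m \<ge> 0" "\<And>z. \<bar>h z\<bar> \<le> m * ((z - y) \<bullet> (z - y))" for h m y t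
  proof -
    have "\<bar>conv h q (y, t)\<bar> = norm (\<integral>x. h (y - x) * q (x, t) \<partial>lborel)"
      by (simp add: conv_reflect(1)[OF h(1) q h(2)])
    also have "\<dots> \<le> (\<integral>x. m * C * c * (t * t powr (d / 2)) * exp (- (x \<bullet> x) / (4 * hc * t)) \<partial>(lborel :: (real^'n) measure))"
    proof (rule Bochner_Integration.integral_norm_bound_integral)
      show "integrable lborel (\<lambda>x. h (y - x) * q (x, t))" by (rule conv_reflect(2)[OF h(1) q h(2)])
      show "integrable lborel (\<lambda>x::real^'n. m * C * c * (t * t powr (d / 2)) * exp (- (x \<bullet> x) / (4 * hc * t)))"
        using integrable_gaussian[of "4 * hc * t"] h(2) by (intro integrable_mult_right) simp
      fix x :: "real^'n"
      have "(norm x / sqrt t)^2 = (x \<bullet> x) / t" using h(2) by (simp add: power_divide power2_norm_eq_inner)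
      then have "(x \<bullet> x) / t \<le> c * exp (1 / (4 * hc) * ((x \<bullet> x) / t))"
        using one_plus_square_le_exp[of "1 / (4 * hc)" "norm x / sqrt t"] by (simp add: c_def)
      then have xx: "x \<bullet> x \<le> t * (c * exp ((x \<bullet> x) / (4 * hc * t)))"
        using h(2) by (simp add: field_simps)
      have "norm (h (y - x) * q (x, t)) \<le> (m * (x \<bullet> x)) * (C * t powr (d / 2) * exp (- (x \<bullet> x) / (2 * hc * t)))"
        unfolding real_norm_def abs_mult using h(4)[of "y - x"] C(2)[OF h(2), of x] h(3)
        by (intro mult_mono) auto
      also have "\<dots> \<le> (m * (t * (c * exp ((x \<bullet> x) / (4 * hc * t))))) * (C * t powr (d / 2) * exp (- (x \<bullet> x) / (2 * hc * t)))"
        using xx h(3) C(1) by (intro mult_right_mono mult_left_mono) auto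
      also have "\<dots> = m * C * c * (t * t powr (d / 2)) * (exp ((x \<bullet> x) / (4 * hc * t)) * exp (- (x \<bullet> x) / (2 * hc * t)))"
        by (simp only: mult_ac)
      also have "exp ((x \<bullet> x) / (4 * hc * t)) * exp (- (x \<bullet> x) / (2 * hc * t)) = exp (- (x \<bullet> x) / (4 * hc * t))"
        using h(2) by (simp add: mult_exp_exp field_simps)
      finally show "norm (h (y - x) * q (x, t)) \<le> m * C * c * (t * t powr (d / 2)) * exp (- (x \<bullet> x) / (4 * hc * t))" .
    qed
    also have "\<dots> = m * C * c * (t * t powr (d / 2)) * (t powr (real CARD('n) / 2) * Z)"
      unfolding Z_def by (subst gaussian_integral_scale[OF h(2), symmetric]) simp
    also have "\<dots> = m * (C * c * Z) * (t powr 1 * t powr (d / 2) * t powr (real CARD('n) / 2))"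
      using h(2) by (simp add: mult_ac)
    also have "t powr 1 * t powr (d / 2) * t powr (real CARD('n) / 2) = t powr (d / 2 + 1 + real CARD('n) / 2)"
      by (simp only: powr_add[symmetric] add_ac)
    finally show ?thesis .
  qed
  moreover have "C * c * Z \<ge> 0" using C c Z by simp
  ultimately show ?thesis using that by blast
qed

lemma quad_at_affine_error:
  assumes "quad_at a b f y p" "0 \<le> a"
  shows "\<bar>f z - ((f y - p \<bullet> y) + p \<bullet> z)\<bar> \<le> b / 2 * ((z - y) \<bullet> (z - y))"
proof -
  have "0 \<le> a / 2 * ((z - y) \<bullet> (z - y))" using assms(2) by simp
  then show ?thesis using assms(1)[unfolded quad_at_def, rule_format, of z] by (simp add: inner_diff_right)
qed

lemma quad_at_upper_nonneg:
  fixes f :: "real^'n \<Rightarrow> real"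
  assumes "quad_at a b f y p" "0 \<le> a"
  shows "0 \<le> b / 2"
  using order_trans[OF abs_ge_zero quad_at_affine_error[OF assms, of "y + axis undefined 1"]] by simp

text \<open>The affine function with the contact slope of \<open>f\<close> at \<open>y\<close> is
  reproduced by the kernel and equals \<open>f y\<close> at \<open>y\<close>, so only the quadratic
  error contributes. For the heat kernel the exponent of \<open>conv_quad_bound\<close> is exactly
  1, and the constant does not depend on \<open>f\<close>.\<close>

lemma heat_evolution_near_initial:
  assumes ab: "0 \<le> a"
  obtains C where "\<And>f y t. quad_between a b f \<Longrightarrow> t > 0 \<Longrightarrow> \<bar>conv f heat_kernel (y, t) - f (y::real^'n)\<bar> \<le> C * t"
proof -
  obtain C where C: "C \<ge> 0" "\<And>h m y t. quad_growth h \<Longrightarrow> t > 0 \<Longrightarrow> m \<ge> 0 \<Longrightarrow> (\<And>z::real^'n. \<bar>h z\<bar> \<le> m * ((z - y) \<bullet> (z - y))) \<Longrightarrow>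
    \<bar>conv h heat_kernel (y, t)\<bar> \<le> m * C * t powr (- real CARD('n) / 2 + 1 + real CARD('n) / 2)"
    by (rule conv_quad_bound[OF heat_type_heat_kernel]) blast
  have "\<bar>conv f heat_kernel (y, t) - f y\<bar> \<le> (b / 2 * C) * t" if f: "quad_between a b f" and t: "t > 0"
    for f t and y :: "real^'n"
  proof -
    obtain p where p: "quad_at a b f y p" using f by (auto simp: quad_between_def)
    note g = quad_between_quad_growth[OF f]
    let ?g = "\<lambda>z. (f y - p \<bullet> y) + p \<bullet> z"
    have "conv (\<lambda>z. f z - ?g z) heat_kernel (y, t) = conv f heat_kernel (y, t) - f y"
      using conv_diff[OF g quad_growth_affine heat_type_heat_kernel, of "(y, t)"]
        conv_affine_heat_kernel[of "(y, t)"] t by simp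
    moreover have "\<bar>conv (\<lambda>z. f z - ?g z) heat_kernel (y, t)\<bar> \<le> b / 2 * C * t powr (- real CARD('n) / 2 + 1 + real CARD('n) / 2)"
      using quad_at_affine_error[OF p ab] quad_at_upper_nonneg[OF p ab]
      by (intro C(2) quad_growth_diff g quad_growth_affine t) auto
    ultimately show ?thesis using t by simp
  qed
  then show ?thesis using that by blast
qed

text \<open>Second differences commute with convolution, and averaging against a positive kernel of
  mass one preserves two-sided bounds by constants.\<close>

lemma heat_evolution_second_difference:
  fixes f :: "real^'n \<Rightarrow> real"
  assumes f: "quad_between a b f" and t: "t > 0"
  shows "a * (h \<bullet> h) \<le> conv f heat_kernel (y + h, t) + conv f heat_kernel (y - h, t) - 2 * conv f heat_kernel (y, t)"
    and "conv f heat_kernel (y + h, t) + conv f heat_kernel (y - h, t) - 2 * conv f heat_kernel (y, t) \<le> b * (h \<bullet> h)"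
proof -
  let ?d = "conv f heat_kernel (y + h, t) + conv f heat_kernel (y - h, t) - 2 * conv f heat_kernel (y, t)"
  note g = quad_between_quad_growth[OF f]
  note r = conv_reflect[OF g heat_type_heat_kernel t]
  let ?K = "\<lambda>x::real^'n. heat_kernel (x, t)"
  let ?s = "\<lambda>x. (f (y + h - x) + f (y - h - x) - 2 * f (y - x)) * ?K x"
  have i1: "integrable lborel ?K"
    using conv_reflect(2)[OF quad_growth_affine[of 1 0] heat_type_heat_kernel t, of y] by simp
  have i: "integrable lborel ?s"
    using r(2)[of "y + h"] r(2)[of "y - h"] r(2)[of y]
    by (simp add: left_diff_distrib distrib_right mult.assoc)
  have e: "?d = integral\<^sup>L lborel ?s"
    using r(2)[of "y + h"] r(2)[of "y - h"] r(2)[of y]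
    by (simp add: r(1) left_diff_distrib distrib_right mult.assoc)
  have m: "(\<integral>x. c * ?K x \<partial>lborel) = c" for c using heat_kernel_mass[OF t, where 'n = 'n] by simp
  have s: "a * (h \<bullet> h) \<le> f (y + h - x) + f (y - h - x) - 2 * f (y - x)"
    "f (y + h - x) + f (y - h - x) - 2 * f (y - x) \<le> b * (h \<bullet> h)" for x
  proof -
    obtain p where p: "quad_at a b f (y - x) p" using f by (auto simp: quad_between_def)
    have e: "y - x + h = y + h - x" "y - x - h = y - h - x" by simp_all
    show "a * (h \<bullet> h) \<le> f (y + h - x) + f (y - h - x) - 2 * f (y - x)"
      "f (y + h - x) + f (y - h - x) - 2 * f (y - x) \<le> b * (h \<bullet> h)"
      using quad_at_second_difference[OF p, of h] unfolding e by simp_all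
  qed
  have "(\<integral>x. (a * (h \<bullet> h)) * ?K x \<partial>lborel) \<le> integral\<^sup>L lborel ?s"
    using i i1 s heat_kernel_pos[OF t] by (intro integral_mono mult_right_mono) (auto intro: less_imp_le)
  then show "a * (h \<bullet> h) \<le> ?d"
    by (simp only: m e)
  have "integral\<^sup>L lborel ?s \<le> (\<integral>x. (b * (h \<bullet> h)) * ?K x \<partial>lborel)"
    using i i1 s heat_kernel_pos[OF t] by (intro integral_mono mult_right_mono) (auto intro: less_imp_le)
  then show "?d \<le> b * (h \<bullet> h)"
    by (simp only: m e)
qed

lemma conv_partial_deriv:
  fixes q :: "(real^'n) \<times> real \<Rightarrow> real"
  assumes "quad_growth f" "heat_type d q" "snd p > 0"
  shows "ddx i (conv f q) p = conv f (ddx i q) p"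
    and "ddt (conv f q) p = conv f (ddt q) p"
  unfolding partial_deriv_eq[OF conv_has_derivative[OF assms]]
  by (simp_all add: axis_def if_distrib if_distribR cong: if_cong)

definition annihilates_affine :: "((real^'n) \<times> real \<Rightarrow> real) \<Rightarrow> bool" where
  "annihilates_affine q \<longleftrightarrow> (\<forall>\<alpha> \<beta> p. snd p > 0 \<longrightarrow> conv (\<lambda>z. \<alpha> + \<beta> \<bullet> z) q p = 0)"

lemma Basis_space_time: "(Basis :: ((real^'n) \<times> real) set) = insert (0, 1) (range (\<lambda>i. (axis i 1, 0)))"
  by (auto simp: Basis_prod_def Basis_vec_def)

lemma conv_partial_deriv_Basis:
  fixes q :: "(real^'n) \<times> real \<Rightarrow> real"
  assumes "quad_growth f" "heat_type d q" "snd p > 0" "b \<in> Basis"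
  shows "partial_deriv b (conv f q) p = conv f (partial_deriv b q) p"
  using assms(4) conv_partial_deriv[OF assms(1-3)] by (auto simp: Basis_space_time)

lemma partial_deriv_const_on_upper:
  fixes g :: "(real^'n) \<times> real \<Rightarrow> real"
  assumes "snd p > 0" "\<And>p. snd p > 0 \<Longrightarrow> g p = c"
  shows "partial_deriv b g p = 0"
proof -
  have "partial_deriv b g p = partial_deriv b (\<lambda>_. c) p"
    using assms by (intro partial_deriv_cong_open[OF open_upper]) auto
  also have "\<dots> = 0" by (rule partial_deriv_eq[OF has_derivative_const])
  finally show ?thesis .
qed

text \<open>It is enough that affine functions are sent to constants in space and time, since
  differentiation removes a constant. This covers first order kernels, which map an affine function
  to a slope, as well as kernels that annihilate already.\<close>

lemma annihilates_affine_deriv: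
  fixes q :: "(real^'n) \<times> real \<Rightarrow> real"
  assumes q: "heat_type d q" and c: "\<And>\<alpha> \<beta>. \<exists>c. \<forall>p. snd p > 0 \<longrightarrow> conv (\<lambda>z. \<alpha> + \<beta> \<bullet> z) q p = c"
    and b: "b \<in> Basis"
  shows "annihilates_affine (partial_deriv b q)"
  unfolding annihilates_affine_def
proof (intro allI impI)
  fix \<alpha> \<beta> and p :: "(real^'n) \<times> real" assume p: "snd p > 0"
  obtain k where k: "\<And>p. snd p > 0 \<Longrightarrow> conv (\<lambda>z. \<alpha> + \<beta> \<bullet> z) q p = k" using c by blast
  have "conv (\<lambda>z. \<alpha> + \<beta> \<bullet> z) (partial_deriv b q) p = partial_deriv b (conv (\<lambda>z. \<alpha> + \<beta> \<bullet> z) q) p"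
    by (rule conv_partial_deriv_Basis[OF quad_growth_affine q p b, symmetric])
  also have "\<dots> = 0" using partial_deriv_const_on_upper[OF p k] .
  finally show "conv (\<lambda>z. \<alpha> + \<beta> \<bullet> z) (partial_deriv b q) p = 0" .
qed

lemma heat_type_partial_deriv_Basis:
  assumes "heat_type d q" "b \<in> Basis"
  obtains d' where "d' \<le> d" "heat_type d' (partial_deriv b q)"
  using assms(2) heat_type_space_deriv[OF assms(1)] heat_type_time_deriv[OF assms(1)]
  by (auto simp: Basis_space_time intro: that[of "d - 1"] that[of "d - 2"])

text \<open>Subtracting the affine function with the contact slope at \<open>y\<close> changes
  nothing for an annihilating kernel and leaves a quadratic error. Differentiation keeps
  annihilation and only lowers the degree, so the same order zero bound serves every step of the
  induction.\<close>

lemma unif_Cb_conv: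
  fixes q :: "(real^'n) \<times> real \<Rightarrow> real"
  assumes "heat_type d q" "d \<le> - real CARD('n) - 2" "annihilates_affine q" and a: "0 \<le> a" and e: "\<epsilon> > 0"
  shows "unif_Cb k (UNIV \<times> {\<epsilon><..}) {f. quad_between a b f} (\<lambda>f. conv f q)"
  using assms(1-3)
proof (induction k arbitrary: d q)
  have bd: "\<exists>C. \<forall>f\<in>{f. quad_between a b f}. \<forall>p\<in>UNIV \<times> {\<epsilon><..}. \<bar>conv f q p\<bar> \<le> C"
    if q: "heat_type d q" and d: "d \<le> - real CARD('n) - 2" and ann: "annihilates_affine q"
    for d and q :: "(real^'n) \<times> real \<Rightarrow> real"
  proof -
    \<comment> \<open>The degree condition says exactly that \<open>r \<le> 0\<close>, so the power
      of \<open>t\<close> is largest at the earliest time \<epsilon>.\<close>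
    define r where "r = d / 2 + 1 + real CARD('n) / 2"
    have r: "r \<le> 0" using d by (simp add: r_def field_simps)
    obtain C where C: "C \<ge> 0" "\<And>h m y t. quad_growth h \<Longrightarrow> t > 0 \<Longrightarrow> m \<ge> 0 \<Longrightarrow> (\<And>z. \<bar>h z\<bar> \<le> m * ((z - y) \<bullet> (z - y))) \<Longrightarrow>
      \<bar>conv h q (y, t)\<bar> \<le> m * C * t powr r"
      unfolding r_def by (rule conv_quad_bound[OF q]) blast
    have "\<bar>conv f q p\<bar> \<le> b / 2 * C * \<epsilon> powr r" if f: "quad_between a b f" and p: "p \<in> UNIV \<times> {\<epsilon><..}" for f p
    proof -
      obtain y t where yt: "p = (y, t)" by (cases p)
      have t: "t > \<epsilon>" "t > 0" using p yt e by auto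
      obtain w where w: "quad_at a b f y w" using f by (auto simp: quad_between_def)
      note g = quad_between_quad_growth[OF f]
      let ?g = "\<lambda>z. (f y - w \<bullet> y) + w \<bullet> z"
      have "conv (\<lambda>z. f z - ?g z) q (y, t) = conv f q (y, t)"
        using conv_diff[OF g quad_growth_affine q, of "(y, t)"] ann t by (simp add: annihilates_affine_def)
      then have "\<bar>conv f q p\<bar> = \<bar>conv (\<lambda>z. f z - ?g z) q (y, t)\<bar>" by (simp add: yt)
      also have "\<dots> \<le> b / 2 * C * t powr r"
        using quad_at_affine_error[OF w a] quad_at_upper_nonneg[OF w a]
        by (intro C(2) quad_growth_diff g quad_growth_affine t) auto
      also have "\<dots> \<le> b / 2 * C * \<epsilon> powr r"
        using quad_at_upper_nonneg[OF w a] C(1) t e r by (intro mult_left_mono powr_mono2') auto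
      finally show ?thesis .
    qed
    then show ?thesis by blast
  qed
  {
    case 0
    then show ?case using bd by simp
  next
    case (Suc k)
    have S: "open (UNIV \<times> {\<epsilon><..} :: ((real^'n) \<times> real) set)" by (intro open_Times) auto
    have "unif_Cb k (UNIV \<times> {\<epsilon><..}) {f. quad_between a b f} (\<lambda>f. partial_deriv b' (conv f q))"
      if b': "b' \<in> Basis" for b'
    proof -
      obtain d' where d': "d' \<le> d" "heat_type d' (partial_deriv b' q)"
        using heat_type_partial_deriv_Basis[OF Suc.prems(1) b'] .
      have "annihilates_affine (partial_deriv b' q)"
        using Suc.prems(3) by (intro annihilates_affine_deriv[OF Suc.prems(1) _ b']) (auto simp: annihilates_affine_def)
      then have "unif_Cb k (UNIV \<times> {\<epsilon><..}) {f. quad_between a b f} (\<lambda>f. conv f (partial_deriv b' q))"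
        using Suc.prems(2) d' by (intro Suc.IH[of d']) auto
      then show ?thesis
        using e by (subst unif_Cb_cong[OF S, where g = "\<lambda>f. conv f (partial_deriv b' q)"])
          (auto intro!: conv_partial_deriv_Basis[OF quad_between_quad_growth Suc.prems(1) _ b'])
    qed
    moreover have "conv f q differentiable (at p)" if "quad_between a b f" "p \<in> UNIV \<times> {\<epsilon><..}" for f p
      using conv_has_derivative[OF quad_between_quad_growth[OF that(1)] Suc.prems(1), of p] that(2) e
      unfolding differentiable_def by (auto simp: mem_Times_iff)
    ultimately show ?case using bd[OF Suc.prems] by simp
  }
qed

text \<open>This and the next three definitions differentiate the kernel instead of the convolution,
  the form to which the bounds on kernels apply; that they are derivatives of the flow is proved
  below.\<close>

definition heat_grad :: "(real^'n \<Rightarrow> real) \<Rightarrow> (real^'n) \<times> real \<Rightarrow> real^'n" where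
  "heat_grad f p = (\<chi> i. conv f (ddx i heat_kernel) p)"

definition heat_hess :: "(real^'n \<Rightarrow> real) \<Rightarrow> (real^'n) \<times> real \<Rightarrow> real^'n^'n" where
  "heat_hess f p = (\<chi> i j. conv f (ddx j (ddx i heat_kernel)) p)"

definition heat_dt :: "(real^'n \<Rightarrow> real) \<Rightarrow> (real^'n) \<times> real \<Rightarrow> real" where
  "heat_dt f p = conv f (ddt heat_kernel) p"

definition heat_grad_dt :: "(real^'n \<Rightarrow> real) \<Rightarrow> (real^'n) \<times> real \<Rightarrow> real^'n" where
  "heat_grad_dt f p = (\<chi> i. conv f (ddt (ddx i heat_kernel)) p)"

lemma heat_kernel_partial:
  fixes p :: "(real^'n) \<times> real" and i j :: 'n
  defines "r \<equiv> - real CARD('n) / 2" and "Z \<equiv> gauss_mass TYPE('n)"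
  assumes t: "snd p > 0"
  shows "ddx i heat_kernel p = 1 / Z * (- (2 / hc) * (fst p $ i * gauss (r - 1) p))"
    and "ddt heat_kernel p = 1 / Z * (r * gauss (r - 1) p + 1 / hc * ((fst p \<bullet> fst p) * gauss (r - 2) p))"
    and "ddx j (ddx i heat_kernel) p =
      1 / Z * (4 / hc\<^sup>2 * (fst p $ i * fst p $ j * gauss (r - 2) p) - 2 / hc * ((if i = j then 1 else 0) * gauss (r - 1) p))"
proof -
  have d: "((heat_kernel :: (real^'n) \<times> real \<Rightarrow> real) has_derivative (\<lambda>h. 1 / Z * (- (2 / hc) * (fst p \<bullet> fst h) * gauss (r - 1) p +
     snd h * (r * gauss (r - 1) p + 1 / hc * ((fst p \<bullet> fst p) * gauss (r - 2) p))))) (at p)" if "snd p > 0" for p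
    unfolding heat_kernel_def[abs_def] r_def Z_def by (intro has_derivative_mult_right gauss_has_derivative that)
  have 1: "ddx i heat_kernel p = 1 / Z * (- (2 / hc) * (fst p $ i * gauss (r - 1) p))"
    if "snd p > 0" for p and i :: 'n
    by (subst partial_deriv_eq[OF d[OF that]]) (simp add: inner_axis)
  then show "ddx i heat_kernel p = 1 / Z * (- (2 / hc) * (fst p $ i * gauss (r - 1) p))"
    using t .
  show "ddt heat_kernel p = 1 / Z * (r * gauss (r - 1) p + 1 / hc * ((fst p \<bullet> fst p) * gauss (r - 2) p))"
    by (subst partial_deriv_eq[OF d[OF t]]) simp
  have "ddx j (ddx i heat_kernel) p =
     ddx j (\<lambda>p. 1 / Z * (- (2 / hc) * (fst p $ i * gauss (r - 1) p))) p"
    by (rule partial_deriv_cong_open[OF open_upper]) (use t 1 in auto)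
  also have "\<dots> = 1 / Z * (- (2 / hc) * (fst p $ i * (- (2 / hc) * (fst p $ j) * gauss (r - 1 - 1) p) + axis j 1 $ i * gauss (r - 1) p))"
  proof (rule trans[OF partial_deriv_eq])
    show "((\<lambda>p. 1 / Z * (- (2 / hc) * (fst p $ i * gauss (r - 1) p))) has_derivative
      (\<lambda>h. 1 / Z * (- (2 / hc) * (fst p $ i * (- (2 / hc) * (fst p \<bullet> fst h) * gauss (r - 1 - 1) p +
     snd h * ((r - 1) * gauss (r - 1 - 1) p + 1 / hc * ((fst p \<bullet> fst p) * gauss (r - 1 - 2) p))) + fst h $ i * gauss (r - 1) p)))) (at p)"
      by (intro has_derivative_mult_right has_derivative_mult gauss_has_derivative t
         bounded_linear.has_derivative[OF bounded_linear_vec_nth] has_derivative_fst has_derivative_ident)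
  qed (simp add: inner_axis)
  also have "\<dots> = 1 / Z * (4 / hc\<^sup>2 * (fst p $ i * fst p $ j * gauss (r - 2) p) - 2 / hc * ((if i = j then 1 else 0) * gauss (r - 1) p))"
    by (auto simp: axis_def power2_eq_square algebra_simps)
  finally show "ddx j (ddx i heat_kernel) p =
      1 / Z * (4 / hc\<^sup>2 * (fst p $ i * fst p $ j * gauss (r - 2) p) - 2 / hc * ((if i = j then 1 else 0) * gauss (r - 1) p))" .
qed

text \<open>The reason for the value of \<open>hc\<close>: with these factors \<open>sqrt 2\<close>
  times the Laplacian of the kernel matches its time derivative, both in the term with
  \<open>|x|^2\<close> and in the term with the dimension.\<close>

lemma hc_identities: "sqrt 2 * (4 / hc\<^sup>2) = 1 / hc" "sqrt 2 * (2 / hc) = 1 / 2"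
  by (simp_all add: hc_def power2_eq_square field_simps)

lemma heat_kernel_heat_equation:
  fixes p :: "(real^'n) \<times> real"
  assumes t: "snd p > 0"
  shows "ddt heat_kernel p =
    sqrt 2 * (\<Sum>i\<in>UNIV. ddx i (ddx i heat_kernel) p)"
proof -
  define r where "r = - real CARD('n) / 2"
  define Z where "Z = gauss_mass TYPE('n)"
  note k = heat_kernel_partial[OF t, folded r_def Z_def]
  have "sqrt 2 * (\<Sum>i\<in>UNIV. ddx i (ddx i heat_kernel) p) =
     1 / Z * ((sqrt 2 * (4 / hc\<^sup>2)) * ((\<Sum>i\<in>UNIV. fst p $ i * fst p $ i) * gauss (r - 2) p)
        - (sqrt 2 * (2 / hc)) * (real CARD('n) * gauss (r - 1) p))"
  proof -
    have "(\<Sum>i\<in>UNIV. ddx i (ddx i heat_kernel) p) =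
       1 / Z * (4 / hc\<^sup>2 * ((\<Sum>i\<in>UNIV. fst p $ i * fst p $ i) * gauss (r - 2) p) - 2 / hc * (real CARD('n) * gauss (r - 1) p))"
      by (simp only: k sum_distrib_left[symmetric] sum_subtractf sum_distrib_right[symmetric] refl if_True) simp
    then show ?thesis by (simp only: right_diff_distrib mult_ac)
  qed
  also have "\<dots> = ddt heat_kernel p"
    unfolding hc_identities k by (simp add: inner_vec_def r_def)
  finally show ?thesis by simp
qed

lemma heat_type_kernel_derivs:
  shows "heat_type (- real CARD('n) - 1) (ddx i (heat_kernel :: (real^'n) \<times> real \<Rightarrow> real))"
    and "heat_type (- real CARD('n) - 2) (ddx j (ddx i (heat_kernel :: (real^'n) \<times> real \<Rightarrow> real)))"
    and "heat_type (- real CARD('n) - 3) (ddt (ddx i (heat_kernel :: (real^'n) \<times> real \<Rightarrow> real)))"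
    and "heat_type (- real CARD('n) - 2) (ddt (heat_kernel :: (real^'n) \<times> real \<Rightarrow> real))"
  using heat_type_space_deriv[OF heat_type_heat_kernel[where 'n = 'n], of i]
    heat_type_space_deriv[OF heat_type_space_deriv[OF heat_type_heat_kernel[where 'n = 'n], of i], of j]
    heat_type_time_deriv[OF heat_type_space_deriv[OF heat_type_heat_kernel[where 'n = 'n], of i]]
    heat_type_time_deriv[OF heat_type_heat_kernel[where 'n = 'n]]
  by (simp_all add: algebra_simps)

text \<open>The heat flow reproduces affine functions, so one space derivative of the kernel sends
  them to a component of the slope and the time derivative sends them to 0. One more derivative
  removes that constant.\<close>

lemma annihilates_affine_kernel_derivs:
  shows "annihilates_affine (ddx j (ddx i (heat_kernel :: (real^'n) \<times> real \<Rightarrow> real)))"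
    and "annihilates_affine (ddt (ddx i (heat_kernel :: (real^'n) \<times> real \<Rightarrow> real)))"
    and "annihilates_affine (ddt (heat_kernel :: (real^'n) \<times> real \<Rightarrow> real))"
proof -
  have d: "((\<lambda>p. \<alpha> + \<beta> \<bullet> fst p) has_derivative (\<lambda>h. \<beta> \<bullet> fst h)) (at p)" for \<alpha> and \<beta> :: "real^'n" and p :: "(real^'n) \<times> real"
    by (auto intro!: derivative_eq_intros)
  have *: "conv (\<lambda>z. \<alpha> + \<beta> \<bullet> z) (partial_deriv b heat_kernel) p = \<beta> \<bullet> fst b"
    if "b \<in> Basis" "snd p > 0" for \<alpha> and \<beta> :: "real^'n" and p b
  proof -
    have "conv (\<lambda>z. \<alpha> + \<beta> \<bullet> z) (partial_deriv b heat_kernel) p = partial_deriv b (conv (\<lambda>z. \<alpha> + \<beta> \<bullet> z) heat_kernel) p"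
      by (rule conv_partial_deriv_Basis[OF quad_growth_affine heat_type_heat_kernel that(2,1), symmetric])
    also have "\<dots> = partial_deriv b (\<lambda>p. \<alpha> + \<beta> \<bullet> fst p) p"
      using that by (intro partial_deriv_cong_open[OF open_upper]) (auto intro: conv_affine_heat_kernel)
    also have "\<dots> = \<beta> \<bullet> fst b" by (rule partial_deriv_eq[OF d])
    finally show ?thesis .
  qed
  have B: "(axis i 1, 0) \<in> (Basis :: ((real^'n) \<times> real) set)" "(0, 1) \<in> (Basis :: ((real^'n) \<times> real) set)" for i
    by (auto simp: Basis_space_time)
  show "annihilates_affine (ddx j (ddx i (heat_kernel :: (real^'n) \<times> real \<Rightarrow> real)))"
    by (rule annihilates_affine_deriv[OF heat_type_kernel_derivs(1) _ B(1)]) (use *[OF B(1)] in blast)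
  show "annihilates_affine (ddt (ddx i (heat_kernel :: (real^'n) \<times> real \<Rightarrow> real)))"
    by (rule annihilates_affine_deriv[OF heat_type_kernel_derivs(1) _ B(2)]) (use *[OF B(1)] in blast)
  show "annihilates_affine (ddt (heat_kernel :: (real^'n) \<times> real \<Rightarrow> real))"
    unfolding annihilates_affine_def using *[OF B(2)] by simp
qed

lemma heat_flow_has_derivative:
  assumes f: "quad_growth f" and t: "snd p > 0"
  shows "(conv f heat_kernel has_derivative (\<lambda>h. heat_grad f p \<bullet> fst h + snd h * heat_dt f p)) (at p)"
  using conv_has_derivative[OF f heat_type_heat_kernel t]
  by (simp add: heat_grad_def heat_dt_def inner_vec_def mult.commute)

lemma heat_grad_has_derivative:
  assumes f: "quad_growth f" and t: "snd p > 0"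
  shows "(heat_grad f has_derivative (\<lambda>h. heat_hess f p *v fst h + snd h *\<^sub>R heat_grad_dt f p)) (at p)"
proof (subst has_derivative_componentwise_within, rule ballI)
  fix b :: "real^'a" assume "b \<in> Basis"
  then obtain k where b: "b = axis k 1" by (auto simp: Basis_vec_def)
  show "((\<lambda>x. heat_grad f x \<bullet> b) has_derivative (\<lambda>h. (heat_hess f p *v fst h + snd h *\<^sub>R heat_grad_dt f p) \<bullet> b)) (at p)"
    using conv_has_derivative[OF f heat_type_kernel_derivs(1)[of k] t]
    by (simp add: b inner_axis heat_grad_def heat_hess_def heat_grad_dt_def matrix_vector_mult_def mult.commute)
qed

text \<open>The explicit second derivatives of the kernel are symmetric in the two indices.\<close>

lemma heat_hess_symmetric: "snd p > 0 \<Longrightarrow> transpose (heat_hess f p) = heat_hess f p"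
  by (auto simp: vec_eq_iff transpose_def heat_hess_def heat_kernel_partial mult_ac intro!: conv_cong)

lemma heat_dt_eq:
  fixes f :: "real^'n \<Rightarrow> real"
  assumes f: "quad_growth f" and t: "snd p > 0"
  shows "heat_dt f p = sqrt 2 * trace (heat_hess f p)"
proof -
  have "heat_dt f p = conv f (\<lambda>p. sqrt 2 * (\<Sum>i\<in>UNIV. ddx i (ddx i heat_kernel) p)) p"
    unfolding heat_dt_def using t by (intro conv_cong heat_kernel_heat_equation) simp
  also have "\<dots> = sqrt 2 * (\<Sum>i\<in>UNIV. conv f (ddx i (ddx i heat_kernel)) p)"
    by (rule conv_sum[OF f heat_type_kernel_derivs(2) t])
  finally show ?thesis by (simp add: trace_def heat_hess_def)
qed

lemma heat_slice_derivatives: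
  assumes f: "quad_growth f" and t: "t > 0"
  shows "((\<lambda>y. conv f heat_kernel (y, t)) has_derivative (\<lambda>h. heat_grad f (y, t) \<bullet> h)) (at y)"
    and "((\<lambda>y. heat_grad f (y, t)) has_derivative (\<lambda>h. heat_hess f (y, t) *v h)) (at y)"
  using has_derivative_slice[OF heat_flow_has_derivative[OF f, of "(y, t)"]]
    has_derivative_slice[OF heat_grad_has_derivative[OF f, of "(y, t)"]] t by simp_all

lemma heat_hess_bounds:
  assumes f: "quad_between a b f" and t: "snd p > 0"
  shows "a * (h \<bullet> h) \<le> h \<bullet> (heat_hess f p *v h)" "h \<bullet> (heat_hess f p *v h) \<le> b * (h \<bullet> h)"
  using hessian_bounds_from_second_differences[OF heat_slice_derivatives[OF quad_between_quad_growth[OF f] t]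
      heat_evolution_second_difference[OF f t], of h "fst p"] by simp_all

lemma heat_flow_quad_at:
  assumes f: "quad_between a b f" and t: "t > 0"
  shows "quad_at a b (\<lambda>y. conv f heat_kernel (y, t)) y (heat_grad f (y, t))"
  using heat_hess_bounds[OF f, of "(_, t)"] t
  by (intro quad_at_gradient[OF heat_slice_derivatives[OF quad_between_quad_growth[OF f] t]]) auto

lemma heat_flow_quad_between:
  "quad_between a b f \<Longrightarrow> t > 0 \<Longrightarrow> quad_between a b (\<lambda>y. conv f heat_kernel (y, t))"
  using heat_flow_quad_at unfolding quad_between_def by blast

section \<open>The inverse Legendre transform of the heat flow\<close>

definition heat_hess_inv :: "(real^'n \<Rightarrow> real) \<Rightarrow> (real^'n) \<times> real \<Rightarrow> real^'n^'n" where
  "heat_hess_inv f p = matrix_inv (heat_hess f p)"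

text \<open>For admissible \<open>f\<close> and positive time, a right inverse of the map from (y,
  t) to (\<open>heat_grad f\<close> (y, t), t), by \<open>heat_grad_leg_point\<close>.\<close>

definition leg_point :: "(real^'n \<Rightarrow> real) \<Rightarrow> (real^'n) \<times> real \<Rightarrow> (real^'n) \<times> real" where
  "leg_point f p = (legmax (\<lambda>y. conv f heat_kernel (y, snd p)) (fst p), snd p)"

text \<open>The inverse of the block triangular Jacobian of the map inverted by
  \<open>leg_point\<close>, written as a function of the image point \<open>q\<close> as
  \<open>unif_Cb_compose\<close> requires.\<close>

definition leg_point_deriv :: "(real^'n \<Rightarrow> real) \<Rightarrow> (real^'n) \<times> real \<Rightarrow> (real^'n) \<times> real \<Rightarrow> (real^'n) \<times> real" where
  "leg_point_deriv f q h = (heat_hess_inv f q *v (fst h - snd h *\<^sub>R heat_grad_dt f q), snd h)"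

definition leg_sol :: "(real^'n \<Rightarrow> real) \<Rightarrow> (real^'n) \<times> real \<Rightarrow> real" where
  "leg_sol f p = legendre (\<lambda>y. conv f heat_kernel (y, snd p)) (fst p) - (fst p \<bullet> fst p) / 2"

lemma snd_leg_point [simp]: "snd (leg_point f p) = snd p"
  by (simp add: leg_point_def)

context
  fixes f :: "real^'n \<Rightarrow> real" and a b :: real
  assumes f: "quad_between a b f" and ab: "0 < a" "0 < b"
begin

lemma heat_hess_inv:
  assumes t: "snd p > 0"
  shows "heat_hess f p ** heat_hess_inv f p = mat 1" "heat_hess_inv f p ** heat_hess f p = mat 1"
    and "norm (heat_hess_inv f p *v v) \<le> norm v / a"
proof -
  obtain B where B: "B ** heat_hess f p = mat 1" "heat_hess f p ** B = mat 1" "\<And>v. norm (B *v v) \<le> norm v / a"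
    using positive_definite_inverse[OF ab(1) heat_hess_bounds(1)[OF f t]] by blast
  have "heat_hess f p ** heat_hess_inv f p = mat 1 \<and> heat_hess_inv f p ** heat_hess f p = mat 1"
    unfolding heat_hess_inv_def matrix_inv_def by (rule someI[of _ B]) (use B in simp)
  then show i: "heat_hess f p ** heat_hess_inv f p = mat 1" "heat_hess_inv f p ** heat_hess f p = mat 1" by simp_all
  have "heat_hess_inv f p = B" using B i by (metis matrix_mul_assoc matrix_mul_lid matrix_mul_rid)
  then show "norm (heat_hess_inv f p *v v) \<le> norm v / a" using B by simp
qed

lemma heat_grad_leg_point:
  assumes t: "snd p > 0"
  shows "heat_grad f (leg_point f p) = fst p"
  unfolding leg_point_def
  by (rule gradient_at_legmax[OF heat_flow_quad_at[OF f t] ab(2)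
      is_legmax_legmax[OF heat_flow_quad_between[OF f t] ab(1)]])

text \<open>Strong monotonicity of the gradient bounds \<open>a\<close> times the distance of two
  maximisers by the difference of the gradients at a common time. Comparing with the fixed point
  \<open>y\<close> at the varying time reduces the claim to continuity of
  \<open>heat_grad\<close>.\<close>

lemma leg_point_continuous:
  assumes t: "snd p > 0"
  shows "continuous (at p) (leg_point f)"
proof -
  define y where "y = fst (leg_point f p)"
  have yp: "leg_point f p = (y, snd p)" by (simp add: y_def leg_point_def)
  have est: "norm (fst (leg_point f p') - y) \<le> norm (fst p' - heat_grad f (y, snd p')) / a" if t': "snd p' > 0" for p'
  proof -
    define y' where "y' = fst (leg_point f p')"
    have g: "heat_grad f (y', snd p') = fst p'"
      using heat_grad_leg_point[OF t'] by (simp add: y'_def leg_point_def)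
    have "a * ((y' - y) \<bullet> (y' - y)) \<le> (fst p' - heat_grad f (y, snd p')) \<bullet> (y' - y)"
      using quad_at_strongly_monotone[OF heat_flow_quad_at[OF f t', of y'] heat_flow_quad_at[OF f t', of y]] g by simp
    also have "\<dots> \<le> norm (fst p' - heat_grad f (y, snd p')) * norm (y' - y)" by (rule norm_cauchy_schwarz)
    finally have "a * norm (y' - y) * norm (y' - y) \<le> norm (fst p' - heat_grad f (y, snd p')) * norm (y' - y)"
      by (simp add: power2_norm_eq_inner[symmetric] power2_eq_square mult.assoc)
    then have "a * norm (y' - y) \<le> norm (fst p' - heat_grad f (y, snd p'))"
      by (cases "y' = y") (simp_all add: mult_le_cancel_right)
    then show ?thesis using ab by (simp add: y'_def field_simps)
  qed
  have "((\<lambda>p'. fst (leg_point f p') - y) \<longlongrightarrow> 0) (at p)"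
  proof (rule Lim_null_comparison)
    have "\<forall>\<^sub>F p' in at p. p' \<in> {p'. snd p' > 0}"
      using t by (intro eventually_at_in_open' open_upper) simp
    then show "\<forall>\<^sub>F p' in at p. norm (fst (leg_point f p') - y) \<le> norm (fst p' - heat_grad f (y, snd p')) / a"
      by eventually_elim (use est in simp)
    have "isCont (heat_grad f) (y, snd p)"
      using heat_grad_has_derivative[OF quad_between_quad_growth[OF f], of "(y, snd p)"] t
      by (intro has_derivative_continuous) auto
    then have "((\<lambda>p'. heat_grad f (y, snd p')) \<longlongrightarrow> heat_grad f (y, snd p)) (at p)"
      by (rule isCont_tendsto_compose) (auto intro!: tendsto_intros)
    moreover have "heat_grad f (y, snd p) = fst p" using heat_grad_leg_point[OF t] by (simp add: yp)
    ultimately show "((\<lambda>p'. norm (fst p' - heat_grad f (y, snd p')) / a) \<longlongrightarrow> 0) (at p)"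
      using ab by (auto intro!: tendsto_eq_intros)
  qed
  then have "((\<lambda>p'. fst (leg_point f p')) \<longlongrightarrow> y) (at p)" by (rule Lim_null[THEN iffD2])
  then have "((\<lambda>p'. (fst (leg_point f p'), snd p')) \<longlongrightarrow> (y, snd p)) (at p)"
    by (intro tendsto_intros)
  moreover have "(\<lambda>p'. (fst (leg_point f p'), snd p')) = leg_point f"
    by (rule ext) (simp add: leg_point_def)
  ultimately show ?thesis by (simp add: continuous_at yp)
qed

lemma leg_point_has_derivative:
  assumes t: "snd p > 0"
  shows "(leg_point f has_derivative leg_point_deriv f (leg_point f p)) (at p)"
proof (rule has_derivative_inverse_basic)
  let ?q = "leg_point f p"
  have tq: "snd ?q > 0" using t by simp
  show "((\<lambda>q. (heat_grad f q, snd q)) has_derivative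
     (\<lambda>h. (heat_hess f ?q *v fst h + snd h *\<^sub>R heat_grad_dt f ?q, snd h))) (at ?q)"
    by (intro has_derivative_Pair heat_grad_has_derivative[OF quad_between_quad_growth[OF f] tq]
        has_derivative_snd has_derivative_ident)
  show "bounded_linear (leg_point_deriv f ?q)"
    unfolding leg_point_deriv_def[abs_def]
    by (intro bounded_linear_Pair bounded_linear_compose[OF matrix_vector_mul_bounded_linear]
        bounded_linear_sub bounded_linear_fst bounded_linear_snd bounded_linear_scaleR_const)
  show "leg_point_deriv f ?q \<circ> (\<lambda>h. (heat_hess f ?q *v fst h + snd h *\<^sub>R heat_grad_dt f ?q, snd h)) = id"
    using heat_hess_inv(2)[OF tq]
    by (simp add: fun_eq_iff leg_point_deriv_def matrix_vector_mul_assoc)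
  show "continuous (at p) (leg_point f)" by (rule leg_point_continuous[OF t])
  show "open {p :: (real^'n) \<times> real. snd p > 0}" by (rule open_upper)
  show "(heat_grad f (leg_point f z), snd (leg_point f z)) = z" if "z \<in> {p. snd p > 0}" for z
    using heat_grad_leg_point[of z] that by simp
qed (use t in simp)

text \<open>Envelope argument: the gradient of the flow at \<open>leg_point f p\<close> is
  \<open>fst p\<close>, so the terms containing the derivative of \<open>leg_point\<close>
  cancel.\<close>

lemma leg_sol_has_derivative:
  assumes t: "snd p > 0"
  shows "(leg_sol f has_derivative (\<lambda>h. (fst (leg_point f p) - fst p) \<bullet> fst h - snd h * heat_dt f (leg_point f p))) (at p)"
proof -
  let ?q = "leg_point f p"
  have eq: "leg_sol f = (\<lambda>p. fst p \<bullet> fst (leg_point f p) - conv f heat_kernel (leg_point f p) - (fst p \<bullet> fst p) / 2)"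
    by (rule ext) (simp add: leg_sol_def legendre_def leg_point_def)
  note L = leg_point_has_derivative[OF t]
  have 1: "((\<lambda>p. fst p \<bullet> fst (leg_point f p)) has_derivative
     (\<lambda>h. fst p \<bullet> fst (leg_point_deriv f ?q h) + fst h \<bullet> fst ?q)) (at p)"
    by (intro has_derivative_inner has_derivative_fst has_derivative_ident L)
  have "(conv f heat_kernel has_derivative (\<lambda>h. heat_grad f ?q \<bullet> fst h + snd h * heat_dt f ?q)) (at ?q)"
    using t by (intro heat_flow_has_derivative[OF quad_between_quad_growth[OF f]]) simp
  from has_derivative_compose[OF L this]
  have 2: "((\<lambda>p. conv f heat_kernel (leg_point f p)) has_derivative
      (\<lambda>h. fst p \<bullet> fst (leg_point_deriv f ?q h) + snd h * heat_dt f ?q)) (at p)"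
    by (simp add: heat_grad_leg_point[OF t]) (simp add: leg_point_deriv_def)
  have 3: "((\<lambda>p::(real^'n) \<times> real. (fst p \<bullet> fst p) / 2) has_derivative (\<lambda>h. fst p \<bullet> fst h)) (at p)"
    by (auto intro!: derivative_eq_intros simp: inner_commute)
  show ?thesis
    unfolding eq by (rule has_derivative_eq_rhs[OF has_derivative_diff[OF has_derivative_diff[OF 1 2] 3]])
      (simp add: fun_eq_iff inner_diff_left inner_diff_right inner_commute)
qed

lemma leg_sol_gradient_has_derivative:
  assumes t: "snd p > 0"
  shows "((\<lambda>p. (fst (leg_point f p) - fst p) $ i) has_derivative
    (\<lambda>h. (fst (leg_point_deriv f (leg_point f p) h) - fst h) $ i)) (at p)"
  by (intro bounded_linear.has_derivative[OF bounded_linear_vec_nth] has_derivative_diff has_derivative_fst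
      leg_point_has_derivative[OF t] has_derivative_ident)

lemma leg_sol_partial_deriv:
  assumes t: "snd p > 0"
  shows "ddx i (leg_sol f) p = (fst (leg_point f p) - fst p) $ i"
    and "ddt (leg_sol f) p = - heat_dt f (leg_point f p)"
    and "ddx j (\<lambda>p. (fst (leg_point f p) - fst p) $ i) p =
      heat_hess_inv f (leg_point f p) $ i $ j - (if i = j then 1 else 0)"
    and "ddt (\<lambda>p. (fst (leg_point f p) - fst p) $ i) p =
      - (heat_hess_inv f (leg_point f p) *v heat_grad_dt f (leg_point f p)) $ i"
proof -
  show "ddx i (leg_sol f) p = (fst (leg_point f p) - fst p) $ i"
    "ddt (leg_sol f) p = - heat_dt f (leg_point f p)"
    by (subst partial_deriv_eq[OF leg_sol_has_derivative[OF assms]]; simp add: inner_axis)+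
  show "ddx j (\<lambda>p. (fst (leg_point f p) - fst p) $ i) p =
      heat_hess_inv f (leg_point f p) $ i $ j - (if i = j then 1 else 0)"
    by (subst partial_deriv_eq[OF leg_sol_gradient_has_derivative[OF assms]])
      (simp add: leg_point_deriv_def matrix_vector_mult_basis column_def, simp add: axis_def)
  show "ddt (\<lambda>p. (fst (leg_point f p) - fst p) $ i) p =
      - (heat_hess_inv f (leg_point f p) *v heat_grad_dt f (leg_point f p)) $ i"
    by (subst partial_deriv_eq[OF leg_sol_gradient_has_derivative[OF assms]])
      (simp add: leg_point_deriv_def linear_neg[OF matrix_vector_mul_linear])
qed

lemma leg_sol_second_partials:
  assumes t: "t > 0"
  shows "iter_partial [i, j] (\<lambda>y. leg_sol f (y, t)) x =
    heat_hess_inv f (leg_point f (x, t)) $ j $ i - (if j = i then 1 else 0)"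
proof -
  have p: "snd (y, t) > 0" for y :: "real^'n" using t by simp
  note pd = leg_sol_partial_deriv[OF p]
  have d: "leg_sol f differentiable (at (y, t))" for y
    using leg_sol_has_derivative[OF p] unfolding differentiable_def by blast
  have dg: "(\<lambda>p. (fst (leg_point f p) - fst p) $ j) differentiable (at (y, t))" for y
    using leg_sol_gradient_has_derivative[OF p] unfolding differentiable_def by blast
  have "partial_deriv (axis j 1) (\<lambda>y. leg_sol f (y, t)) = (\<lambda>y. (\<lambda>p. (fst (leg_point f p) - fst p) $ j) (y, t))"
    by (rule ext) (simp add: partial_deriv_slice[OF d] pd(1))
  then have "iter_partial [i, j] (\<lambda>y. leg_sol f (y, t)) x =
      partial_deriv (axis i 1) (\<lambda>y. (\<lambda>p. (fst (leg_point f p) - fst p) $ j) (y, t)) x"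
    by (simp add: iter_partial_def)
  also have "\<dots> = heat_hess_inv f (leg_point f (x, t)) $ j $ i - (if j = i then 1 else 0)"
    by (subst partial_deriv_slice[OF dg]) (rule pd(3))
  finally show ?thesis .
qed

lemma heat_hess_inv_symmetric:
  assumes t: "snd p > 0"
  shows "transpose (heat_hess_inv f p) = heat_hess_inv f p"
  by (rule symmetric_inverse[OF heat_hess_symmetric[OF t] heat_hess_inv(2)[OF t]])

lemma leg_sol_hessian:
  assumes t: "t > 0"
  shows "hessian (\<lambda>y. leg_sol f (y, t)) x = heat_hess_inv f (leg_point f (x, t)) - mat 1"
proof -
  let ?B = "heat_hess_inv f (leg_point f (x, t))"
  have "transpose ?B = ?B" using t by (intro heat_hess_inv_symmetric) simp
  then have "?B $ j $ i = ?B $ i $ j" for i j by (metis transpose_def vec_lambda_beta)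
  then show ?thesis
    by (simp add: hessian_def leg_sol_second_partials[OF t] vec_eq_iff mat_def)
qed

lemma leg_sol_loewner:
  assumes t: "t > 0"
  shows "loewner_le (mat (- 1 + 1 / b)) (hessian (\<lambda>y. leg_sol f (y, t)) x)"
    and "loewner_le (hessian (\<lambda>y. leg_sol f (y, t)) x) (mat (1 / a - 1))"
proof -
  let ?q = "leg_point f (x, t)"
  let ?A = "heat_hess_inv f ?q - mat 1"
  have tq: "snd ?q > 0" using t by simp
  have "transpose ?A = ?A" using heat_hess_inv_symmetric[OF tq]
    by (simp add: vec_eq_iff transpose_def mat_def eq_commute)
  moreover have "(- 1 + 1 / b) * (v \<bullet> v) \<le> v \<bullet> (?A *v v)" "v \<bullet> (?A *v v) \<le> (1 / a - 1) * (v \<bullet> v)" for v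
    using inverse_quadratic_form_bounds[OF heat_hess_symmetric[OF tq] heat_hess_inv(1)[OF tq] ab
        heat_hess_bounds[OF f tq], of v]
    by (simp_all add: matrix_vector_mult_diff_rdistrib inner_diff_right left_diff_distrib distrib_right)
  moreover have "transpose (mat c) = (mat c :: real^'n^'n)" for c by simp
  ultimately show "loewner_le (mat (- 1 + 1 / b)) (hessian (\<lambda>y. leg_sol f (y, t)) x)"
    "loewner_le (hessian (\<lambda>y. leg_sol f (y, t)) x) (mat (1 / a - 1))"
    unfolding loewner_le_def leg_sol_hessian[OF t]
    using loewner_quadratic_form(1)[of "- 1 + 1 / b" ?A] loewner_quadratic_form(2)[of ?A "1 / a - 1"] by blast+
qed

text \<open>The identity plus the Hessian of the solution is the inverse of the heat Hessian, so
  \<open>F_pi4\<close> is \<open>- sqrt 2\<close> times the trace of the heat Hessian. By the heat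
  equation this is minus the time derivative of the flow, as the envelope formula demands.\<close>

lemma leg_sol_time_derivative:
  assumes t: "t > 0"
  shows "((\<lambda>s. leg_sol f (x, s)) has_real_derivative F_pi4 (hessian (\<lambda>y. leg_sol f (y, t)) x)) (at t)"
proof -
  let ?q = "leg_point f (x, t)"
  have tq: "snd ?q > 0" using t by simp
  have s: "((\<lambda>s. (x, s)) has_derivative (\<lambda>\<tau>. (0, \<tau>))) (at t)" by (auto intro!: derivative_eq_intros)
  have "F_pi4 (hessian (\<lambda>y. leg_sol f (y, t)) x) = - sqrt 2 * trace (heat_hess f ?q)"
  proof (rule F_pi4_eq_trace)
    show "transpose (hessian (\<lambda>y. leg_sol f (y, t)) x) = hessian (\<lambda>y. leg_sol f (y, t)) x"
      using leg_sol_loewner(1)[OF t] by (simp add: loewner_le_def)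
    show "heat_hess f ?q ** (mat 1 + hessian (\<lambda>y. leg_sol f (y, t)) x) = mat 1"
      using heat_hess_inv(1)[OF tq] by (simp add: leg_sol_hessian[OF t])
  qed
  also have "\<dots> = - heat_dt f ?q" by (simp add: heat_dt_eq[OF quad_between_quad_growth[OF f] tq])
  finally have e: "F_pi4 (hessian (\<lambda>y. leg_sol f (y, t)) x) = - heat_dt f ?q" .
  have "snd (x, t) > 0" using t by simp
  from has_derivative_compose[OF s leg_sol_has_derivative[OF this]]
  show ?thesis unfolding has_field_derivative_def e
    by (rule has_derivative_eq_rhs) (simp add: fun_eq_iff mult.commute)
qed

end

lemma leg_sol_near_initial:
  assumes ab: "0 < a" "0 < b"
  obtains C where "\<And>f x t. quad_between a b f \<Longrightarrow> t > 0 \<Longrightarrow>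
     \<bar>leg_sol f (x, t) - (legendre f (x::real^'n) - (x \<bullet> x) / 2)\<bar> \<le> C * t"
proof -
  obtain C where C: "\<And>f y t. quad_between a b f \<Longrightarrow> t > 0 \<Longrightarrow> \<bar>conv f heat_kernel (y, t) - f (y::real^'n)\<bar> \<le> C * t"
    by (rule heat_evolution_near_initial[of a b]) (use ab in auto)
  have "\<bar>leg_sol f (x, t) - (legendre f x - (x \<bullet> x) / 2)\<bar> \<le> C * t" if f: "quad_between a b f" and t: "t > 0"
    for f t and x :: "real^'n"
    using legendre_diff_le[OF heat_flow_quad_between[OF f t] f ab(1) C[OF f t], of x] by (simp add: leg_sol_def)
  then show ?thesis using that by blast
qed

section \<open>Smoothness and uniform derivative bounds of the back-transformed flow\<close>

context
  fixes a b \<epsilon> :: real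
  assumes ab: "0 < a" "0 < b" and eps: "\<epsilon> > 0"
begin

definition Q_class :: "(real^'n \<Rightarrow> real) set" where "Q_class = {f. quad_between a b f}"

definition later :: "((real^'n) \<times> real) set" where "later = UNIV \<times> {\<epsilon><..}"

lemma open_later: "open later"
  unfolding later_def by (intro open_Times) auto

lemma Q_classD: "f \<in> Q_class \<Longrightarrow> quad_between a b f" by (simp add: Q_class_def)

lemma laterD: "p \<in> later \<Longrightarrow> snd p > 0" using eps by (auto simp: later_def)

lemma unif_Cb_heat_hess: "unif_Cb k later Q_class (\<lambda>f p. heat_hess f p $ i $ j)"
  and unif_Cb_heat_grad_dt: "unif_Cb k later Q_class (\<lambda>f p. heat_grad_dt f p $ i)"
  and unif_Cb_heat_dt: "unif_Cb k later Q_class (heat_dt :: (real^'n \<Rightarrow> real) \<Rightarrow> _)"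
  unfolding heat_hess_def heat_grad_dt_def heat_dt_def[abs_def] vec_lambda_beta later_def Q_class_def
  using ab eps
  by (auto intro!: unif_Cb_conv heat_type_kernel_derivs annihilates_affine_kernel_derivs)

lemma unif_Cb_heat_hess_inv: "unif_Cb k later Q_class (\<lambda>f p. heat_hess_inv f p $ i $ j)"
proof (rule unif_Cb_matrix_inverse[OF open_later unif_Cb_heat_hess])
  fix f :: "real^'n \<Rightarrow> real" and p :: "(real^'n) \<times> real" assume *: "f \<in> Q_class" "p \<in> later"
  note h = heat_hess_inv[OF Q_classD[OF *(1)] ab laterD[OF *(2)]]
  show "heat_hess f p ** heat_hess_inv f p = mat 1" by (rule h)
  show "\<bar>heat_hess_inv f p $ i $ j\<bar> \<le> 1 / a" for i j by (rule matrix_entry_le[OF h(3)])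
qed

lemma unif_Cb_leg_point_deriv:
  "unif_Cb k later Q_class (\<lambda>f q. leg_point_deriv f q h \<bullet> c)"
proof -
  have "leg_point_deriv f q h \<bullet> c =
    (\<Sum>i\<in>UNIV. fst c $ i * (\<Sum>j\<in>UNIV. heat_hess_inv f q $ i $ j * (fst h $ j + (- snd h) * heat_grad_dt f q $ j))) + snd h * snd c" for f q
    by (simp add: leg_point_deriv_def inner_prod_def inner_vec_def matrix_vector_mult_def mult.commute)
  moreover have "unif_Cb k later Q_class (\<lambda>f q.
    (\<Sum>i\<in>UNIV. fst c $ i * (\<Sum>j\<in>UNIV. heat_hess_inv f q $ i $ j * (fst h $ j + (- snd h) * heat_grad_dt f q $ j))) + snd h * snd c)"
    by (intro unif_Cb_add[OF open_later] unif_Cb_sum[OF open_later] unif_Cb_mult[OF open_later]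
        unif_Cb_const[OF open_later] unif_Cb_heat_hess_inv unif_Cb_heat_grad_dt)
  ultimately show ?thesis by simp
qed

text \<open>\<open>unif_Cb_compose\<close> applies because \<open>leg_point\<close> preserves time,
  hence maps \<open>later\<close> into itself, and its derivative is a bounded function of the image
  point.\<close>

lemma unif_Cb_compose_leg_point:
  assumes "unif_Cb k later Q_class g"
  shows "unif_Cb k later Q_class (\<lambda>f p. g f (leg_point f p))"
proof (rule unif_Cb_compose[OF open_later _ _ unif_Cb_leg_point_deriv assms])
  fix f :: "real^'n \<Rightarrow> real" and p :: "(real^'n) \<times> real" assume *: "f \<in> Q_class" "p \<in> later"
  show "leg_point f p \<in> later" using *(2) by (simp add: later_def leg_point_def mem_Times_iff)
  show "(leg_point f has_derivative leg_point_deriv f (leg_point f p)) (at p)"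
    by (rule leg_point_has_derivative[OF Q_classD[OF *(1)] ab laterD[OF *(2)]])
qed

text \<open>\<open>leg_sol\<close> and its space gradient may be unbounded, so they fall outside
  \<open>unif_Cb\<close>. Two orders are peeled off by hand, until only bounded functions composed
  with \<open>leg_point\<close> remain.\<close>

lemma leg_sol_Ck_on_later:
  fixes f :: "real^'n \<Rightarrow> real"
  assumes f: "f \<in> Q_class"
  shows "Ck_on (Suc (Suc k)) later (leg_sol f)"
proof -
  note d = leg_sol_has_derivative[OF Q_classD[OF f] ab laterD]
  note dg = leg_sol_gradient_has_derivative[OF Q_classD[OF f] ab laterD]
  note pd = leg_sol_partial_deriv[OF Q_classD[OF f] ab laterD]
  have smooth: "Ck_on k later (\<lambda>p. g f (leg_point f p))" if "\<And>k. unif_Cb k later Q_class g" for k g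
    using unif_Cb_imp_Ck_on[OF unif_Cb_compose_leg_point[OF that] f] .
  have t: "Ck_on (Suc k) later (ddt (leg_sol f))"
  proof (subst Ck_on_cong[OF open_later pd(2)])
    show "Ck_on (Suc k) later (\<lambda>p. - heat_dt f (leg_point f p))"
      using smooth[OF unif_Cb_cmult[OF open_later unif_Cb_heat_dt, of _ "- 1"], of "Suc k"]
      by (simp del: Ck_on.simps)
  qed
  have x: "Ck_on (Suc k) later (ddx i (leg_sol f))" for i :: 'n
  proof (subst Ck_on_cong[OF open_later pd(1)])
    have j: "Ck_on k later (ddx j (\<lambda>p. (fst (leg_point f p) - fst p) $ i))" for j :: 'n
    proof (subst Ck_on_cong[OF open_later pd(3)])
      have "unif_Cb k later Q_class (\<lambda>f q. heat_hess_inv f q $ i $ j + - (if i = j then 1 else 0))" for k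
        by (intro unif_Cb_add[OF open_later] unif_Cb_const[OF open_later] unif_Cb_heat_hess_inv)
      from smooth[OF this, of k]
      show "Ck_on k later (\<lambda>p. heat_hess_inv f (leg_point f p) $ i $ j - (if i = j then 1 else 0))"
        by (simp only: add_uminus_conv_diff)
    qed
    have j': "Ck_on k later (ddt (\<lambda>p. (fst (leg_point f p) - fst p) $ i))"
    proof (subst Ck_on_cong[OF open_later pd(4)])
      have "unif_Cb k later Q_class (\<lambda>f q. (- 1) * (\<Sum>j\<in>UNIV. heat_hess_inv f q $ i $ j * heat_grad_dt f q $ j))" for k
        by (intro unif_Cb_sum[OF open_later] unif_Cb_mult[OF open_later]
            unif_Cb_const[OF open_later] unif_Cb_heat_hess_inv unif_Cb_heat_grad_dt)
      from smooth[OF this]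
      show "Ck_on k later (\<lambda>p. - (heat_hess_inv f (leg_point f p) *v heat_grad_dt f (leg_point f p)) $ i)"
        by (simp add: matrix_vector_mult_def)
    qed
    have "(\<lambda>p. (fst (leg_point f p) - fst p) $ i) differentiable (at p)" if "p \<in> later" for p
      using dg[OF that] unfolding differentiable_def by blast
    then show "Ck_on (Suc k) later (\<lambda>p. (fst (leg_point f p) - fst p) $ i)"
      using j j' by (auto simp: Basis_space_time)
  qed
  have "leg_sol f differentiable (at p)" if "p \<in> later" for p
    using d[OF that] unfolding differentiable_def by blast
  then show ?thesis using t x unfolding Ck_on.simps(2)[of "Suc k"] by (auto simp del: Ck_on.simps simp: Basis_space_time)
qed

text \<open>Induction on the index list, whose head is the derivative applied last. Lists of length
  two give the entries of the inverse Hessian; each further index differentiates the witness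
  \<open>H\<close>, which lives in space-time and is bounded to every order.\<close>

lemma iter_partial_leg_sol:
  fixes ks :: "'n::finite list"
  assumes "length ks \<ge> 2"
  shows "\<exists>H. (\<forall>k. unif_Cb k later Q_class H) \<and>
    (\<forall>f\<in>Q_class. \<forall>x t. t > \<epsilon> \<longrightarrow> iter_partial ks (\<lambda>y::real^'n. leg_sol f (y, t)) x = H f (x, t))"
  using assms
proof (induction ks)
  case (Cons i js)
  have mem: "(y, t) \<in> later" if "t > \<epsilon>" for y :: "real^'n" and t using that by (simp add: later_def)
  show ?case
  proof (cases "length js \<ge> 2")
    case True
    then obtain H where H: "\<And>k. unif_Cb k later Q_class H"
      "\<And>f x t. f \<in> Q_class \<Longrightarrow> t > \<epsilon> \<Longrightarrow> iter_partial js (\<lambda>y::real^'n. leg_sol f (y, t)) x = H f (x, t)"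
      using Cons.IH by blast
    have B: "(axis i 1, 0) \<in> (Basis :: ((real^'n) \<times> real) set)" by (simp add: Basis_space_time)
    show ?thesis
    proof (intro exI[of _ "\<lambda>f. ddx i (H f)"] conjI allI ballI impI)
      show "unif_Cb k later Q_class (\<lambda>f. ddx i (H f))" for k
        using H(1)[of "Suc k"] B by simp
      fix f :: "real^'n \<Rightarrow> real" and x t assume f: "f \<in> Q_class" and t: "t > \<epsilon>"
      have d: "H f differentiable (at (x, t))" using H(1)[of "Suc 0"] f mem[OF t] by simp
      have "iter_partial js (\<lambda>y::real^'n. leg_sol f (y, t)) = (\<lambda>y. H f (y, t))" using H(2)[OF f t] by blast
      then show "iter_partial (i # js) (\<lambda>y::real^'n. leg_sol f (y, t)) x = ddx i (H f) (x, t)"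
        using partial_deriv_slice[OF d] by (simp add: iter_partial_def)
    qed
  next
    case False
    then obtain j where js: "js = [j]" using Cons.prems by (cases js; cases "tl js") auto
    show ?thesis
    proof (intro exI[of _ "\<lambda>f p. heat_hess_inv f (leg_point f p) $ j $ i + - (if j = i then 1 else 0)"] conjI allI ballI impI)
      show "unif_Cb k later Q_class (\<lambda>f p. heat_hess_inv f (leg_point f p) $ j $ i + - (if j = i then 1 else 0))" for k
        by (intro unif_Cb_add[OF open_later] unif_Cb_const[OF open_later]
            unif_Cb_compose_leg_point[OF unif_Cb_heat_hess_inv])
      fix f :: "real^'n \<Rightarrow> real" and x t assume f: "f \<in> Q_class" and t: "t > \<epsilon>"
      show "iter_partial (i # js) (\<lambda>y::real^'n. leg_sol f (y, t)) x =
          heat_hess_inv f (leg_point f (x, t)) $ j $ i + - (if j = i then 1 else 0)"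
        using leg_sol_second_partials[OF Q_classD[OF f] ab, of t i j x] t eps by (simp add: js)
    qed
  qed
qed simp

lemma deriv_norm_leg_sol_bounded:
  assumes "l \<ge> 2"
  shows "\<exists>C. \<forall>f\<in>Q_class. \<forall>x t. t > \<epsilon> \<longrightarrow> deriv_norm l (\<lambda>y::real^'n. leg_sol f (y, t)) x \<le> C"
proof -
  have "\<exists>C. \<forall>f\<in>Q_class. \<forall>x t. t > \<epsilon> \<longrightarrow> \<bar>iter_partial is (\<lambda>y::real^'n. leg_sol f (y, t)) x\<bar> \<le> C"
    if len: "length is = l" for "is"
  proof -
    obtain H where H: "\<And>k. unif_Cb k later Q_class H"
      "\<And>f x t. f \<in> Q_class \<Longrightarrow> t > \<epsilon> \<Longrightarrow> iter_partial is (\<lambda>y::real^'n. leg_sol f (y, t)) x = H f (x, t)"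
      using iter_partial_leg_sol[of "is"] len assms by blast
    obtain C where "\<forall>f\<in>Q_class. \<forall>p\<in>later. \<bar>H f p\<bar> \<le> C" using unif_Cb_bounded[OF H(1)] by blast
    then have "\<bar>iter_partial is (\<lambda>y::real^'n. leg_sol f (y, t)) x\<bar> \<le> C" if "f \<in> Q_class" "t > \<epsilon>" for f x t
      using that by (simp add: H(2) later_def)
    then show ?thesis by blast
  qed
  then obtain C where C: "\<And>is f x t. length is = l \<Longrightarrow> f \<in> Q_class \<Longrightarrow> t > \<epsilon> \<Longrightarrow>
      \<bar>iter_partial is (\<lambda>y::real^'n. leg_sol f (y, t)) x\<bar> \<le> C is" by metis
  have "deriv_norm l (\<lambda>y::real^'n. leg_sol f (y, t)) x \<le> (\<Sum>is\<in>{is. length is = l}. C is)"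
    if "f \<in> Q_class" "t > \<epsilon>" for f x t
    unfolding deriv_norm_def by (rule order_trans[OF L2_set_le_sum_abs]) (use C that in \<open>auto intro!: sum_mono\<close>)
  then show ?thesis by blast
qed

end

section \<open>Existence and derivative bounds\<close>

lemma hessian_bounds_quad_between:
  fixes u0 :: "real^'n \<Rightarrow> real"
  assumes C2: "Ck_on 2 UNIV u0" and H: "hessian_bounds \<rho> \<zeta> u0"
  shows "quad_between \<zeta> (\<rho> + 1) (\<lambda>x. u0 x + (x \<bullet> x) / 2)"
  unfolding quad_between_def
proof
  fix x
  define G where "G = (\<lambda>x. \<chi> i. partial_deriv (axis i 1) u0 x)"
  have e: "h \<bullet> (h v* A) = h \<bullet> (A *v h)" for h and A :: "real^'n^'n"
    using dot_lmul_matrix[of h A h] by (simp add: inner_commute)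
  have "quad_at (- 1 + \<zeta>) \<rho> u0 x (G x)"
    unfolding G_def
  proof (rule quad_at_gradient[OF C2_gradient_hessian[OF C2]])
    fix x h
    show "(- 1 + \<zeta>) * (h \<bullet> h) \<le> h \<bullet> (h v* hessian u0 x)" "h \<bullet> (h v* hessian u0 x) \<le> \<rho> * (h \<bullet> h)"
      using H loewner_quadratic_form[where 'n = 'n] unfolding e hessian_bounds_def loewner_le_def by blast+
  qed
  then have "quad_at \<zeta> (\<rho> + 1) (\<lambda>x. u0 x + (x \<bullet> x) / 2) x (G x + x)"
    unfolding quad_at_def
  proof (rule all_forward)
    fix z
    have z: "z \<bullet> z / 2 = x \<bullet> x / 2 + x \<bullet> (z - x) + (z - x) \<bullet> (z - x) / 2"
      by (simp add: inner_diff_left inner_diff_right inner_commute field_simps)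
    assume "u0 x + G x \<bullet> (z - x) + (- 1 + \<zeta>) / 2 * ((z - x) \<bullet> (z - x)) \<le> u0 z \<and>
      u0 z \<le> u0 x + G x \<bullet> (z - x) + \<rho> / 2 * ((z - x) \<bullet> (z - x))"
    then show "u0 x + x \<bullet> x / 2 + (G x + x) \<bullet> (z - x) + \<zeta> / 2 * ((z - x) \<bullet> (z - x)) \<le> u0 z + z \<bullet> z / 2 \<and>
      u0 z + z \<bullet> z / 2 \<le> u0 x + x \<bullet> x / 2 + (G x + x) \<bullet> (z - x) + (\<rho> + 1) / 2 * ((z - x) \<bullet> (z - x))"
      unfolding z inner_add_left by (auto simp: field_simps)
  qed
  then show "\<exists>p. quad_at \<zeta> (\<rho> + 1) (\<lambda>x. u0 x + (x \<bullet> x) / 2) x p" by blast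
qed

text \<open>The uniform bounds degenerate at time 0, but regularity is local and the sets
  \<open>later\<close> \<epsilon> exhaust the positive times.\<close>

lemma leg_sol_smooth:
  fixes f :: "real^'n \<Rightarrow> real"
  assumes f: "quad_between a b f" and ab: "0 < a" "0 < b"
  shows "smooth_on (UNIV \<times> {0<..}) (leg_sol f)"
  unfolding smooth_on_def
proof
  fix k
  have eq: "(UNIV \<times> {0<..} :: ((real^'n) \<times> real) set) = \<Union> (later ` {0<..})"
  proof -
    have "\<exists>\<epsilon>>0. \<epsilon> < t" if "t > 0" for t :: real using that by (intro exI[of _ "t / 2"]) auto
    then show ?thesis by (auto simp: later_def)
  qed
  show "Ck_on k (UNIV \<times> {0<..}) (leg_sol f)"
    unfolding eq
  proof (rule Ck_on_Union)
    fix T :: "((real^'n) \<times> real) set" assume "T \<in> later ` {0<..}"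
    then obtain \<epsilon> where e: "\<epsilon> > 0" "T = later \<epsilon>" by auto
    show "open T" unfolding e(2) by (rule open_later[OF ab e(1)])
    have "Ck_on (Suc (Suc k)) (later \<epsilon>) (leg_sol f)"
      by (rule leg_sol_Ck_on_later[OF ab e(1)]) (simp add: Q_class_def[OF ab e(1)] f)
    then show "Ck_on k T (leg_sol f)" unfolding e(2) 
      using Ck_on_Suc_imp[OF open_later[OF ab e(1)]] by blast
  qed
qed

text \<open>The initial value is put in by hand, since the kernel has no value at time 0.\<close>

definition flow_solution :: "(real^'n \<Rightarrow> real) \<Rightarrow> real^'n \<Rightarrow> real \<Rightarrow> real" where
  "flow_solution u0 x t = (if t > 0 then leg_sol (legendre (\<lambda>x. u0 x + (x \<bullet> x) / 2)) (x, t) else u0 x)"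

lemma flow_solution_solves:
  fixes u0 :: "real^'n \<Rightarrow> real"
  assumes \<rho>: "\<rho> > 0" and \<zeta>: "0 < \<zeta>" and C2: "Ck_on 2 UNIV u0" and H: "hessian_bounds \<rho> \<zeta> u0"
  shows "solves_cauchy \<rho> \<zeta> u0 (flow_solution u0)"
proof -
  define w where "w = (\<lambda>x. u0 x + (x \<bullet> x) / 2)"
  define f where "f = legendre w"
  define a where "a = 1 / (\<rho> + 1)"
  define b where "b = 1 / \<zeta>"
  have ab: "0 < a" "0 < b" using \<rho> \<zeta> by (auto simp: a_def b_def)
  have w: "quad_between \<zeta> (\<rho> + 1) w" unfolding w_def by (rule hessian_bounds_quad_between[OF C2 H])
  have f: "quad_between a b f" unfolding f_def a_def b_def using quad_between_legendre[OF w \<zeta>] \<rho> by simp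
  have lf: "legendre f x = w x" for x unfolding f_def using legendre_legendre[OF w \<zeta>] \<rho> by simp
  have sol: "flow_solution u0 x t = leg_sol f (x, t)" if "t > 0" for x t
    using that by (simp add: flow_solution_def f_def w_def)
  have sol': "(\<lambda>y. flow_solution u0 y t) = (\<lambda>y. leg_sol f (y, t))" if "t > 0" for t
    using sol[OF that] by blast
  have smooth: "smooth_on (UNIV \<times> {0<..}) (leg_sol f)" by (rule leg_sol_smooth[OF f ab])
  have op: "open (UNIV \<times> {0<..} :: ((real^'n) \<times> real) set)" by (intro open_Times) auto
  have s1: "smooth_on (UNIV \<times> {0<..}) (\<lambda>(x, t). flow_solution u0 x t)"
    unfolding smooth_on_def
  proof
    fix k
    show "Ck_on k (UNIV \<times> {0<..}) (\<lambda>(x, t). flow_solution u0 x t)"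
      using smooth by (subst Ck_on_cong[OF op, where g = "leg_sol f"]) (auto simp: sol smooth_on_def)
  qed
  obtain C where C: "\<And>x t. t > 0 \<Longrightarrow> \<bar>leg_sol f (x, t) - (legendre f x - (x \<bullet> x) / 2)\<bar> \<le> C * t"
    using leg_sol_near_initial[OF ab] f by metis
  have near: "\<bar>flow_solution u0 x t - u0 x\<bar> \<le> C * t" if "t \<ge> 0" for x t
  proof (cases "t = 0")
    case False
    then have t: "t > 0" using that by simp
    show ?thesis using C[OF t, of x] by (simp add: sol[OF t] lf w_def)
  qed (simp add: flow_solution_def)
  have cu0: "continuous_on UNIV u0" using Ck_on_continuous[OF open_UNIV C2] .
  have s2: "continuous_on (UNIV \<times> {0..}) (\<lambda>(x, t). flow_solution u0 x t)"
  proof -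
    \<comment> \<open>Continuity is shown for the difference to the initial value: at time 0 it is
      squeezed by \<open>C\<close> times \<open>t\<close>, uniformly in space, and at positive times
      smoothness applies.\<close>
    have "((\<lambda>p. flow_solution u0 (fst p) (snd p) - u0 (fst p)) \<longlongrightarrow> flow_solution u0 (fst p) (snd p) - u0 (fst p))
        (at p within UNIV \<times> {0..})" if p: "p \<in> UNIV \<times> {0..}" for p
    proof (cases "snd p = 0")
      case True
      have "((\<lambda>p. flow_solution u0 (fst p) (snd p) - u0 (fst p)) \<longlongrightarrow> 0) (at p within UNIV \<times> {0..})"
      proof (rule Lim_null_comparison)
        show "\<forall>\<^sub>F p in at p within UNIV \<times> {0..}. norm (flow_solution u0 (fst p) (snd p) - u0 (fst p)) \<le> C * snd p"
          unfolding eventually_at_filter using near by (intro always_eventually) auto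
        have "((\<lambda>p. C * snd p) \<longlongrightarrow> C * snd p) (at p within UNIV \<times> {0..})" by (intro tendsto_intros)
        then show "((\<lambda>p. C * snd p) \<longlongrightarrow> 0) (at p within UNIV \<times> {0..})" using True by simp
      qed
      moreover have "flow_solution u0 (fst p) (snd p) - u0 (fst p) = 0" using True by (simp add: flow_solution_def)
      ultimately show ?thesis by simp
    next
      case False
      then have pt: "p \<in> UNIV \<times> {0<..}" using p by (auto simp: mem_Times_iff)
      have "continuous_on (UNIV \<times> {0<..}) (\<lambda>(x, t). flow_solution u0 x t)"
        using s1 Ck_on_continuous[OF op] unfolding smooth_on_def by blast
      then have "isCont (\<lambda>(x, t). flow_solution u0 x t) p"
        using continuous_on_eq_continuous_at[OF op] pt by blast
      moreover have "isCont (\<lambda>p. u0 (fst p)) p"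
        using cu0 by (intro continuous_on_interior[of UNIV]) (auto intro!: continuous_on_compose2[OF cu0] continuous_intros)
      ultimately have "isCont (\<lambda>p. flow_solution u0 (fst p) (snd p) - u0 (fst p)) p"
        by (intro isCont_diff) (simp_all add: case_prod_beta')
      then show ?thesis unfolding isCont_def by (rule tendsto_within_subset) simp
    qed
    then have "continuous_on (UNIV \<times> {0..}) (\<lambda>p. flow_solution u0 (fst p) (snd p) - u0 (fst p))"
      unfolding continuous_on_def by blast
    moreover have "continuous_on (UNIV \<times> {0..}) (\<lambda>p. u0 (fst p))"
      by (intro continuous_on_compose2[OF cu0] continuous_intros) auto
    ultimately have "continuous_on (UNIV \<times> {0..}) (\<lambda>p. (flow_solution u0 (fst p) (snd p) - u0 (fst p)) + u0 (fst p))"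
      by (rule continuous_on_add)
    then show ?thesis by (simp add: case_prod_beta')
  qed
  have s3: "((\<lambda>s. flow_solution u0 x s) has_real_derivative F_pi4 (hessian (\<lambda>y. flow_solution u0 y t) x)) (at t)"
    if t: "t > 0" for x t
    unfolding sol'[OF t]
  proof (rule DERIV_cong_ev[THEN iffD1, OF refl _ refl leg_sol_time_derivative[OF f ab t, of x]])
    have "\<forall>\<^sub>F s in nhds t. s \<in> {0<..}" using t by (intro eventually_nhds_in_open) auto
    then show "\<forall>\<^sub>F s in nhds t. leg_sol f (x, s) = flow_solution u0 x s"
      by eventually_elim (simp add: sol)
  qed
  have s4: "hessian_bounds \<rho> \<zeta> (\<lambda>y. flow_solution u0 y t)" if t: "t > 0" for t
    unfolding hessian_bounds_def sol'[OF t] using leg_sol_loewner[OF f ab t] by (simp add: a_def b_def)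
  have s5: "flow_solution u0 x 0 = u0 x" for x by (simp add: flow_solution_def)
  show ?thesis
    unfolding solves_cauchy_def by (intro conjI allI impI s1 s2 s3 s4 s5)
qed

lemma solves_cauchy_unique:
  assumes \<zeta>: "\<zeta> > 0" and "solves_cauchy \<rho> \<zeta> u0 u" "solves_cauchy \<rho> \<zeta> u0 v" "t \<ge> 0"
  shows "v x t = u x t"
proof (cases "t = 0")
  case True
  then show ?thesis using assms by (simp add: solves_cauchy_def)
next
  case False
  then have "t > 0" using assms by simp
  then show ?thesis
    using solves_cauchy_comparison[OF \<zeta> assms(2,3)] solves_cauchy_comparison[OF \<zeta> assms(3,2)] by (intro antisym)
qed

theorem theorem1p2:
  fixes \<rho> \<zeta> :: real
  assumes "\<rho> > 0" and "0 < \<zeta>" and "\<zeta> < \<rho> + 1"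
  shows "(\<forall>u0 :: real^'n \<Rightarrow> real.
            Ck_on 2 UNIV u0 \<and> hessian_bounds \<rho> \<zeta> u0 \<longrightarrow>
            (\<exists>u. solves_cauchy \<rho> \<zeta> u0 u \<and>
                 (\<forall>v. solves_cauchy \<rho> \<zeta> u0 v \<longrightarrow> (\<forall>x. \<forall>t\<ge>0. v x t = u x t)))) \<and>
         (\<forall>l\<ge>3. \<forall>\<epsilon>\<^sub>0>0. \<exists>C :: real. \<forall>(u0 :: real^'n \<Rightarrow> real) u.
            Ck_on 2 UNIV u0 \<and> hessian_bounds \<rho> \<zeta> u0 \<and> solves_cauchy \<rho> \<zeta> u0 u \<longrightarrow>
            (\<forall>t>\<epsilon>\<^sub>0. \<forall>x. deriv_norm l (\<lambda>y. u y t) x \<le> C))"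
proof (intro conjI allI impI)
  fix u0 :: "real^'n \<Rightarrow> real"
  assume "Ck_on 2 UNIV u0 \<and> hessian_bounds \<rho> \<zeta> u0"
  then have "solves_cauchy \<rho> \<zeta> u0 (flow_solution u0)" using flow_solution_solves[OF assms(1,2)] by blast
  then show "\<exists>u. solves_cauchy \<rho> \<zeta> u0 u \<and> (\<forall>v. solves_cauchy \<rho> \<zeta> u0 v \<longrightarrow> (\<forall>x. \<forall>t\<ge>0. v x t = u x t))"
    using solves_cauchy_unique[OF assms(2)] by blast
next
  fix l :: nat and \<epsilon> :: real
  assume l: "l \<ge> 3" and e: "\<epsilon> > 0"
  define a where "a = 1 / (\<rho> + 1)"
  define b where "b = 1 / \<zeta>"
  have ab: "0 < a" "0 < b" using assms by (auto simp: a_def b_def)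
  \<comment> \<open>The constant is fixed here, before any initial value, from \<open>a\<close>,
    \<open>b\<close>, \<epsilon>, \<open>l\<close> and the dimension alone.\<close>
  obtain C where C: "\<And>f x t. quad_between a b f \<Longrightarrow> t > \<epsilon> \<Longrightarrow> deriv_norm l (\<lambda>y::real^'n. leg_sol f (y, t)) x \<le> C"
    using deriv_norm_leg_sol_bounded[OF ab e, of l, where 'n = 'n] l by (auto simp: Q_class_def[OF ab e])
  show "\<exists>C :: real. \<forall>(u0 :: real^'n \<Rightarrow> real) u.
            Ck_on 2 UNIV u0 \<and> hessian_bounds \<rho> \<zeta> u0 \<and> solves_cauchy \<rho> \<zeta> u0 u \<longrightarrow>
            (\<forall>t>\<epsilon>. \<forall>x. deriv_norm l (\<lambda>y. u y t) x \<le> C)"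
  proof (intro exI[of _ C] allI impI)
    fix u0 :: "real^'n \<Rightarrow> real" and u t x
    assume u: "Ck_on 2 UNIV u0 \<and> hessian_bounds \<rho> \<zeta> u0 \<and> solves_cauchy \<rho> \<zeta> u0 u" and t: "t > \<epsilon>"
    let ?w = "\<lambda>x. u0 x + (x \<bullet> x) / 2"
    have w: "quad_between \<zeta> (\<rho> + 1) ?w" using hessian_bounds_quad_between u by blast
    have f: "quad_between a b (legendre ?w)"
      unfolding a_def b_def using quad_between_legendre[OF w] assms by simp
    have "solves_cauchy \<rho> \<zeta> u0 (flow_solution u0)" using flow_solution_solves[OF assms(1,2)] u by blast
    \<comment> \<open>Uniqueness transfers the bounds from the constructed solution to the given
      one.\<close>
    then have "u y t = flow_solution u0 y t" for y
      using solves_cauchy_unique[OF assms(2), of \<rho> u0 "flow_solution u0" u t y] u t e by simp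
    then have "(\<lambda>y. u y t) = (\<lambda>y. leg_sol (legendre ?w) (y, t))"
      using t e by (simp add: fun_eq_iff flow_solution_def)
    then show "deriv_norm l (\<lambda>y. u y t) x \<le> C" using C[OF f t] by simp
  qed
qed

end
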